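(* Let $(M^n,g)$ be a compact $n$-dimensional Riemannian manifold without boundary, let $\alpha\in(0,n)$, $1<p<\frac n\alpha$, and let $q$ be given by $\frac1q=\frac1p-\frac\alpha n$. Then $$N_{p,\alpha,M}\ \ge\ N_{p,\alpha}.$$
   Context: For $x,y\in M^n$, $|x-y|_g$ denotes the distance from $x$ to $y$ on $M^n$ under the metric $g$, and $dV$ (written $dV_x$, $dV_y$ according to the integration variable) is the Riemannian volume measure of $g$. $L^p(M^n)$ is the Lebesgue space with respect to $dV$. For $f\in L^p(M^n)$, $$I_\alpha f(x)=\int_{M^n}\frac{f(y)}{|x-y|_g^{n-\alpha}}\,dV_y .$$ It is known that $I_\alpha$ is bounded from $L^p(M^n)$ to $L^q(M^n)$ (Hardy-Littlewood-Sobolev inequality on $M^n$). The sharp constant is $$N_{p,\alpha,M}:=\sup\Bigl\{\frac{\|I_\alpha f\|_{L^q(M^n)}}{\|f\|_{L^p(M^n)}}:\ f\in L^p(M^n)\setminus\{0\}\Bigr\}.$$ $N_{p,\alpha}$ denotes the corresponding sharp constant on Euclidean $\mathbb{R}^n$ (with Euclidean distance and Lebesgue measure): $$N_{p,\alpha}:=\sup\Bigl\{\frac{\bigl\|\int_{\mathbb{R}^n}f(y)\,|x-y|^{\alpha-n}\,dy\bigr\|_{L^q(\mathbb{R}^n)}}{\|f\|_{L^p(\mathbb{R}^n)}}:\ f\in L^p(\mathbb{R}^n)\setminus\{0\}\Bigr\}.$$ *)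

theory Defs
  imports "HOL-Analysis.Analysis"
begin

text \<open>Smooth functions on an open set \<open>S\<close>, by iterating directional derivatives.\<close>

primrec Ck_on :: "nat \<Rightarrow> ('a::real_normed_vector \<Rightarrow> 'b::real_normed_vector) \<Rightarrow> 'a set \<Rightarrow> bool" where
  "Ck_on 0 f S \<longleftrightarrow> continuous_on S f"
| "Ck_on (Suc k) f S \<longleftrightarrow>
     (\<forall>x\<in>S. f differentiable (at x)) \<and>
     (\<forall>v. Ck_on k (\<lambda>x. frechet_derivative f (at x) v) S)"

definition smooth_on :: "'a set \<Rightarrow> ('a::real_normed_vector \<Rightarrow> 'b::real_normed_vector) \<Rightarrow> bool" where
  "smooth_on S f \<longleftrightarrow> (\<forall>k. Ck_on k f S)"

text \<open>
  A chart is a pair of its domain and its coordinate map; the values of the coordinate map off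
  the domain are irrelevant. The dimension of the manifold is \<open>CARD('n)\<close>.
  A Riemannian metric is given by its coefficient matrices: \<open>g c p\<close> is the matrix
  \<open>(g\<^sub>i\<^sub>j(p))\<close> in the chart \<open>c\<close>, with the transformation law of a covariant 2-tensor.
\<close>

type_synonym ('a, 'n) chart = "'a set \<times> ('a \<Rightarrow> real ^ 'n)"

type_synonym ('a, 'n) metric_coeffs = "('a, 'n) chart \<Rightarrow> 'a \<Rightarrow> real ^ 'n ^ 'n"

text \<open>
  All points are interior (charts map onto open subsets of Euclidean space), so there is no
  boundary. Second countability is not required separately: it is automatic when \<open>M\<close> is compact.
\<close>

locale riemannian_manifold =
  fixes M :: "'a::t2_space set"
    and A :: "('a, 'n::finite) chart set"
    and g :: "('a, 'n) metric_coeffs"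
  assumes atlas_cover: "(\<Union>c\<in>A. fst c) = M"
    and chart_open: "(U, \<phi>) \<in> A \<Longrightarrow> openin (top_of_set M) U"
    and chart_image_open: "(U, \<phi>) \<in> A \<Longrightarrow> open (\<phi> ` U)"
    and chart_homeo: "(U, \<phi>) \<in> A \<Longrightarrow> homeomorphism U (\<phi> ` U) \<phi> (inv_into U \<phi>)"
    and transition_smooth:
      "(U, \<phi>) \<in> A \<Longrightarrow> (V, \<psi>) \<in> A \<Longrightarrow> smooth_on (\<phi> ` (U \<inter> V)) (\<psi> \<circ> inv_into U \<phi>)"
    and metric_smooth:
      "(U, \<phi>) \<in> A \<Longrightarrow> smooth_on (\<phi> ` U) (\<lambda>x. g (U, \<phi>) (inv_into U \<phi> x))"
    and metric_symmetric:
      "(U, \<phi>) \<in> A \<Longrightarrow> p \<in> U \<Longrightarrow> transpose (g (U, \<phi>) p) = g (U, \<phi>) p"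
    and metric_pos_def:
      "(U, \<phi>) \<in> A \<Longrightarrow> p \<in> U \<Longrightarrow> v \<noteq> 0 \<Longrightarrow> v \<bullet> (g (U, \<phi>) p *v v) > 0"
    and metric_transform:
      "(U, \<phi>) \<in> A \<Longrightarrow> (V, \<psi>) \<in> A \<Longrightarrow> p \<in> U \<inter> V \<Longrightarrow>
       J = matrix (frechet_derivative (\<psi> \<circ> inv_into U \<phi>) (at (\<phi> p))) \<Longrightarrow>
       g (U, \<phi>) p = transpose J ** g (V, \<psi>) p ** J"

text \<open>On each piece the coordinate representations are \<open>C\<^sup>1\<close> up to the end points,
  with one-sided derivatives there.\<close>

definition C1_curve_on :: "('a::t2_space, 'n::finite) chart set \<Rightarrow> (real \<Rightarrow> 'a) \<Rightarrow> real \<Rightarrow> real \<Rightarrow> bool" where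
  "C1_curve_on A \<gamma> a b \<longleftrightarrow>
     (\<forall>(U, \<phi>)\<in>A. \<exists>D. continuous_on {t \<in> {a..b}. \<gamma> t \<in> U} D \<and>
        (\<forall>t\<in>{a..b}. \<gamma> t \<in> U \<longrightarrow>
           ((\<phi> \<circ> \<gamma>) has_vector_derivative D t) (at t within {a..b})))"

definition piecewise_C1_curve ::
    "'a::t2_space set \<Rightarrow> ('a, 'n::finite) chart set \<Rightarrow> (real \<Rightarrow> 'a) \<Rightarrow> bool" where
  "piecewise_C1_curve M A \<gamma> \<longleftrightarrow>
     continuous_on {0..1} \<gamma> \<and> \<gamma> ` {0..1} \<subseteq> M \<and>
     (\<exists>S. finite S \<and> {0, 1} \<subseteq> S \<and> S \<subseteq> {0..1} \<and>
        (\<forall>a\<in>S. \<forall>b\<in>S. a < b \<and> {a<..<b} \<inter> S = {} \<longrightarrow> C1_curve_on A \<gamma> a b))"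

text \<open>By the transformation law of \<open>g\<close>, the choice of the chart around \<open>\<gamma> t\<close> does not matter
  at points of differentiability; the finitely many break points do not affect the length.\<close>

definition curve_speed ::
    "('a::t2_space, 'n::finite) chart set \<Rightarrow> ('a, 'n) metric_coeffs \<Rightarrow> (real \<Rightarrow> 'a) \<Rightarrow> real \<Rightarrow> real" where
  "curve_speed A g \<gamma> t =
     (let c = (SOME c. c \<in> A \<and> \<gamma> t \<in> fst c);
          v = vector_derivative (snd c \<circ> \<gamma>) (at t)
      in sqrt (v \<bullet> (g c (\<gamma> t) *v v)))"

definition curve_length ::
    "('a::t2_space, 'n::finite) chart set \<Rightarrow> ('a, 'n) metric_coeffs \<Rightarrow> (real \<Rightarrow> 'a) \<Rightarrow> ennreal" where
  "curve_length A g \<gamma> = (\<integral>\<^sup>+t\<in>{0..1}. ennreal (curve_speed A g \<gamma> t) \<partial>lborel)"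

text \<open>The value is \<open>\<infinity>\<close> exactly when the two points lie in different components.\<close>

definition riemannian_dist ::
    "'a::t2_space set \<Rightarrow> ('a, 'n::finite) chart set \<Rightarrow> ('a, 'n) metric_coeffs \<Rightarrow> 'a \<Rightarrow> 'a \<Rightarrow> ennreal" where
  "riemannian_dist M A g x y =
     (INF \<gamma>\<in>{\<gamma>. piecewise_C1_curve M A \<gamma> \<and> \<gamma> 0 = x \<and> \<gamma> 1 = y}. curve_length A g \<gamma>)"

text \<open>The Riemannian volume is the Borel measure given by \<open>sqrt (det g) dx\<close> in every chart.\<close>

definition is_riemannian_volume ::
    "'a::t2_space set \<Rightarrow> ('a, 'n::finite) chart set \<Rightarrow> ('a, 'n) metric_coeffs \<Rightarrow> 'a measure \<Rightarrow> bool" where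
  "is_riemannian_volume M A g \<mu> \<longleftrightarrow>
     space \<mu> = M \<and> sets \<mu> = sets (restrict_space borel M) \<and>
     (\<forall>(U, \<phi>)\<in>A. \<forall>B\<in>sets \<mu>. B \<subseteq> U \<longrightarrow>
        emeasure \<mu> B =
          (\<integral>\<^sup>+x\<in>\<phi> ` B. ennreal (sqrt (det (g (U, \<phi>) (inv_into U \<phi> x)))) \<partial>lborel))"

definition riemannian_volume ::
    "'a::t2_space set \<Rightarrow> ('a, 'n::finite) chart set \<Rightarrow> ('a, 'n) metric_coeffs \<Rightarrow> 'a measure" where
  "riemannian_volume M A g = (THE \<mu>. is_riemannian_volume M A g \<mu>)"

text \<open>The \<open>L\<^sup>p\<close> norm with values in \<open>[0, \<infinity>]\<close>. Functions are real-valued and Borel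
  representatives of the classes.\<close>

definition Lp_norm :: "real \<Rightarrow> 'a measure \<Rightarrow> ('a \<Rightarrow> real) \<Rightarrow> ennreal" where
  "Lp_norm p \<mu> f =
     (let I = (\<integral>\<^sup>+x. ennreal (\<bar>f x\<bar> powr p) \<partial>\<mu>)
      in if I = \<infinity> then \<infinity> else ennreal (enn2real I powr (1 / p)))"

definition Lp_space :: "real \<Rightarrow> 'a measure \<Rightarrow> ('a \<Rightarrow> real) set" where
  "Lp_space p \<mu> = {f \<in> borel_measurable \<mu>. Lp_norm p \<mu> f < \<infinity>}"

definition integral_op :: "'a measure \<Rightarrow> ('a \<Rightarrow> 'a \<Rightarrow> real) \<Rightarrow> ('a \<Rightarrow> real) \<Rightarrow> 'a \<Rightarrow> real" where
  "integral_op \<mu> K f x = (\<integral>y. f y * K x y \<partial>\<mu>)"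

text \<open>The operator norm from \<open>L\<^sup>p\<close> to \<open>L\<^sup>q\<close>, with values in \<open>[0, \<infinity>]\<close>;
  \<open>Lp_norm p \<mu> f \<noteq> 0\<close> says that \<open>f\<close> is not the zero class.\<close>

definition sharp_const ::
    "real \<Rightarrow> real \<Rightarrow> 'a measure \<Rightarrow> ('a \<Rightarrow> 'a \<Rightarrow> real) \<Rightarrow> ennreal" where
  "sharp_const p q \<mu> K =
     (SUP f\<in>{f \<in> Lp_space p \<mu>. Lp_norm p \<mu> f \<noteq> 0}.
        Lp_norm q \<mu> (integral_op \<mu> K f) / Lp_norm p \<mu> f)"

text \<open>On the diagonal both kernels below take the value \<open>0\<close> instead of \<open>\<infinity>\<close>, which does not affect
  the integrals. Points at infinite distance contribute \<open>0\<close>.\<close>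

definition riemannian_kernel ::
    "'a::t2_space set \<Rightarrow> ('a, 'n::finite) chart set \<Rightarrow> ('a, 'n) metric_coeffs \<Rightarrow> real \<Rightarrow> 'a \<Rightarrow> 'a \<Rightarrow> real" where
  "riemannian_kernel M A g \<alpha> x y =
     (let d = riemannian_dist M A g x y
      in if d = \<infinity> then 0 else 1 / enn2real d powr (real CARD('n) - \<alpha>))"

definition euclidean_kernel :: "real \<Rightarrow> real ^ 'n::finite \<Rightarrow> real ^ 'n \<Rightarrow> real" where
  "euclidean_kernel \<alpha> x y = norm (x - y) powr (\<alpha> - real CARD('n))"

definition N_manifold ::
    "'a::t2_space set \<Rightarrow> ('a, 'n::finite) chart set \<Rightarrow> ('a, 'n) metric_coeffs \<Rightarrow> real \<Rightarrow> real \<Rightarrow> real \<Rightarrow> ennreal" where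
  "N_manifold M A g p \<alpha> q =
     sharp_const p q (riemannian_volume M A g) (riemannian_kernel M A g \<alpha>)"

definition N_euclidean :: "'n::finite itself \<Rightarrow> real \<Rightarrow> real \<Rightarrow> real \<Rightarrow> ennreal" where
  "N_euclidean _ p \<alpha> q =
     sharp_const p q (lborel :: (real ^ 'n) measure) (euclidean_kernel \<alpha>)"

end

theory Submission
  imports Defs
begin

text \<open>
Small balls in a Riemannian manifold are almost Euclidean, and the Euclidean inequality does not see
how small they are. This is why the sharp constant of the manifold cannot be smaller than the
Euclidean one.

If \<open>f\<close> on \<open>\<real>\<^sup>n\<close> is replaced by \<open>x \<mapsto> f (x / \<delta>)\<close>, then the \<open>L\<^sup>p\<close> norm of \<open>f\<close> is multiplied by \<open>\<delta> powr (n / p)\<close>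
and the \<open>L\<^sup>q\<close> norm of \<open>I\<^sub>\<alpha> f\<close> by \<open>\<delta> powr (\<alpha> + n / q)\<close>. The two factors agree because of the relation
\<open>1 / q = 1 / p - \<alpha> / n\<close>, so the quotient that defines the constant does not change. A bounded function with
support in a ball can therefore be compressed to an arbitrarily small ball and transplanted to the
manifold by coordinates that are orthonormal at a point. There, volumes and distances differ from
the Euclidean ones by factors close to \<open>1\<close>, and so does the quotient. By monotone convergence, and
since \<open>\<bar>I\<^sub>\<alpha> f\<bar> \<le> I\<^sub>\<alpha> \<bar>f\<bar>\<close>, such functions suffice for the Euclidean constant.

The predicate \<open>euclidean_model\<close> states what the transplantation needs. The lemma
\<open>sharp_const_euclidean_le\<close> derives the comparison of constants from the existence of such models for
all radii and accuracies, and \<open>euclidean_model_exists\<close> constructs them.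

The construction rests on three facts about the manifold. The Riemannian volume is a definite
description, so it has to be shown that there is exactly one measure with the prescribed form in
all charts (\<open>riemannian_volume_exists\<close>, \<open>riemannian_volume_unique\<close>); this uses compactness, for a
finite partition into pieces of charts, and the change of variables formula. The distance is
bounded above by the length of coordinate segments (\<open>riemannian_dist_segment_le\<close>) and below by a
first exit argument (\<open>riemannian_dist_ge\<close>). Finally, it satisfies the triangle inequality
(\<open>riemannian_dist_triangle\<close>) and so is continuous in coordinates, which makes the integrands
measurable.
\<close>

section \<open>Change of variables for an arbitrary finite index type\<close>

text \<open>A copy of a finite type, ordered by an injection into the natural numbers. Passing from an index
type to its copy only renames the coordinates of \<open>\<real>\<^sup>n\<close>, but it gives them a well-order, which
the change of variables formula for differentiable maps asks of them. The lemmas below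
check that renaming coordinates preserves Lebesgue measure and determinants, so that the formula
holds for every finite index type.\<close>

typedef 'n ordered_copy = "UNIV :: 'n set"
  morphisms of_copy to_copy by simp

lemma bij_of_copy: "bij (of_copy :: 'n ordered_copy \<Rightarrow> 'n)"
  by (metis bij_betw_def inj_def of_copy_inject surj_def to_copy_inverse UNIV_I)

instance ordered_copy :: (finite) finite
proof
  have "finite (of_copy ` (UNIV :: 'a ordered_copy set))"
    by simp
  then show "finite (UNIV :: 'a ordered_copy set)"
    using bij_of_copy bij_is_inj finite_imageD by blast
qed

instantiation ordered_copy :: (finite) linorder
begin

definition less_eq_ordered_copy :: "'a ordered_copy \<Rightarrow> 'a ordered_copy \<Rightarrow> bool" where
  "x \<le> y \<longleftrightarrow> to_nat (of_copy x) \<le> to_nat (of_copy y)"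

definition less_ordered_copy :: "'a ordered_copy \<Rightarrow> 'a ordered_copy \<Rightarrow> bool" where
  "x < y \<longleftrightarrow> to_nat (of_copy x) < to_nat (of_copy y)"

instance
proof
  fix x y z :: "'a ordered_copy"
  show "x < y \<longleftrightarrow> x \<le> y \<and> \<not> y \<le> x"
    unfolding less_eq_ordered_copy_def less_ordered_copy_def by linarith
  show "x \<le> x"
    unfolding less_eq_ordered_copy_def by simp
  show "x \<le> z" if "x \<le> y" "y \<le> z"
    using that unfolding less_eq_ordered_copy_def by linarith
  show "x = y" if "x \<le> y" "y \<le> x"
    using that unfolding less_eq_ordered_copy_def
    by (meson injD inj_to_nat le_antisym of_copy_inject)
  show "x \<le> y \<or> y \<le> x"
    unfolding less_eq_ordered_copy_def by linarith
qed

end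

instance ordered_copy :: (finite) wellorder
proof
  fix P :: "'a ordered_copy \<Rightarrow> bool" and a
  assume step: "\<And>x. (\<And>y. y < x \<Longrightarrow> P y) \<Longrightarrow> P x"
  show "P a"
  proof (induction a rule: measure_induct_rule[of "\<lambda>x. to_nat (of_copy x)"])
    case (less x)
    show ?case
    proof (rule step)
      fix y assume "y < x"
      then show "P y"
        unfolding less_ordered_copy_def by (rule less)
    qed
  qed
qed

definition relabel :: "('m \<Rightarrow> 'n) \<Rightarrow> real ^ 'n \<Rightarrow> real ^ 'm" where
  "relabel b x = (\<chi> i. x $ b i)"

lemma linear_relabel: "linear (relabel b :: real ^ 'n::finite \<Rightarrow> real ^ 'm::finite)"
  by (rule linearI) (simp_all add: relabel_def vec_eq_iff)

lemma bounded_linear_relabel: "bounded_linear (relabel b :: real ^ 'n::finite \<Rightarrow> real ^ 'm::finite)"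
  by (simp add: linear_conv_bounded_linear[symmetric] linear_relabel)

lemma relabel_inverse:
  assumes "bij b"
  shows "relabel b (relabel (inv b) x) = x" "relabel (inv b) (relabel b y) = y"
  using assms by (simp_all add: relabel_def vec_eq_iff bij_is_inj bij_is_surj surj_f_inv_f)

lemma relabel_measurable [measurable]:
  "(relabel b :: real ^ 'n::finite \<Rightarrow> real ^ 'm::finite) \<in> borel_measurable borel"
  by (intro borel_measurable_continuous_onI linear_continuous_on bounded_linear_relabel)

text \<open>Renaming coordinates maps boxes to boxes with the same side lengths.\<close>

lemma lborel_relabel:
  assumes b: "bij (b :: 'm::finite \<Rightarrow> 'n::finite)"
  shows "distr lborel borel (relabel b) = (lborel :: (real ^ 'm) measure)"
proof (rule lborel_eqI[symmetric])
  fix l u :: "real ^ 'm"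
  assume le: "\<And>e. e \<in> Basis \<Longrightarrow> l \<bullet> e \<le> u \<bullet> e"
  have le': "l $ i \<le> u $ i" for i
    using le[of "axis i 1"] by (simp add: inner_axis)
  have pre: "relabel b -` box l u = box (relabel (inv b) l) (relabel (inv b) u)"
    (is "?L = ?R")
  proof (intro set_eqI iffI)
    fix x :: "real ^ 'n"
    assume "x \<in> ?L"
    then have "l $ i < x $ b i \<and> x $ b i < u $ i" for i
      by (simp add: mem_box_cart relabel_def)
    from this[of "inv b _"] show "x \<in> ?R"
      using b by (simp add: mem_box_cart relabel_def bij_is_surj surj_f_inv_f)
  next
    fix x :: "real ^ 'n"
    assume "x \<in> ?R"
    then have "l $ inv b i < x $ i \<and> x $ i < u $ inv b i" for i
      by (simp add: mem_box_cart relabel_def)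
    from this[of "b _"] show "x \<in> ?L"
      using b by (simp add: mem_box_cart relabel_def bij_is_inj)
  qed
  have prod_vec: "(\<Prod>e\<in>Basis. (y :: real ^ 'k) \<bullet> e) = (\<Prod>i\<in>UNIV. y $ i)" for y :: "real ^ 'k::finite"
  proof -
    have "(\<Prod>e\<in>Basis. y \<bullet> e) = (\<Prod>e\<in>range (\<lambda>i. axis i 1). y \<bullet> e)"
      by (rule prod.cong) (auto simp: Basis_vec_def)
    also have "\<dots> = (\<Prod>i\<in>UNIV. y $ i)"
      by (subst prod.reindex) (auto simp: inj_on_def axis_eq_axis inner_axis)
    finally show ?thesis .
  qed
  have "emeasure (distr lborel borel (relabel b)) (box l u)
      = emeasure lborel (box (relabel (inv b) l) (relabel (inv b) u))"
    by (subst emeasure_distr) (auto simp: pre)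
  also have "\<dots> = (\<Prod>e\<in>Basis. (relabel (inv b) u - relabel (inv b) l) \<bullet> e)"
    by (rule emeasure_lborel_box)
      (auto simp: Basis_vec_def inner_axis relabel_def intro!: le')
  also have "(\<Prod>e\<in>Basis. (relabel (inv b) u - relabel (inv b) l) \<bullet> e)
      = (\<Prod>i\<in>UNIV. (u - l) $ inv b i)"
    unfolding prod_vec by (simp add: relabel_def)
  also have "\<dots> = (\<Prod>i\<in>UNIV. (u - l) $ i)"
    by (rule prod.reindex_bij_betw) (simp add: b bij_betw_inv_into)
  also have "\<dots> = (\<Prod>e\<in>Basis. (u - l) \<bullet> e)"
    unfolding prod_vec by simp
  finally show "emeasure (distr lborel borel (relabel b)) (box l u) = (\<Prod>e\<in>Basis. (u - l) \<bullet> e)" .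
qed simp

lemma swapidseq_conjugate:
  assumes "swapidseq n p" and b: "bij b"
  shows "swapidseq n (b \<circ> p \<circ> inv b)"
  using assms(1)
proof induction
  case id
  have "b \<circ> id \<circ> inv b = id"
    using bij_is_surj[OF b] by (metis comp_id surj_iff)
  then show ?case
    by (metis swapidseq.id)
next
  case (comp_Suc n p x y)
  have "b \<circ> (Transposition.transpose x y \<circ> p) \<circ> inv b = Transposition.transpose (b x) (b y) \<circ> (b \<circ> p \<circ> inv b)"
    using b by (auto simp: fun_eq_iff Transposition.transpose_def bij_is_inj inj_eq)
  moreover have "b x \<noteq> b y"
    using comp_Suc.hyps b by (simp add: bij_is_inj inj_eq)
  ultimately show ?case
    using swapidseq.comp_Suc[OF comp_Suc.IH] by metis
qed

lemma sign_conjugate: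
  assumes "permutation p" and "bij b"
  shows "sign (b \<circ> p \<circ> inv b) = sign p"
proof -
  obtain n where n: "swapidseq n p"
    using assms(1) by (auto simp: permutation_def)
  show ?thesis
    using evenperm_unique[OF n refl] evenperm_unique[OF swapidseq_conjugate[OF n assms(2)] refl]
    by (simp add: sign_def)
qed

text \<open>In the Leibniz formula, conjugation by \<open>b\<close> is a sign-preserving bijection between the permutations
of the two index types.\<close>

lemma det_relabel:
  fixes A :: "real ^ 'n::finite ^ 'n" and b :: "'m::finite \<Rightarrow> 'n"
  assumes b: "bij b"
  shows "det (\<chi> i j. A $ b i $ b j :: real ^ 'm ^ 'm) = det A"
proof -
  define h where "h p = b \<circ> p \<circ> inv b" for p
  have bb: "b (inv b x) = x" "inv b (b y) = y" for x y
    using b by (simp_all add: bij_is_inj bij_is_surj surj_f_inv_f)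
  have perm: "p permutes UNIV \<longleftrightarrow> bij p" for p :: "'x \<Rightarrow> 'x"
    using bij_imp_permutes[of p UNIV] permutes_bij[of p UNIV] by auto
  have bij_h: "bij_betw h {p. p permutes UNIV} {p. p permutes UNIV}"
  proof (rule bij_betwI[where g = "\<lambda>p. inv b \<circ> p \<circ> b"])
    show "h \<in> {p. p permutes UNIV} \<rightarrow> {p. p permutes UNIV}"
      using b by (auto simp: h_def perm intro!: bij_comp bij_imp_bij_inv)
    show "(\<lambda>p. inv b \<circ> p \<circ> b) \<in> {p. p permutes UNIV} \<rightarrow> {p. p permutes UNIV}"
      using b by (auto simp: perm intro!: bij_comp bij_imp_bij_inv)
  qed (simp_all add: h_def fun_eq_iff bb)
  have "det (\<chi> i j. A $ b i $ b j :: real ^ 'm ^ 'm)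
      = (\<Sum>p\<in>{p. p permutes UNIV}. of_int (sign (h p)) * (\<Prod>i\<in>UNIV. A $ i $ h p i))"
    unfolding det_def
  proof (rule sum.cong[OF refl])
    fix p :: "'m \<Rightarrow> 'm"
    assume "p \<in> {p. p permutes UNIV}"
    then have p: "permutation p"
      using permutation_permutes finite by blast
    have "(\<Prod>i\<in>UNIV. A $ b i $ b (p i)) = (\<Prod>i\<in>UNIV. A $ b i $ h p (b i))"
      by (simp add: h_def bb)
    also have "\<dots> = (\<Prod>i\<in>UNIV. A $ i $ h p i)"
      by (rule prod.reindex_bij_betw[OF b])
    finally show "of_int (sign p) * (\<Prod>i\<in>UNIV. (\<chi> i j. A $ b i $ b j :: real ^ 'm ^ 'm) $ i $ p i)
        = of_int (sign (h p)) * (\<Prod>i\<in>UNIV. A $ i $ h p i)"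
      by (simp add: sign_conjugate[OF p b] h_def)
  qed
  also have "\<dots> = det A"
    unfolding det_def by (rule sum.reindex_bij_betw[OF bij_h])
  finally show ?thesis .
qed

text \<open>The formula for the Henstock--Kurzweil integral speaks of sets of finite measure only. The Jacobian
is integrable exactly when the image has finite measure, so the two sides are also infinite at the
same time.\<close>

lemma emeasure_differentiable_image_wellorder:
  fixes f :: "real ^ 'n::{finite,wellorder} \<Rightarrow> real ^ 'n::_"
  assumes S: "S \<in> sets borel" and fS: "f ` S \<in> sets borel"
    and der: "\<And>x. x \<in> S \<Longrightarrow> (f has_derivative f' x) (at x within S)"
    and inj: "inj_on f S"
    and meas: "(\<lambda>x. indicator S x * \<bar>det (matrix (f' x))\<bar>) \<in> borel_measurable borel"
  shows "emeasure lborel (f ` S) = (\<integral>\<^sup>+x. ennreal (indicator S x * \<bar>det (matrix (f' x))\<bar>) \<partial>lborel)"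
    (is "_ = ?I")
proof -
  have iff: "f ` S \<in> lmeasurable \<and> measure lebesgue (f ` S) = m
     \<longleftrightarrow> ((\<lambda>x. \<bar>det (matrix (f' x))\<bar>) has_integral m) S" for m
    using S by (intro has_measure_differentiable_image der inj) auto
  have uniq: "((\<lambda>x. \<bar>det (matrix (f' x))\<bar>) has_integral m) S \<longleftrightarrow>
      ((\<lambda>x. indicator S x * \<bar>det (matrix (f' x))\<bar>) has_integral m) UNIV" for m
    by (subst has_integral_restrict_UNIV[symmetric])
      (rule arg_cong[where f = "\<lambda>F. (F has_integral m) UNIV"], auto simp: indicator_def)
  have em: "emeasure lebesgue (f ` S) = emeasure lborel (f ` S)"
    using fS by simp
  show ?thesis
  proof (cases "?I < \<infinity>")
    case True
    then obtain r where r: "?I = ennreal r" "0 \<le> r"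
      by (cases ?I) auto
    have "((\<lambda>x. indicator S x * \<bar>det (matrix (f' x))\<bar>) has_integral r) UNIV"
      by (rule nn_integral_has_integral[OF meas _ r]) auto
    with iff[of r] uniq have "f ` S \<in> lmeasurable" "measure lebesgue (f ` S) = r"
      by auto
    then show ?thesis
      using r em emeasure_eq_measure2[of "f ` S" lebesgue] by simp
  next
    case False
    have "emeasure lborel (f ` S) = \<infinity>"
    proof (rule ccontr)
      assume "emeasure lborel (f ` S) \<noteq> \<infinity>"
      then have "f ` S \<in> lmeasurable"
        using fS em by (auto simp: fmeasurable_def top.not_eq_extremum)
      with iff uniq have "((\<lambda>x. indicator S x * \<bar>det (matrix (f' x))\<bar>)
          has_integral measure lebesgue (f ` S)) UNIV"
        by blast
      from nn_integral_has_integral_lborel[OF meas _ this] False show False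
        by auto
    qed
    with False show ?thesis
      by (auto simp: less_top[symmetric])
  qed
qed

lemma emeasure_differentiable_image:
  fixes f :: "real ^ 'n::finite \<Rightarrow> real ^ 'n::_"
  assumes S: "S \<in> sets borel" and fS: "f ` S \<in> sets borel"
    and der: "\<And>x. x \<in> S \<Longrightarrow> (f has_derivative f' x) (at x within S)"
    and inj: "inj_on f S"
    and meas: "(\<lambda>x. indicator S x * \<bar>det (matrix (f' x))\<bar>) \<in> borel_measurable borel"
  shows "emeasure lborel (f ` S) = (\<integral>\<^sup>+x. ennreal (indicator S x * \<bar>det (matrix (f' x))\<bar>) \<partial>lborel)"
proof -
  define b :: "'n ordered_copy \<Rightarrow> 'n" where "b = of_copy"
  have b: "bij b"
    by (simp add: b_def bij_of_copy)
  define r where "r = relabel b"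
  define s where "s = relabel (inv b)"
  have rs [simp]: "r (s x) = x" "s (r y) = y" for x y
    using relabel_inverse[OF b] by (simp_all add: r_def s_def)
  have [measurable]: "r \<in> borel_measurable borel" "s \<in> borel_measurable borel"
    by (simp_all add: r_def s_def)
  have dr: "distr lborel borel r = lborel"
    by (simp add: r_def lborel_relabel[OF b])
  have bl: "bounded_linear r" "bounded_linear s"
    by (simp_all add: r_def s_def bounded_linear_relabel)
  have r_image: "r ` X = s -` X" for X
    by (auto simp: image_iff) (metis rs(1))
  have r_borel: "r ` X \<in> sets borel" if "X \<in> sets borel" for X
    using measurable_sets[of s borel borel X] that by (simp add: r_image)
  have r_emeasure: "emeasure lborel (r ` X) = emeasure lborel X" if X: "X \<in> sets borel" for X
  proof -
    have "emeasure lborel (r ` X) = emeasure (distr lborel borel r) (r ` X)"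
      by (simp add: r_def lborel_relabel[OF b])
    also have "\<dots> = emeasure lborel (r -` (r ` X))"
      by (subst emeasure_distr) (use X r_borel in auto)
    also have "r -` (r ` X) = X"
      by (auto simp: image_iff) (metis rs(2))
    finally show ?thesis .
  qed
  define F where "F = r \<circ> f \<circ> s"
  define F' where "F' y = r \<circ> f' (s y) \<circ> s" for y
  have det_F': "det (matrix (F' y)) = det (matrix (f' (s y)))" for y
  proof -
    have "matrix (F' y) = (\<chi> i j. matrix (f' (s y)) $ b i $ b j)"
    proof -
      have *: "s (axis j 1) = axis (b j) 1" for j
        using b by (auto simp: s_def relabel_def axis_def vec_eq_iff bij_is_inj bij_is_surj surj_f_inv_f)
      then show ?thesis
        by (simp add: matrix_def F'_def r_def relabel_def *)
    qed
    then show ?thesis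
      by (simp add: det_relabel[OF b])
  qed
  have F_image: "F ` r ` S = r ` f ` S"
    by (simp add: F_def image_comp o_def)
  have ind: "indicator (r ` S) y = (indicator S (s y) :: real)" for y
    by (auto simp: indicator_def image_iff) (metis rs(1))
  have meas_s: "(\<lambda>y. indicator S (s y) * \<bar>det (matrix (f' (s y)))\<bar>) \<in> borel_measurable borel"
    by (rule measurable_compose[OF _ meas]) simp
  have "emeasure lborel (f ` S) = emeasure lborel (F ` r ` S)"
    using fS by (simp add: F_image r_emeasure)
  also have "\<dots> = (\<integral>\<^sup>+y. ennreal (indicator (r ` S) y * \<bar>det (matrix (F' y))\<bar>) \<partial>lborel)"
  proof (rule emeasure_differentiable_image_wellorder)
    show "r ` S \<in> sets borel" "F ` r ` S \<in> sets borel"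
      using S fS by (simp_all add: F_image r_borel)
    show "inj_on F (r ` S)"
    proof (rule inj_onI)
      fix y y' assume y: "y \<in> r ` S" "y' \<in> r ` S" and eq: "F y = F y'"
      have "s (r (f (s y))) = s (r (f (s y')))"
        using eq by (simp add: F_def)
      then have "f (s y) = f (s y')"
        by simp
      moreover have "s y \<in> S" "s y' \<in> S"
        using y by auto
      ultimately have "s y = s y'"
        by (rule inj_onD[OF inj])
      then have "r (s y) = r (s y')"
        by (rule arg_cong)
      then show "y = y'"
        by simp
    qed
    show "(\<lambda>y. indicator (r ` S) y * \<bar>det (matrix (F' y))\<bar>) \<in> borel_measurable borel"
      using meas_s by (simp add: ind det_F')
    fix y
    assume "y \<in> r ` S"
    then have sy: "s y \<in> S"
      by auto
    have img: "s ` r ` S = S"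
      by (simp add: image_comp o_def)
    have 1: "(s has_derivative s) (at y within r ` S)"
      by (rule bounded_linear_imp_has_derivative[OF bl(2)])
    have 2: "(f has_derivative f' (s y)) (at (s y) within s ` r ` S)"
      unfolding img by (rule der[OF sy])
    have "((r \<circ> (f \<circ> s)) has_derivative r \<circ> (f' (s y) \<circ> s)) (at y within r ` S)"
      by (intro diff_chain_within 1 2 bounded_linear_imp_has_derivative[OF bl(1)])
    then show "(F has_derivative F' y) (at y within r ` S)"
      by (simp add: F_def F'_def o_assoc)
  qed
  also have "\<dots> = (\<integral>\<^sup>+y. ennreal (indicator S (s y) * \<bar>det (matrix (f' (s y)))\<bar>) \<partial>distr lborel borel r)"
    by (simp add: ind det_F' dr)
  also have "\<dots> = (\<integral>\<^sup>+x. ennreal (indicator S (s (r x)) * \<bar>det (matrix (f' (s (r x))))\<bar>) \<partial>lborel)"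
    by (rule nn_integral_distr) (use meas_s in \<open>simp_all add: measurable_compose[OF _ measurable_ennreal]\<close>)
  finally show ?thesis
    by simp
qed


text \<open>The formula for the measure of images says that two measures agree: Lebesgue measure restricted to
\<open>f ` S\<close>, and the image under \<open>f\<close> of the measure on \<open>S\<close> with the Jacobian as density. Integrating
\<open>u\<close> against both gives the claim for every nonnegative \<open>u\<close>, with no integrability to check.\<close>

lemma nn_integral_change_of_variables:
  fixes f :: "real ^ 'n::finite \<Rightarrow> real ^ 'n::_"
  assumes S [measurable]: "S \<in> sets borel" and fS [measurable]: "f ` S \<in> sets borel"
    and der: "\<And>x. x \<in> S \<Longrightarrow> (f has_derivative f' x) (at x within S)"
    and inj: "inj_on f S"
    and meas [measurable]: "(\<lambda>x. indicator S x * \<bar>det (matrix (f' x))\<bar>) \<in> borel_measurable borel"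
    and u [measurable]: "u \<in> borel_measurable borel"
  shows "(\<integral>\<^sup>+y. indicator (f ` S) y * u y \<partial>lborel)
    = (\<integral>\<^sup>+x. ennreal (indicator S x * \<bar>det (matrix (f' x))\<bar>) * u (f x) \<partial>lborel)"
proof -
  \<comment> \<open>an everywhere measurable map that agrees with \<open>f\<close> on \<open>S\<close>\<close>
  define F where "F x = (if x \<in> S then f x else 0)" for x
  have "continuous_on S f"
    using der by (meson has_derivative_continuous_on)
  then have [measurable]: "F \<in> borel_measurable borel"
    unfolding F_def by (intro borel_measurable_continuous_on_if S continuous_on_const)
  let ?d = "\<lambda>x. ennreal (indicator S x * \<bar>det (matrix (f' x))\<bar>)"
  have eq: "density lborel (indicator (f ` S)) = distr (density lborel ?d) borel F"
  proof (rule measure_eqI)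
    fix E assume "E \<in> sets (density lborel (indicator (f ` S)))"
    then have E [measurable]: "E \<in> sets borel"
      by simp
    have pre [measurable]: "F -` E \<in> sets borel"
      using measurable_sets[of F borel borel E] by simp
    define S' where "S' = S \<inter> F -` E"
    have S' [measurable]: "S' \<in> sets borel"
      by (simp add: S'_def)
    have image: "f ` S' = f ` S \<inter> E"
      by (auto simp: S'_def F_def)
    have ind: "indicator S' x * \<bar>det (matrix (f' x))\<bar>
        = indicator S' x * (indicator S x * \<bar>det (matrix (f' x))\<bar>)" for x
      by (auto simp: S'_def indicator_def)
    have "emeasure (density lborel (indicator (f ` S))) E = emeasure lborel (f ` S')"
      unfolding image by (rule emeasure_restricted) simp_all
    also have "\<dots> = (\<integral>\<^sup>+x. ennreal (indicator S' x * \<bar>det (matrix (f' x))\<bar>) \<partial>lborel)"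
    proof (rule emeasure_differentiable_image)
      show "f ` S' \<in> sets borel"
        unfolding image by measurable
      show "(f has_derivative f' x) (at x within S')" if "x \<in> S'" for x
        using der[of x] that by (auto simp: S'_def intro: has_derivative_subset)
      show "inj_on f S'"
        using inj by (rule inj_on_subset) (auto simp: S'_def)
      show "(\<lambda>x. indicator S' x * \<bar>det (matrix (f' x))\<bar>) \<in> borel_measurable borel"
        unfolding ind by measurable
    qed (rule S')
    also have "\<dots> = (\<integral>\<^sup>+x. ?d x * indicator (F -` E) x \<partial>lborel)"
      by (intro nn_integral_cong) (auto simp: S'_def indicator_def)
    also have "\<dots> = emeasure (distr (density lborel ?d) borel F) E"
      by (subst emeasure_distr) (auto simp: emeasure_density)
    finally show "emeasure (density lborel (indicator (f ` S))) E
        = emeasure (distr (density lborel ?d) borel F) E" .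
  qed simp
  have "(\<integral>\<^sup>+y. indicator (f ` S) y * u y \<partial>lborel) = (\<integral>\<^sup>+y. u y \<partial>density lborel (indicator (f ` S)))"
    by (subst nn_integral_density) auto
  also have "\<dots> = (\<integral>\<^sup>+x. u (F x) \<partial>density lborel ?d)"
    unfolding eq by (rule nn_integral_distr) auto
  also have "\<dots> = (\<integral>\<^sup>+x. ?d x * u (F x) \<partial>lborel)"
    by (subst nn_integral_density) auto
  also have "\<dots> = (\<integral>\<^sup>+x. ?d x * u (f x) \<partial>lborel)"
    by (intro nn_integral_cong) (auto simp: F_def indicator_def)
  finally show ?thesis .
qed

section \<open>Riesz potentials on Euclidean space\<close>

lemma emeasure_ball_powr:
  assumes "0 < r"
  shows "emeasure lborel (ball (x :: 'a::euclidean_space) r)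
    = ennreal (unit_ball_vol (real DIM('a)) * r powr real DIM('a))"
  using assms by (simp add: emeasure_ball powr_realpow)

lemma ball_measurable [measurable]: "ball (x :: 'a::metric_space) r \<in> sets borel"
  by simp

text \<open>On the dyadic shell where \<open>norm (x - y)\<close> lies between \<open>R / 2 ^ Suc k\<close> and \<open>R / 2 ^ k\<close>, the integrand
is at most \<open>(R / 2 ^ Suc k) powr (- s)\<close> and the volume is of order \<open>(R / 2 ^ k) powr n\<close>. The products
form a geometric series with ratio \<open>(1 / 2) powr (n - s) < 1\<close>.\<close>

lemma nn_integral_norm_powr_ball_finite:
  fixes x :: "'a::euclidean_space"
  assumes s: "s < real DIM('a)" and s0: "0 \<le> s" and R: "0 < R"
  shows "(\<integral>\<^sup>+y\<in>ball x R. ennreal (norm (x - y) powr (- s)) \<partial>lborel) < \<infinity>"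
proof -
  define n where "n = real DIM('a)"
  define V where "V = unit_ball_vol n"
  have V: "0 \<le> V"
    by (simp add: V_def n_def unit_ball_vol_nonneg)
  define r where "r k = R * (1 / 2) ^ k" for k :: nat
  have r: "0 < r k" for k
    using R by (simp add: r_def)
  have half: "r (Suc k) = r k / 2" for k
    by (simp add: r_def)
  have shell: "\<exists>k. r (Suc k) \<le> d \<and> d < r k" if "0 < d" "d < R" for d
  proof -
    obtain k0 where "(1 / 2 :: real) ^ k0 < d / R"
      using real_arch_pow_inv[of "d / R" "1 / 2"] \<open>0 < d\<close> R by auto
    then have ex: "\<exists>k. r k \<le> d"
      using R by (intro exI[of _ k0]) (simp add: r_def field_simps)
    define m where "m = (LEAST k. r k \<le> d)"
    have m: "r m \<le> d"
      unfolding m_def by (rule LeastI_ex[OF ex])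
    have "m \<noteq> 0"
    proof
      assume "m = 0"
      with m that show False
        by (simp add: r_def)
    qed
    then obtain k where k: "m = Suc k"
      using not0_implies_Suc by blast
    then have "\<not> r k \<le> d"
      unfolding m_def using not_less_Least[of k "\<lambda>k. r k \<le> d"] by auto
    then show ?thesis
      using m k by (intro exI[of _ k]) auto
  qed
  have pw: "ennreal (norm (x - y) powr (- s)) * indicator (ball x R) y
      \<le> (\<Sum>k. ennreal (r (Suc k) powr (- s)) * indicator (ball x (r k)) y)" for y
  proof (cases "y \<in> ball x R \<and> y \<noteq> x")
    case True
    then obtain k where k: "r (Suc k) \<le> norm (x - y)" "norm (x - y) < r k"
      using shell[of "norm (x - y)"] by (auto simp: dist_norm)
    have "ennreal (norm (x - y) powr (- s)) \<le> ennreal (r (Suc k) powr (- s)) * indicator (ball x (r k)) y"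
      using k r[of "Suc k"] s0 by (auto simp: dist_norm intro!: ennreal_leI powr_mono2')
    also have "\<dots> \<le> (\<Sum>k. ennreal (r (Suc k) powr (- s)) * indicator (ball x (r k)) y)"
    proof -
      define T where "T k = ennreal (r (Suc k) powr (- s)) * indicator (ball x (r k)) y" for k
      have "T k \<le> suminf T"
        using sum_le_suminf[OF summableI, of "{k}" T] by simp
      then show ?thesis
        unfolding T_def[abs_def] .
    qed
    finally show ?thesis
      using True by simp
  qed auto
  have term_eq: "r (Suc k) powr (- s) * (V * r k powr n)
      = (2 powr s * V * R powr (n - s)) * ((1 / 2) powr (n - s)) ^ k" for k
  proof -
    have "r (Suc k) powr (- s) * (V * r k powr n) = 2 powr s * V * (r k powr (- s) * r k powr n)"
      using r[of k] by (simp add: half powr_divide powr_minus field_simps)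
    also have "r k powr (- s) * r k powr n = r k powr (n - s)"
      by (simp add: powr_add[symmetric])
    also have "r k powr (n - s) = R powr (n - s) * ((1 / 2) ^ k) powr (n - s)"
      using R by (simp add: r_def powr_mult)
    also have "((1 / 2) ^ k) powr (n - s) = ((1 / 2 :: real) powr (n - s)) ^ k"
      by (simp add: powr_realpow[symmetric] powr_powr mult.commute)
    finally show ?thesis
      by simp
  qed
  have "(\<integral>\<^sup>+y\<in>ball x R. ennreal (norm (x - y) powr (- s)) \<partial>lborel)
      \<le> (\<integral>\<^sup>+y. (\<Sum>k. ennreal (r (Suc k) powr (- s)) * indicator (ball x (r k)) y) \<partial>lborel)"
    by (intro nn_integral_mono pw)
  also have "\<dots> = (\<Sum>k. ennreal (r (Suc k) powr (- s)) * emeasure lborel (ball x (r k)))"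
    by (subst nn_integral_suminf) (auto simp: nn_integral_cmult_indicator)
  also have "\<dots> = (\<Sum>k. ennreal (r (Suc k) powr (- s) * (V * r k powr n)))"
  proof (rule suminf_cong)
    fix k
    have "emeasure lborel (ball x (r k)) = ennreal (V * r k powr n)"
      unfolding V_def n_def by (rule emeasure_ball_powr[OF r])
    then show "ennreal (r (Suc k) powr (- s)) * emeasure lborel (ball x (r k))
        = ennreal (r (Suc k) powr (- s) * (V * r k powr n))"
      using V by (simp only: ennreal_mult[symmetric] powr_ge_zero mult_nonneg_nonneg)
  qed
  also have "\<dots> = (\<Sum>k. ennreal ((2 powr s * V * R powr (n - s)) * ((1 / 2) powr (n - s)) ^ k))"
    unfolding term_eq ..
  also have "\<dots> < \<infinity>"
  proof -
    have "(1 / 2 :: real) powr (n - s) < 1 powr (n - s)"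
      using s by (intro powr_less_mono2) (auto simp: n_def)
    then have "summable (\<lambda>k. (2 powr s * V * R powr (n - s)) * ((1 / 2) powr (n - s)) ^ k)"
      by (intro summable_mult summable_geometric) simp
    then show ?thesis
      using V by (subst suminf_ennreal_eq[OF _ summable_sums]) auto
  qed
  finally show ?thesis .
qed

text \<open>For \<open>h \<ge> 0\<close> this is \<open>I\<^sub>\<alpha> h\<close> with the value \<open>\<infinity>\<close> allowed, so that monotone convergence
applies without integrability.\<close>

definition riesz_potential :: "real \<Rightarrow> (real ^ 'n::finite \<Rightarrow> real) \<Rightarrow> real ^ 'n \<Rightarrow> ennreal" where
  "riesz_potential \<alpha> h x = (\<integral>\<^sup>+y. ennreal (h y * euclidean_kernel \<alpha> x y) \<partial>lborel)"

lemma euclidean_kernel_nonneg: "0 \<le> euclidean_kernel \<alpha> x y"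
  by (simp add: euclidean_kernel_def)

lemma euclidean_kernel_measurable [measurable]:
  "(\<lambda>y. euclidean_kernel \<alpha> x y) \<in> borel_measurable borel"
  unfolding euclidean_kernel_def by measurable

lemma riesz_potential_measurable [measurable]:
  assumes [measurable]: "h \<in> borel_measurable borel"
  shows "riesz_potential \<alpha> h \<in> borel_measurable borel"
proof -
  have [measurable]: "(\<lambda>(x, y). ennreal (h y * euclidean_kernel \<alpha> x y)) \<in> borel_measurable (borel \<Otimes>\<^sub>M lborel)"
    by (simp add: euclidean_kernel_def split_beta')
  show ?thesis
    unfolding riesz_potential_def[abs_def]
    by (rule lborel.borel_measurable_nn_integral) simp
qed

lemma riesz_potential_mono:
  assumes "\<And>y. h y \<le> k y"
  shows "riesz_potential \<alpha> h x \<le> riesz_potential \<alpha> k x"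
  unfolding riesz_potential_def
  by (intro nn_integral_mono ennreal_leI mult_right_mono assms euclidean_kernel_nonneg)

lemma riesz_potential_finite:
  fixes h :: "real ^ 'n::finite \<Rightarrow> real"
  assumes a: "0 < \<alpha>" "\<alpha> < real CARD('n)"
    and h: "\<And>y. 0 \<le> h y" "\<And>y. h y \<le> B" "\<And>y. y \<notin> ball 0 R \<Longrightarrow> h y = 0"
    and R: "0 < R"
  shows "riesz_potential \<alpha> h x < \<infinity>"
proof -
  have B: "0 \<le> B"
    using h(1,2) order_trans by blast
  have sub: "ball 0 R \<subseteq> ball x (R + norm x)"
    by (auto simp: dist_norm) (smt (verit) norm_triangle_ineq4)
  have "riesz_potential \<alpha> h x
      \<le> (\<integral>\<^sup>+y. ennreal B * (ennreal (norm (x - y) powr (- (real CARD('n) - \<alpha>))) * indicator (ball x (R + norm x)) y) \<partial>lborel)"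
    unfolding riesz_potential_def
  proof (rule nn_integral_mono)
    fix y
    show "ennreal (h y * euclidean_kernel \<alpha> x y)
        \<le> ennreal B * (ennreal (norm (x - y) powr (- (real CARD('n) - \<alpha>))) * indicator (ball x (R + norm x)) y)"
    proof (cases "y \<in> ball 0 R")
      case True
      with sub have "y \<in> ball x (R + norm x)"
        by blast
      then show ?thesis
        using h(1,2)[of y] B
        by (auto simp: euclidean_kernel_def ennreal_mult[symmetric] intro!: ennreal_leI mult_right_mono)
    qed (simp add: h(3))
  qed
  also have "\<dots> = ennreal B * (\<integral>\<^sup>+y\<in>ball x (R + norm x). ennreal (norm (x - y) powr (- (real CARD('n) - \<alpha>))) \<partial>lborel)"
    by (rule nn_integral_cmult) measurable
  also have "\<dots> < \<infinity>"
    using nn_integral_norm_powr_ball_finite[of "real CARD('n) - \<alpha>" "R + norm x" x] a R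
    by (auto simp: ennreal_mult_less_top add_pos_nonneg)
  finally show ?thesis .
qed

text \<open>This removes signs from the problem. It holds for every \<open>f\<close>, because the integral of a
non-integrable function is \<open>0\<close>.\<close>

lemma abs_integral_op_le_riesz_potential:
  fixes f :: "real ^ 'n::finite \<Rightarrow> real"
  shows "ennreal \<bar>integral_op lborel (euclidean_kernel \<alpha>) f x\<bar> \<le> riesz_potential \<alpha> (\<lambda>y. \<bar>f y\<bar>) x"
proof (cases "integrable lborel (\<lambda>y. f y * euclidean_kernel \<alpha> x y)")
  case True
  then have "ennreal (norm (\<integral>y. f y * euclidean_kernel \<alpha> x y \<partial>lborel))
      \<le> (\<integral>\<^sup>+y. ennreal (norm (f y * euclidean_kernel \<alpha> x y)) \<partial>lborel)"
    by (rule integral_norm_bound_ennreal)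
  then show ?thesis
    by (simp add: integral_op_def riesz_potential_def abs_mult euclidean_kernel_nonneg)
next
  case False
  then show ?thesis
    by (simp add: integral_op_def not_integrable_integral_eq)
qed

lemma Lp_norm_finite_eq:
  assumes "(\<integral>\<^sup>+x. ennreal (\<bar>f x\<bar> powr p) \<partial>\<mu>) < \<infinity>"
  shows "Lp_norm p \<mu> f = ennreal (enn2real (\<integral>\<^sup>+x. ennreal (\<bar>f x\<bar> powr p) \<partial>\<mu>) powr (1 / p))"
  using assms by (simp add: Lp_norm_def Let_def)

lemma Lp_norm_le_iff:
  assumes q: "0 < q" and C: "0 \<le> C"
  shows "Lp_norm q \<mu> f \<le> ennreal C \<longleftrightarrow> (\<integral>\<^sup>+x. ennreal (\<bar>f x\<bar> powr q) \<partial>\<mu>) \<le> ennreal (C powr q)"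
    (is "_ \<longleftrightarrow> ?I \<le> _")
proof (cases "?I = \<infinity>")
  case True
  then show ?thesis
    by (simp add: Lp_norm_def top_unique)
next
  case False
  then obtain r where r: "?I = ennreal r" "0 \<le> r"
    by (cases ?I) auto
  have "r powr (1 / q) \<le> C \<longleftrightarrow> r \<le> C powr q"
  proof
    assume "r powr (1 / q) \<le> C"
    then have "(r powr (1 / q)) powr q \<le> C powr q"
      using q by (intro powr_mono2) auto
    then show "r \<le> C powr q"
      using q r by (simp add: powr_powr)
  next
    assume "r \<le> C powr q"
    then have "r powr (1 / q) \<le> (C powr q) powr (1 / q)"
      using q r by (intro powr_mono2) auto
    then show "r powr (1 / q) \<le> C"
      using q C by (simp add: powr_powr)
  qed
  then show ?thesis
    using r C by (simp add: Lp_norm_def)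
qed


text \<open>It suffices to test the inequality on nonnegative bounded functions supported in a ball, and to
integrate the potential over the same ball only: the truncations of \<open>\<bar>f\<bar>\<close> by height \<open>k\<close> and radius
\<open>k\<close> increase to \<open>\<bar>f\<bar>\<close>, hence their potentials increase to that of \<open>\<bar>f\<bar>\<close>, which dominates \<open>\<bar>I\<^sub>\<alpha> f\<bar>\<close>.\<close>

lemma integral_op_Lp_norm_le_of_truncations:
  fixes f :: "real ^ 'n::finite \<Rightarrow> real"
  assumes a: "0 < \<alpha>" "\<alpha> < real CARD('n)" and p: "0 < p" and q: "0 < q" and C: "0 \<le> C"
    and bound: "\<And>k (h :: real ^ 'n \<Rightarrow> real) B. 0 < k \<Longrightarrow> h \<in> borel_measurable borel \<Longrightarrow> (\<And>y. 0 \<le> h y) \<Longrightarrow> (\<And>y. h y \<le> B)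
      \<Longrightarrow> (\<And>y. y \<notin> ball 0 k \<Longrightarrow> h y = 0)
      \<Longrightarrow> (\<integral>\<^sup>+x\<in>ball 0 k. ennreal (enn2real (riesz_potential \<alpha> h x) powr q) \<partial>lborel)
        \<le> ennreal (C powr q * enn2real (\<integral>\<^sup>+x. ennreal (h x powr p) \<partial>lborel) powr (q / p))"
    and f: "f \<in> Lp_space p lborel"
  shows "Lp_norm q lborel (integral_op lborel (euclidean_kernel \<alpha>) f) \<le> ennreal C * Lp_norm p lborel f"
proof -
  define I where "I = integral_op lborel (euclidean_kernel \<alpha>) f"
  define P where "P = (\<integral>\<^sup>+x. ennreal (\<bar>f x\<bar> powr p) \<partial>lborel)"
  have fm [measurable]: "f \<in> borel_measurable borel"
    using f by (simp add: Lp_space_def)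
  have P: "P < \<infinity>"
    using f by (auto simp: Lp_space_def Lp_norm_def P_def Let_def top.not_eq_extremum split: if_splits)
  define h where "h k y = min \<bar>f y\<bar> (real k) * indicator (ball 0 (real k)) y" for k :: nat and y
  have [measurable]: "h k \<in> borel_measurable borel" for k
    unfolding h_def[abs_def] by measurable
  have h0: "0 \<le> h k y" and hf: "h k y \<le> \<bar>f y\<bar>" and hk: "h k y \<le> real k"
    and hout: "y \<notin> ball 0 (real k) \<Longrightarrow> h k y = 0" for k y
    by (auto simp: h_def indicator_def)
  have hmono: "h k y \<le> h l y" if "k \<le> l" for k l y
    using that by (auto simp: h_def indicator_def)
  have hlim: "(\<lambda>k. h k y) \<longlonglongrightarrow> \<bar>f y\<bar>" for y
  proof (rule tendsto_eventually)
    obtain k0 :: nat where k0: "max \<bar>f y\<bar> (norm y) < real k0"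
      using reals_Archimedean2 by blast
    show "\<forall>\<^sub>F k in sequentially. h k y = \<bar>f y\<bar>"
      using eventually_ge_at_top[of k0]
    proof eventually_elim
      case (elim k)
      then have "real k0 \<le> real k"
        by simp
      with k0 have "\<bar>f y\<bar> < real k" "norm y < real k"
        by linarith+
      then show ?case
        by (simp add: h_def)
    qed
  qed
  define e where "e k x = riesz_potential \<alpha> (h k) x" for k x
  have [measurable]: "e k \<in> borel_measurable borel" for k
    unfolding e_def[abs_def] by simp
  have efin: "e k x < \<infinity>" for k x
    unfolding e_def
    using riesz_potential_finite[OF a, of "h k" "real k" "real k + 1" x] h0 hk hout
    by (auto simp: subset_eq)
  have emono: "e k x \<le> e l x" if "k \<le> l" for k l x
    unfolding e_def by (intro riesz_potential_mono hmono that)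
  have eSUP: "(SUP k. e k x) = riesz_potential \<alpha> (\<lambda>y. \<bar>f y\<bar>) x" for x
  proof -
    have inc: "incseq (\<lambda>k y. ennreal (h k y * euclidean_kernel \<alpha> x y))"
      by (auto simp: incseq_def le_fun_def intro!: ennreal_leI mult_right_mono hmono euclidean_kernel_nonneg)
    have "(SUP k. ennreal (h k y * euclidean_kernel \<alpha> x y)) = ennreal (\<bar>f y\<bar> * euclidean_kernel \<alpha> x y)" for y
    proof (rule LIMSEQ_unique[OF LIMSEQ_SUP])
      show "incseq (\<lambda>k. ennreal (h k y * euclidean_kernel \<alpha> x y))"
        using inc by (auto simp: incseq_def le_fun_def)
      show "(\<lambda>k. ennreal (h k y * euclidean_kernel \<alpha> x y)) \<longlonglongrightarrow> ennreal (\<bar>f y\<bar> * euclidean_kernel \<alpha> x y)"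
        by (intro tendsto_ennrealI tendsto_mult hlim tendsto_const)
    qed
    then show ?thesis
      unfolding e_def riesz_potential_def
      by (subst nn_integral_monotone_convergence_SUP[OF inc, symmetric]) simp_all
  qed
  define Q where "Q k x = ennreal (enn2real (e k x) powr q) * indicator (ball 0 (real k)) x" for k x
  have [measurable]: "Q k \<in> borel_measurable lborel" for k
    unfolding Q_def[abs_def] by measurable
  have Qinc: "incseq Q"
  proof (intro incseq_SucI le_funI)
    fix k x
    have "enn2real (e k x) powr q \<le> enn2real (e (Suc k) x) powr q"
      using efin emono[of k "Suc k" x] q by (intro powr_mono2 enn2real_mono) auto
    then show "Q k x \<le> Q (Suc k) x"
      by (auto simp: Q_def indicator_def intro!: ennreal_leI)
  qed
  have pw: "ennreal (\<bar>I x\<bar> powr q) \<le> (SUP k. Q k x)" for x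
  proof -
    \<comment> \<open>the potentials may tend to infinity; cut off at \<open>\<bar>I x\<bar>\<close>, they converge to a real number\<close>
    define t where "t k = min (enn2real (e k x)) \<bar>I x\<bar>" for k
    have le: "ennreal \<bar>I x\<bar> \<le> (SUP k. e k x)"
      unfolding I_def eSUP by (rule abs_integral_op_le_riesz_potential)
    have tlim: "t \<longlonglongrightarrow> \<bar>I x\<bar>"
    proof (rule order_tendstoI)
      fix y assume y: "y < \<bar>I x\<bar>"
      show "\<forall>\<^sub>F k in sequentially. y < t k"
      proof (cases "0 \<le> y")
        case True
        then have "ennreal y < (SUP k. e k x)"
          using y by (intro less_le_trans[OF _ le]) (simp add: ennreal_lessI)
        then obtain k0 where k0: "ennreal y < e k0 x"
          by (auto simp: less_SUP_iff)
        show ?thesis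
          using eventually_ge_at_top[of k0]
        proof eventually_elim
          case (elim k)
          have "ennreal y < e k x"
            using k0 emono[OF elim, of x] by (rule less_le_trans)
          then have "y < enn2real (e k x)"
            using True efin[of k x] by (cases "e k x") (auto simp: ennreal_less_iff)
          then show ?case
            using y by (simp add: t_def)
        qed
      next
        case False
        have "0 \<le> t k" for k
          by (simp add: t_def)
        then have "y < t k" for k
          using False by (meson not_le order_less_le_trans)
        then show ?thesis
          by simp
      qed
    next
      fix y assume y: "\<bar>I x\<bar> < y"
      have "t k < y" for k
        using y by (simp add: t_def min_less_iff_disj)
      then show "\<forall>\<^sub>F k in sequentially. t k < y"
        by simp
    qed
    have lim: "(\<lambda>k. ennreal (t k powr q)) \<longlonglongrightarrow> ennreal (\<bar>I x\<bar> powr q)"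
      using q by (intro tendsto_ennrealI tendsto_powr'[OF tlim] tendsto_const) (auto simp: t_def)
    obtain k1 :: nat where k1: "norm x < real k1"
      using reals_Archimedean2 by blast
    have "\<forall>\<^sub>F k in sequentially. ennreal (t k powr q) \<le> (SUP k. Q k x)"
      using eventually_ge_at_top[of k1]
    proof eventually_elim
      case (elim k)
      then have "x \<in> ball 0 (real k)"
        using k1 by (simp add: less_le_trans)
      then have "ennreal (t k powr q) \<le> Q k x"
        using q by (auto simp: Q_def t_def intro!: ennreal_leI powr_mono2)
      also have "\<dots> \<le> (SUP k. Q k x)"
        by (rule SUP_upper) simp
      finally show ?case .
    qed
    then show ?thesis
      using lim by (intro tendsto_upperbound[OF lim]) auto
  qed
  have "(\<integral>\<^sup>+x. ennreal (\<bar>I x\<bar> powr q) \<partial>lborel) \<le> (\<integral>\<^sup>+x. (SUP k. Q k x) \<partial>lborel)"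
    by (intro nn_integral_mono pw)
  also have "\<dots> = (SUP k. \<integral>\<^sup>+x. Q k x \<partial>lborel)"
    by (rule nn_integral_monotone_convergence_SUP[OF Qinc]) simp
  also have "\<dots> \<le> ennreal (C powr q * enn2real P powr (q / p))"
  proof (rule SUP_least)
    fix k
    show "(\<integral>\<^sup>+x. Q k x \<partial>lborel) \<le> ennreal (C powr q * enn2real P powr (q / p))"
    proof (cases "k = 0")
      case True
      then show ?thesis
        by (simp add: Q_def)
    next
      case False
      have "(\<integral>\<^sup>+x. Q k x \<partial>lborel)
          \<le> ennreal (C powr q * enn2real (\<integral>\<^sup>+x. ennreal (h k x powr p) \<partial>lborel) powr (q / p))"
        unfolding Q_def e_def using False h0 hk hout by (intro bound) auto
      also have "\<dots> \<le> ennreal (C powr q * enn2real P powr (q / p))"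
        using P p q h0 hf unfolding P_def
        by (intro ennreal_leI mult_left_mono powr_mono2 enn2real_mono nn_integral_mono) auto
      finally show ?thesis .
    qed
  qed
  also have "C powr q * enn2real P powr (q / p) = (C * enn2real P powr (1 / p)) powr q"
    using C by (simp add: powr_mult powr_powr)
  finally have "Lp_norm q lborel I \<le> ennreal (C * enn2real P powr (1 / p))"
    using C q by (subst Lp_norm_le_iff) auto
  also have "\<dots> = ennreal C * Lp_norm p lborel f"
    using C P by (simp add: Lp_norm_finite_eq P_def ennreal_mult)
  finally show ?thesis
    by (simp add: I_def)
qed


section \<open>Transplanting functions into a nearly Euclidean space\<close>

text \<open>\<open>\<Phi>\<close> embeds the ball of radius \<open>R\<close> into the space that carries \<open>\<mu>\<close>, with inverse \<open>\<Psi>\<close>, in such a way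
that \<open>\<mu>\<close> and \<open>K\<close> look like Lebesgue measure and the Euclidean kernel in coordinates scaled by \<open>\<delta>\<close>,
up to factors \<open>1 \<plusminus> \<epsilon>\<close>; \<open>w\<close> is the density of \<open>\<mu>\<close> pulled back by \<open>\<Phi>\<close>. Only the lower bound on the
kernel has to be sharp. The upper bound, with an arbitrary constant \<open>C\<close>, makes the integrals that
define the potential finite: a divergent Bochner integral would have the value \<open>0\<close>. For the same
reason the kernel has to be measurable in its second argument.\<close>

definition euclidean_model ::
    "'a measure \<Rightarrow> ('a \<Rightarrow> 'a \<Rightarrow> real) \<Rightarrow> real \<Rightarrow> real \<Rightarrow> real \<Rightarrow> real \<Rightarrow> real \<Rightarrow>
     (real ^ 'n::finite \<Rightarrow> 'a) \<Rightarrow> ('a \<Rightarrow> real ^ 'n) \<Rightarrow> (real ^ 'n \<Rightarrow> real) \<Rightarrow> bool" where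
  "euclidean_model \<mu> K \<alpha> R \<epsilon> \<delta> C \<Phi> \<Psi> w \<longleftrightarrow>
     0 < \<delta> \<and>
     \<Phi> \<in> measurable borel \<mu> \<and> \<Psi> \<in> borel_measurable \<mu> \<and> w \<in> borel_measurable borel \<and>
     \<Phi> ` ball 0 R \<in> sets \<mu> \<and> (\<forall>u\<in>ball 0 R. \<Psi> (\<Phi> u) = u) \<and>
     (\<forall>E\<in>sets \<mu>. E \<subseteq> \<Phi> ` ball 0 R \<longrightarrow>
        emeasure \<mu> E = (\<integral>\<^sup>+u. ennreal (w u) * indicator (ball 0 R \<inter> \<Phi> -` E) u \<partial>lborel)) \<and>
     (\<forall>u\<in>ball 0 R. (1 - \<epsilon>) * \<delta> powr real CARD('n) \<le> w u \<and> w u \<le> (1 + \<epsilon>) * \<delta> powr real CARD('n)) \<and>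
     (\<forall>u\<in>ball 0 R. \<forall>v\<in>ball 0 R.
        (1 - \<epsilon>) * \<delta> powr (\<alpha> - real CARD('n)) * euclidean_kernel \<alpha> u v \<le> K (\<Phi> u) (\<Phi> v) \<and>
        K (\<Phi> u) (\<Phi> v) \<le> C * euclidean_kernel \<alpha> u v) \<and>
     (\<forall>u\<in>ball 0 R. (\<lambda>z. indicator (\<Phi> ` ball 0 R) z * K (\<Phi> u) z) \<in> borel_measurable \<mu>)"

lemma euclidean_model_nn_integral:
  fixes \<Phi> :: "real ^ 'n::finite \<Rightarrow> 'a"
  assumes m: "euclidean_model \<mu> K \<alpha> R \<epsilon> \<delta> C \<Phi> \<Psi> w"
    and F [measurable]: "F \<in> borel_measurable \<mu>"
  shows "(\<integral>\<^sup>+z. indicator (\<Phi> ` ball 0 R) z * F z \<partial>\<mu>)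
    = (\<integral>\<^sup>+u. ennreal (w u) * indicator (ball 0 R) u * F (\<Phi> u) \<partial>lborel)"
proof -
  let ?D = "\<Phi> ` ball 0 R"
  have [measurable]: "\<Phi> \<in> measurable borel \<mu>" "w \<in> borel_measurable borel" "?D \<in> sets \<mu>"
    and em: "\<And>E. E \<in> sets \<mu> \<Longrightarrow> E \<subseteq> ?D \<Longrightarrow>
        emeasure \<mu> E = (\<integral>\<^sup>+u. ennreal (w u) * indicator (ball 0 R \<inter> \<Phi> -` E) u \<partial>lborel)"
    using m by (auto simp: euclidean_model_def)
  let ?L = "density lborel (\<lambda>u. ennreal (w u) * indicator (ball 0 R) u)"
  have eq: "density \<mu> (indicator ?D) = distr ?L \<mu> \<Phi>"
  proof (rule measure_eqI)
    fix E assume "E \<in> sets (density \<mu> (indicator ?D))"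
    then have E [measurable]: "E \<in> sets \<mu>"
      by simp
    have pre: "\<Phi> -` E \<in> sets borel"
      using measurable_sets[of \<Phi> borel \<mu> E] by simp
    have "emeasure (density \<mu> (indicator ?D)) E = emeasure \<mu> (?D \<inter> E)"
      by (rule emeasure_restricted) measurable
    also have "\<dots> = (\<integral>\<^sup>+u. ennreal (w u) * indicator (ball 0 R \<inter> \<Phi> -` (?D \<inter> E)) u \<partial>lborel)"
      by (rule em) auto
    also have "\<dots> = (\<integral>\<^sup>+u. ennreal (w u) * indicator (ball 0 R) u * indicator (\<Phi> -` E) u \<partial>lborel)"
      by (intro nn_integral_cong) (auto simp: indicator_def)
    also have "\<dots> = emeasure (distr ?L \<mu> \<Phi>) E"
      using pre by (subst emeasure_distr) (auto simp: emeasure_density)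
    finally show "emeasure (density \<mu> (indicator ?D)) E = emeasure (distr ?L \<mu> \<Phi>) E" .
  qed simp
  have "(\<integral>\<^sup>+z. indicator ?D z * F z \<partial>\<mu>) = (\<integral>\<^sup>+z. F z \<partial>density \<mu> (indicator ?D))"
    by (subst nn_integral_density) auto
  also have "\<dots> = (\<integral>\<^sup>+u. F (\<Phi> u) \<partial>?L)"
    unfolding eq by (rule nn_integral_distr) auto
  also have "\<dots> = (\<integral>\<^sup>+u. ennreal (w u) * indicator (ball 0 R) u * F (\<Phi> u) \<partial>lborel)"
    by (subst nn_integral_density) auto
  finally show ?thesis .
qed

lemma ennreal_le_mult_of_divide_le:
  assumes "0 < r" "0 \<le> N" "a / ennreal r \<le> ennreal N"
  shows "a \<le> ennreal (N * r)"
proof (cases a)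
  case (real x)
  with assms have "x / r \<le> N"
    by (simp add: divide_ennreal)
  with real assms show ?thesis
    by (simp add: field_simps ennreal_leI)
next
  case top
  with assms show ?thesis
    by (simp add: ennreal_top_divide top_unique)
qed

text \<open>Transplant \<open>h\<close> to \<open>F = h \<circ> \<Psi>\<close> on the image of the ball. The \<open>p\<close>-th power of the norm of \<open>F\<close> is
\<open>\<delta> powr n\<close> times that of \<open>h\<close>, the potential is multiplied by \<open>\<delta> powr \<alpha>\<close>, and the \<open>q\<close>-th power of its
norm by \<open>\<delta> powr (n + \<alpha> * q)\<close>, all up to powers of \<open>1 \<plusminus> \<epsilon>\<close>. Since \<open>n + \<alpha> * q = n * q / p\<close>, the scale
\<open>\<delta>\<close> cancels, and the inequality with constant \<open>N\<close> for \<open>F\<close> gives that for \<open>h\<close> up to a factor that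
depends on \<open>\<epsilon>\<close>, \<open>p\<close> and \<open>q\<close> only.\<close>

lemma euclidean_model_bound:
  fixes \<Phi> :: "real ^ 'n::finite \<Rightarrow> 'a" and h :: "real ^ 'n \<Rightarrow> real"
  assumes m: "euclidean_model \<mu> K \<alpha> R \<epsilon> \<delta> C \<Phi> \<Psi> w"
    and \<epsilon>: "0 < \<epsilon>" "\<epsilon> < 1" and R: "0 < R" and C: "0 \<le> C"
    and a: "0 < \<alpha>" "\<alpha> < real CARD('n)" and p: "0 < p" and q: "0 < q"
    and pq: "1 / q = 1 / p - \<alpha> / real CARD('n)"
    and N: "sharp_const p q \<mu> K \<le> ennreal N" "0 \<le> N"
    and hm [measurable]: "h \<in> borel_measurable borel"
    and h: "\<And>y. 0 \<le> h y" "\<And>y. h y \<le> B" "\<And>y. y \<notin> ball 0 R \<Longrightarrow> h y = 0"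
  shows "(\<integral>\<^sup>+x\<in>ball 0 R. ennreal (enn2real (riesz_potential \<alpha> h x) powr q) \<partial>lborel)
    \<le> ennreal (N powr q * enn2real (\<integral>\<^sup>+x. ennreal (h x powr p) \<partial>lborel) powr (q / p)
        * ((1 + \<epsilon>) powr (q / p) / ((1 - \<epsilon>) * ((1 - \<epsilon>) * (1 - \<epsilon>)) powr q)))"
proof -
  define n where "n = real CARD('n)"
  have n: "0 < n"
    by (simp add: n_def)
  let ?B = "ball (0 :: real ^ 'n) R"
  define D where "D = \<Phi> ` ?B"
  have \<delta>: "0 < \<delta>"
    and [measurable]: "\<Phi> \<in> measurable borel \<mu>" "\<Psi> \<in> borel_measurable \<mu>" "w \<in> borel_measurable borel" "D \<in> sets \<mu>"
    and inv: "\<And>u. u \<in> ?B \<Longrightarrow> \<Psi> (\<Phi> u) = u"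
    and w: "\<And>u. u \<in> ?B \<Longrightarrow> (1 - \<epsilon>) * \<delta> powr n \<le> w u" "\<And>u. u \<in> ?B \<Longrightarrow> w u \<le> (1 + \<epsilon>) * \<delta> powr n"
    and Kl: "\<And>u v. u \<in> ?B \<Longrightarrow> v \<in> ?B \<Longrightarrow> (1 - \<epsilon>) * \<delta> powr (\<alpha> - n) * euclidean_kernel \<alpha> u v \<le> K (\<Phi> u) (\<Phi> v)"
    and Ku: "\<And>u v. u \<in> ?B \<Longrightarrow> v \<in> ?B \<Longrightarrow> K (\<Phi> u) (\<Phi> v) \<le> C * euclidean_kernel \<alpha> u v"
    and Km: "\<And>u. u \<in> ?B \<Longrightarrow> (\<lambda>z. indicator D z * K (\<Phi> u) z) \<in> borel_measurable \<mu>"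
    using m by (auto simp: euclidean_model_def n_def D_def)
  have D: "\<Phi> u \<in> D" if "u \<in> ?B" for u
    using that by (simp add: D_def)
  have int: "(\<integral>\<^sup>+z. indicator D z * F z \<partial>\<mu>)
      = (\<integral>\<^sup>+u. ennreal (w u) * indicator ?B u * F (\<Phi> u) \<partial>lborel)"
    if "F \<in> borel_measurable \<mu>" for F
    unfolding D_def by (rule euclidean_model_nn_integral[OF m that])
  have w0: "0 \<le> w u" if "u \<in> ?B" for u
    using w(1)[OF that] \<epsilon> by (smt (verit) mult_nonneg_nonneg powr_ge_zero)
  have K0: "0 \<le> K (\<Phi> u) (\<Phi> v)" if "u \<in> ?B" "v \<in> ?B" for u v
  proof -
    have "0 \<le> (1 - \<epsilon>) * \<delta> powr (\<alpha> - n) * euclidean_kernel \<alpha> u v"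
      using \<epsilon> by (simp add: euclidean_kernel_nonneg)
    with Kl[OF that] show ?thesis
      by linarith
  qed
  have B: "0 \<le> B"
    using h(1,2) order_trans by blast
  define P where "P = (\<integral>\<^sup>+x. ennreal (h x powr p) \<partial>lborel)"
  have P: "P < \<infinity>"
  proof -
    have "P \<le> (\<integral>\<^sup>+x. ennreal (B powr p) * indicator ?B x \<partial>lborel)"
      unfolding P_def
    proof (rule nn_integral_mono)
      fix x
      show "ennreal (h x powr p) \<le> ennreal (B powr p) * indicator ?B x"
        using h[of x] p by (cases "x \<in> ?B") (auto intro!: ennreal_leI powr_mono2)
    qed
    also have "\<dots> = ennreal (B powr p) * emeasure lborel ?B"
      by (simp add: nn_integral_cmult_indicator)
    also have "\<dots> < \<infinity>"
      using R by (simp add: emeasure_ball ennreal_mult_less_top)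
    finally show ?thesis .
  qed
  define e where "e x = enn2real (riesz_potential \<alpha> h x)" for x
  have [measurable]: "e \<in> borel_measurable borel"
    unfolding e_def[abs_def] by measurable
  have e: "riesz_potential \<alpha> h x = ennreal (e x)" "0 \<le> e x" for x
    using riesz_potential_finite[where h = h and x = x, OF a h R] by (auto simp: e_def ennreal_enn2real_if)
  define X where "X = (\<integral>\<^sup>+x\<in>?B. ennreal (e x powr q) \<partial>lborel)"
  define F where "F z = indicator D z * h (\<Psi> z)" for z
  have [measurable]: "F \<in> borel_measurable \<mu>"
    unfolding F_def[abs_def] by measurable
  have F0: "0 \<le> F z" for z
    by (simp add: F_def h)
  define PF where "PF = (\<integral>\<^sup>+z. ennreal (\<bar>F z\<bar> powr p) \<partial>\<mu>)"
  have PF_eq: "PF = (\<integral>\<^sup>+u. ennreal (w u) * indicator ?B u * ennreal (h u powr p) \<partial>lborel)"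
  proof -
    have "PF = (\<integral>\<^sup>+z. indicator D z * ennreal (h (\<Psi> z) powr p) \<partial>\<mu>)"
      unfolding PF_def using h(1) by (intro nn_integral_cong) (auto simp: F_def indicator_def)
    also have "\<dots> = (\<integral>\<^sup>+u. ennreal (w u) * indicator ?B u * ennreal (h (\<Psi> (\<Phi> u)) powr p) \<partial>lborel)"
      by (rule int) measurable
    also have "\<dots> = (\<integral>\<^sup>+u. ennreal (w u) * indicator ?B u * ennreal (h u powr p) \<partial>lborel)"
      by (intro nn_integral_cong) (auto simp: inv indicator_def)
    finally show ?thesis .
  qed
  have PF_le: "PF \<le> ennreal ((1 + \<epsilon>) * \<delta> powr n * enn2real P)"
  proof -
    have "PF \<le> (\<integral>\<^sup>+u. ennreal ((1 + \<epsilon>) * \<delta> powr n) * ennreal (h u powr p) \<partial>lborel)"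
      unfolding PF_eq by (intro nn_integral_mono) (auto simp: indicator_def intro!: mult_right_mono ennreal_leI w)
    also have "\<dots> = ennreal ((1 + \<epsilon>) * \<delta> powr n) * P"
      unfolding P_def by (rule nn_integral_cmult) measurable
    also have "\<dots> = ennreal ((1 + \<epsilon>) * \<delta> powr n * enn2real P)"
      using P \<epsilon> by (simp add: ennreal_mult)
    finally show ?thesis .
  qed
  then have PF: "PF < \<infinity>"
    by (simp add: le_less_trans)
  have F_Lp: "F \<in> Lp_space p \<mu>"
    using PF by (simp add: Lp_space_def Lp_norm_finite_eq PF_def[symmetric])
  define \<kappa> where "\<kappa> = ((1 - \<epsilon>) * (1 - \<epsilon>)) * \<delta> powr \<alpha>"
  have \<kappa>: "0 < \<kappa>"
    using \<epsilon> \<delta> by (simp add: \<kappa>_def)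
  \<comment> \<open>the factor for the potential combines that of the volume with that of the kernel\<close>
  have pot: "\<kappa> * e v \<le> integral_op \<mu> K F (\<Phi> v)" if v: "v \<in> ?B" for v
  proof -
    define T where "T = (\<integral>\<^sup>+z. ennreal (F z * K (\<Phi> v) z) \<partial>\<mu>)"
    have [measurable]: "(\<lambda>z. indicator D z * K (\<Phi> v) z) \<in> borel_measurable \<mu>"
      by (rule Km[OF v])
    have FK: "F z * K (\<Phi> v) z = h (\<Psi> z) * (indicator D z * K (\<Phi> v) z)" for z
      by (simp add: F_def)
    have FKm [measurable]: "(\<lambda>z. F z * K (\<Phi> v) z) \<in> borel_measurable \<mu>"
      unfolding FK by measurable
    have FK0: "0 \<le> F z * K (\<Phi> v) z" for z
      using K0[OF v] h(1) by (auto simp: F_def indicator_def D_def)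
    have "T = (\<integral>\<^sup>+z. indicator D z * ennreal (h (\<Psi> z) * (indicator D z * K (\<Phi> v) z)) \<partial>\<mu>)"
      unfolding T_def FK by (intro nn_integral_cong) (auto simp: indicator_def)
    also have "\<dots> = (\<integral>\<^sup>+u. ennreal (w u) * indicator ?B u
        * ennreal (h (\<Psi> (\<Phi> u)) * (indicator D (\<Phi> u) * K (\<Phi> v) (\<Phi> u))) \<partial>lborel)"
      by (rule int) measurable
    also have "\<dots> = (\<integral>\<^sup>+u. ennreal (w u) * indicator ?B u * ennreal (h u * K (\<Phi> v) (\<Phi> u)) \<partial>lborel)"
      by (intro nn_integral_cong) (auto simp: inv indicator_def D)
    finally have T: "T = (\<integral>\<^sup>+u. ennreal (w u) * indicator ?B u * ennreal (h u * K (\<Phi> v) (\<Phi> u)) \<partial>lborel)" .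
    have "T \<le> (\<integral>\<^sup>+u. ennreal ((1 + \<epsilon>) * \<delta> powr n * C) * ennreal (h u * euclidean_kernel \<alpha> v u) \<partial>lborel)"
      unfolding T
    proof (rule nn_integral_mono)
      fix u
      have "w u * (h u * K (\<Phi> v) (\<Phi> u)) \<le> ((1 + \<epsilon>) * \<delta> powr n) * (h u * (C * euclidean_kernel \<alpha> v u))" if "u \<in> ?B"
        using that \<epsilon> h(1) by (intro mult_mono w Ku v mult_nonneg_nonneg K0) auto
      then have le: "w u * (h u * K (\<Phi> v) (\<Phi> u))
          \<le> ((1 + \<epsilon>) * \<delta> powr n * C) * (h u * euclidean_kernel \<alpha> v u)" if "u \<in> ?B"
        using that by (simp add: mult_ac)
      have c0: "0 \<le> (1 + \<epsilon>) * \<delta> powr n * C"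
        using \<epsilon> C by simp
      show "ennreal (w u) * indicator ?B u * ennreal (h u * K (\<Phi> v) (\<Phi> u))
          \<le> ennreal ((1 + \<epsilon>) * \<delta> powr n * C) * ennreal (h u * euclidean_kernel \<alpha> v u)"
        unfolding ennreal_mult'[OF c0, symmetric]
        using le w0 by (cases "u \<in> ?B") (auto simp: ennreal_mult'[symmetric] simp del: mem_ball intro!: ennreal_leI)
    qed
    also have "\<dots> = ennreal ((1 + \<epsilon>) * \<delta> powr n * C) * riesz_potential \<alpha> h v"
      unfolding riesz_potential_def by (rule nn_integral_cmult) measurable
    also have "\<dots> < \<infinity>"
      by (simp add: e ennreal_mult_less_top)
    \<comment> \<open>this is where the upper bound on the kernel is needed\<close>
    finally have Tfin: "T < \<infinity>" .
    have "ennreal (\<kappa> * e v) = ennreal \<kappa> * riesz_potential \<alpha> h v"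
      using \<kappa> e by (simp add: ennreal_mult)
    also have "\<dots> = (\<integral>\<^sup>+u. ennreal \<kappa> * ennreal (h u * euclidean_kernel \<alpha> v u) \<partial>lborel)"
      unfolding riesz_potential_def by (rule nn_integral_cmult[symmetric]) measurable
    also have "\<dots> \<le> T"
      unfolding T
    proof (rule nn_integral_mono)
      fix u
      have "\<kappa> = ((1 - \<epsilon>) * \<delta> powr n) * ((1 - \<epsilon>) * \<delta> powr (\<alpha> - n))"
        by (simp add: \<kappa>_def powr_diff powr_minus)
      then have "\<kappa> * (h u * euclidean_kernel \<alpha> v u)
          = ((1 - \<epsilon>) * \<delta> powr n) * (h u * ((1 - \<epsilon>) * \<delta> powr (\<alpha> - n) * euclidean_kernel \<alpha> v u))"
        by (simp add: mult_ac)
      also have "\<dots> \<le> w u * (h u * K (\<Phi> v) (\<Phi> u))" if "u \<in> ?B"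
        using that \<epsilon> h(1) w0
        by (intro mult_mono mult_left_mono w Kl v mult_nonneg_nonneg) (auto simp: euclidean_kernel_nonneg)
      finally show "ennreal \<kappa> * ennreal (h u * euclidean_kernel \<alpha> v u)
          \<le> ennreal (w u) * indicator ?B u * ennreal (h u * K (\<Phi> v) (\<Phi> u))"
        using \<kappa> w0 h(3)[of u] by (cases "u \<in> ?B") (auto simp: ennreal_mult'[symmetric] intro!: ennreal_leI)
    qed
    finally have "ennreal (\<kappa> * e v) \<le> T" .
    moreover have "integral_op \<mu> K F (\<Phi> v) = enn2real T"
      unfolding integral_op_def T_def by (rule integral_eq_nn_integral) (auto simp: FK0)
    ultimately show ?thesis
      using Tfin \<kappa> e(2)[of v] by (cases T) (auto simp: ennreal_le_iff2)
  qed
  have low: "ennreal ((1 - \<epsilon>) * \<delta> powr n * \<kappa> powr q) * X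
      \<le> (\<integral>\<^sup>+z. ennreal (\<bar>integral_op \<mu> K F z\<bar> powr q) \<partial>\<mu>)"
  proof -
    have "ennreal ((1 - \<epsilon>) * \<delta> powr n * \<kappa> powr q) * X
        = (\<integral>\<^sup>+u. ennreal ((1 - \<epsilon>) * \<delta> powr n * \<kappa> powr q) * (ennreal (e u powr q) * indicator ?B u) \<partial>lborel)"
      unfolding X_def by (rule nn_integral_cmult[symmetric]) measurable
    also have "\<dots> \<le> (\<integral>\<^sup>+u. ennreal (w u) * indicator ?B u * ennreal ((\<kappa> * e (\<Psi> (\<Phi> u))) powr q) \<partial>lborel)"
    proof (rule nn_integral_mono)
      fix u
      show "ennreal ((1 - \<epsilon>) * \<delta> powr n * \<kappa> powr q) * (ennreal (e u powr q) * indicator ?B u)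
          \<le> ennreal (w u) * indicator ?B u * ennreal ((\<kappa> * e (\<Psi> (\<Phi> u))) powr q)"
      proof (cases "u \<in> ?B")
        case True
        have "(1 - \<epsilon>) * \<delta> powr n * \<kappa> powr q * e u powr q = (1 - \<epsilon>) * \<delta> powr n * ((\<kappa> * e u) powr q)"
          using \<kappa> e(2) by (simp add: powr_mult)
        also have "\<dots> \<le> w u * (\<kappa> * e u) powr q"
          by (intro mult_right_mono w True) simp
        finally show ?thesis
          using True w0[OF True] \<epsilon> by (simp add: inv ennreal_mult'[symmetric] ennreal_leI)
      qed simp
    qed
    also have "\<dots> = (\<integral>\<^sup>+z. indicator D z * ennreal ((\<kappa> * e (\<Psi> z)) powr q) \<partial>\<mu>)"
      by (rule int[symmetric]) measurable
    also have "\<dots> \<le> (\<integral>\<^sup>+z. ennreal (\<bar>integral_op \<mu> K F z\<bar> powr q) \<partial>\<mu>)"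
    proof (rule nn_integral_mono)
      fix z
      show "indicator D z * ennreal ((\<kappa> * e (\<Psi> z)) powr q) \<le> ennreal (\<bar>integral_op \<mu> K F z\<bar> powr q)"
      proof (cases "z \<in> D")
        case True
        then obtain v where v: "v \<in> ?B" "z = \<Phi> v"
          by (auto simp: D_def)
        have "(\<kappa> * e v) powr q \<le> \<bar>integral_op \<mu> K F z\<bar> powr q"
          using pot[OF v(1)] \<kappa> e(2)[of v] q v(2) by (intro powr_mono2) auto
        then show ?thesis
          using True v by (simp add: inv ennreal_leI)
      qed simp
    qed
    finally show ?thesis .
  qed
  have main: "ennreal ((1 - \<epsilon>) * \<delta> powr n * \<kappa> powr q) * X
      \<le> ennreal (N powr q * ((1 + \<epsilon>) * \<delta> powr n * enn2real P) powr (q / p))"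
  \<comment> \<open>the supremum in \<open>sharp_const\<close> does not see functions of norm \<open>0\<close>; then \<open>h\<close> vanishes almost everywhere\<close>
  proof (cases "Lp_norm p \<mu> F = 0")
    case True
    then have "enn2real PF powr (1 / p) = 0"
      using PF by (simp add: Lp_norm_finite_eq PF_def[symmetric])
    then have "PF = 0"
      using PF by (auto simp: enn2real_eq_0_iff)
    have "AE u in lborel. ennreal (w u) * indicator ?B u * ennreal (h u powr p) = 0"
      using \<open>PF = 0\<close> unfolding PF_eq by (subst (asm) nn_integral_0_iff_AE) auto
    then have "AE u in lborel. h u = 0"
    proof eventually_elim
      case (elim u)
      show ?case
      proof (cases "u \<in> ?B")
        case True
        have "0 < (1 - \<epsilon>) * \<delta> powr n"
          using \<epsilon> \<delta> by simp
        with w(1)[OF True] have "0 < w u"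
          by linarith
        with elim True show ?thesis
          by (auto simp: ennreal_eq_0_iff not_le)
      qed (simp add: h)
    qed
    then have "riesz_potential \<alpha> h x = 0" for x
      unfolding riesz_potential_def
      by (subst nn_integral_0_iff_AE) (auto elim: eventually_mono)
    then have "X = 0"
      by (simp add: X_def e_def)
    then show ?thesis
      by simp
  next
    case False
    have "Lp_norm q \<mu> (integral_op \<mu> K F) / Lp_norm p \<mu> F \<le> sharp_const p q \<mu> K"
      unfolding sharp_const_def using F_Lp False by (intro SUP_upper) auto
    also have "\<dots> \<le> ennreal N"
      by (rule N)
    finally have div: "Lp_norm q \<mu> (integral_op \<mu> K F) / Lp_norm p \<mu> F \<le> ennreal N" .
    have nF: "Lp_norm p \<mu> F = ennreal (enn2real PF powr (1 / p))"
      using PF by (simp add: Lp_norm_finite_eq PF_def[symmetric])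
    have "0 < enn2real PF powr (1 / p)"
      using False nF by (metis ennreal_0 less_eq_real_def powr_ge_zero)
    then have "Lp_norm q \<mu> (integral_op \<mu> K F) \<le> ennreal (N * enn2real PF powr (1 / p))"
      using div N(2) unfolding nF by (intro ennreal_le_mult_of_divide_le)
    then have "(\<integral>\<^sup>+z. ennreal (\<bar>integral_op \<mu> K F z\<bar> powr q) \<partial>\<mu>)
        \<le> ennreal ((N * enn2real PF powr (1 / p)) powr q)"
      using N q by (subst (asm) Lp_norm_le_iff) auto
    also have "(N * enn2real PF powr (1 / p)) powr q = N powr q * enn2real PF powr (q / p)"
      using N by (simp add: powr_mult powr_powr)
    also have "ennreal (N powr q * enn2real PF powr (q / p))
        \<le> ennreal (N powr q * ((1 + \<epsilon>) * \<delta> powr n * enn2real P) powr (q / p))"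
      using PF_le \<epsilon> p q by (intro ennreal_leI mult_left_mono powr_mono2) (auto intro: enn2real_leI)
    finally show ?thesis
      using low by (rule order_trans[rotated])
  qed
  define A where "A = (1 - \<epsilon>) * \<delta> powr n * \<kappa> powr q"
  have A: "0 < A"
    using \<epsilon> \<delta> \<kappa> by (simp add: A_def)
  have expo: "n + \<alpha> * q = n * (q / p)"
    using pq n p q by (simp add: n_def field_simps)
  have A_eq: "A = ((1 - \<epsilon>) * ((1 - \<epsilon>) * (1 - \<epsilon>)) powr q) * \<delta> powr (n * (q / p))"
    using \<epsilon> \<delta> unfolding A_def \<kappa>_def expo[symmetric] by (simp add: powr_mult powr_powr powr_add)
  have B_eq: "((1 + \<epsilon>) * \<delta> powr n * enn2real P) powr (q / p)
      = (1 + \<epsilon>) powr (q / p) * \<delta> powr (n * (q / p)) * enn2real P powr (q / p)"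
    using \<epsilon> by (simp add: powr_mult powr_powr)
  have \<open>X \<le> ennreal (N powr q * ((1 + \<epsilon>) * \<delta> powr n * enn2real P) powr (q / p) / A)\<close>
  proof -
    have "X = ennreal (1 / A) * (ennreal A * X)"
      using A by (simp add: mult.assoc[symmetric] ennreal_mult[symmetric])
    also have "\<dots> \<le> ennreal (1 / A) * ennreal (N powr q * ((1 + \<epsilon>) * \<delta> powr n * enn2real P) powr (q / p))"
      using main unfolding A_def by (intro mult_left_mono) auto
    also have "\<dots> = ennreal (N powr q * ((1 + \<epsilon>) * \<delta> powr n * enn2real P) powr (q / p) / A)"
      using A by (simp add: ennreal_mult[symmetric])
    finally show ?thesis .
  qed
  also have "N powr q * ((1 + \<epsilon>) * \<delta> powr n * enn2real P) powr (q / p) / A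
      = N powr q * enn2real P powr (q / p) * ((1 + \<epsilon>) powr (q / p) / ((1 - \<epsilon>) * ((1 - \<epsilon>) * (1 - \<epsilon>)) powr q))"
  proof -
    have cancel: "x * (y * d * z) / (t * d) = x * z * (y / t)" if "d \<noteq> 0" for x y z d t :: real
      using that by simp
    show ?thesis
      unfolding A_eq B_eq by (rule cancel) (use \<delta> in simp)
  qed
  finally show ?thesis
    by (simp add: X_def P_def e_def)
qed


text \<open>A space that contains models of all Euclidean balls, to every accuracy \<open>\<epsilon>\<close>, has a sharp constant
at least as large as the Euclidean one: the bound for bounded functions supported in a ball follows
by letting \<open>\<epsilon>\<close> tend to \<open>0\<close>, and truncation extends it to \<open>L\<^sup>p\<close>.\<close>

lemma sharp_const_euclidean_le:
  fixes K :: "'a \<Rightarrow> 'a \<Rightarrow> real"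
  assumes a: "0 < \<alpha>" "\<alpha> < real CARD('n::finite)" and p: "0 < p" and q: "0 < q"
    and pq: "1 / q = 1 / p - \<alpha> / real CARD('n)"
    and model: "\<And>R \<epsilon>. 0 < R \<Longrightarrow> 0 < \<epsilon> \<Longrightarrow> \<epsilon> < 1 \<Longrightarrow>
      \<exists>\<delta> C \<Phi> \<Psi> w. 0 \<le> C \<and> euclidean_model \<mu> K \<alpha> R \<epsilon> \<delta> C (\<Phi> :: real ^ 'n \<Rightarrow> 'a) \<Psi> w"
  shows "sharp_const p q (lborel :: (real ^ 'n) measure) (euclidean_kernel \<alpha>) \<le> sharp_const p q \<mu> K"
proof (cases "sharp_const p q \<mu> K")
  case top
  then show ?thesis
    by simp
next
  case (real N)
  have bound: "(\<integral>\<^sup>+x\<in>ball 0 k. ennreal (enn2real (riesz_potential \<alpha> h x) powr q) \<partial>lborel)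
      \<le> ennreal (N powr q * enn2real (\<integral>\<^sup>+x. ennreal (h x powr p) \<partial>lborel) powr (q / p))"
    if k: "0 < k" and hm: "h \<in> borel_measurable borel"
      and h: "\<And>y. 0 \<le> h y" "\<And>y. h y \<le> B" "\<And>y. y \<notin> ball 0 k \<Longrightarrow> h y = 0"
    for k B and h :: "real ^ 'n \<Rightarrow> real"
  proof -
    define X where "X = (\<integral>\<^sup>+x\<in>ball 0 k. ennreal (enn2real (riesz_potential \<alpha> h x) powr q) \<partial>lborel)"
    define Y where "Y = N powr q * enn2real (\<integral>\<^sup>+x. ennreal (h x powr p) \<partial>lborel) powr (q / p)"
    define \<rho> where "\<rho> \<epsilon> = (1 + \<epsilon>) powr (q / p) / ((1 - \<epsilon>) * ((1 - \<epsilon>) * (1 - \<epsilon>)) powr q)" for \<epsilon> :: real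
    have le: "X \<le> ennreal (Y * \<rho> \<epsilon>)" if \<epsilon>: "0 < \<epsilon>" "\<epsilon> < 1" for \<epsilon>
    proof -
      obtain \<delta> C \<Phi> \<Psi> w where C: "0 \<le> C"
        and m: "euclidean_model \<mu> K \<alpha> k \<epsilon> \<delta> C (\<Phi> :: real ^ 'n \<Rightarrow> 'a) \<Psi> w"
        using model[OF k \<epsilon>] by blast
      have "sharp_const p q \<mu> K \<le> ennreal N"
        using real by simp
      from euclidean_model_bound[OF m \<epsilon> k C a p q pq this _ hm h] show ?thesis
        using real by (simp add: X_def Y_def \<rho>_def)
    qed
    have "(\<rho> \<longlongrightarrow> \<rho> 0) (at_right 0)"
      unfolding \<rho>_def by (intro tendsto_intros) auto
    then have "((\<lambda>\<epsilon>. ennreal (Y * \<rho> \<epsilon>)) \<longlongrightarrow> ennreal (Y * \<rho> 0)) (at_right 0)"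
      by (intro tendsto_ennrealI tendsto_mult tendsto_const)
    moreover have "\<forall>\<^sub>F \<epsilon> in at_right 0. X \<le> ennreal (Y * \<rho> \<epsilon>)"
      using le by (auto simp: eventually_at_right_field intro!: exI[of _ 1])
    ultimately have "X \<le> ennreal (Y * \<rho> 0)"
      by (intro tendsto_lowerbound) auto
    then show ?thesis
      by (simp add: X_def Y_def \<rho>_def)
  qed
  have "Lp_norm q lborel (integral_op lborel (euclidean_kernel \<alpha>) f) / Lp_norm p lborel f \<le> ennreal N"
    if f: "f \<in> Lp_space p lborel" and f0: "Lp_norm p lborel f \<noteq> 0" for f :: "real ^ 'n \<Rightarrow> real"
  proof (rule divide_le_posI_ennreal)
    show "0 < Lp_norm p lborel f"
      using f0 by (simp add: zero_less_iff_neq_zero)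
    have "Lp_norm q lborel (integral_op lborel (euclidean_kernel \<alpha>) f) \<le> ennreal N * Lp_norm p lborel f"
      by (rule integral_op_Lp_norm_le_of_truncations[OF a p q _ bound f]) (use real in auto)
    then show "Lp_norm q lborel (integral_op lborel (euclidean_kernel \<alpha>) f) \<le> Lp_norm p lborel f * ennreal N"
      by (simp add: mult.commute)
  qed
  note bound_f = this
  show ?thesis
  proof -
    have "sharp_const p q \<mu> K = ennreal N"
      using real by simp
    then show ?thesis
      by (subst sharp_const_def) (auto intro!: SUP_least bound_f)
  qed
qed

section \<open>Charts and existence of the Riemannian volume\<close>

lemma continuous_on_det:
  fixes f :: "'a::topological_space \<Rightarrow> real ^ 'n::finite ^ 'n"
  assumes "continuous_on S f"
  shows "continuous_on S (\<lambda>x. det (f x))"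
  unfolding det_def
  by (intro continuous_on_sum continuous_on_mult continuous_on_const continuous_on_prod
      continuous_on_component assms)

lemma smooth_on_continuous_on: "smooth_on S f \<Longrightarrow> continuous_on S f"
  unfolding smooth_on_def by (drule spec[of _ 0]) simp

lemma smooth_on_has_derivative:
  assumes "smooth_on S f" "x \<in> S"
  shows "(f has_derivative frechet_derivative f (at x)) (at x)"
proof -
  have "Ck_on (Suc 0) f S"
    using assms(1) by (simp only: smooth_on_def)
  with assms(2) show ?thesis
    by (simp add: frechet_derivative_works)
qed

lemma smooth_on_continuous_derivative:
  assumes "smooth_on S f"
  shows "continuous_on S (\<lambda>x. frechet_derivative f (at x) v)"
proof -
  have "Ck_on (Suc 0) f S"
    using assms by (simp only: smooth_on_def)
  then show ?thesis
    by simp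
qed

lemma continuous_on_jacobian:
  fixes f :: "real ^ 'n::finite \<Rightarrow> real ^ 'n"
  assumes "smooth_on S f"
  shows "continuous_on S (\<lambda>x. matrix (frechet_derivative f (at x)))"
  unfolding matrix_def
  by (intro continuous_on_vec_lambda continuous_on_component smooth_on_continuous_derivative assms)

context riemannian_manifold
begin

definition chart_inv :: "('a, 'n) chart \<Rightarrow> real ^ 'n \<Rightarrow> 'a" where
  "chart_inv c = inv_into (fst c) (snd c)"

definition chart_range :: "('a, 'n) chart \<Rightarrow> (real ^ 'n) set" where
  "chart_range c = snd c ` fst c"

definition chart_metric :: "('a, 'n) chart \<Rightarrow> real ^ 'n \<Rightarrow> real ^ 'n ^ 'n" where
  "chart_metric c x = g c (chart_inv c x)"

lemma chart_subset: "c \<in> A \<Longrightarrow> fst c \<subseteq> M"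
  using atlas_cover by blast

lemma chart_openin: "c \<in> A \<Longrightarrow> openin (top_of_set M) (fst c)"
  using chart_open[of "fst c" "snd c"] by simp

lemma chart_range_open: "c \<in> A \<Longrightarrow> open (chart_range c)"
  using chart_image_open[of "fst c" "snd c"] by (simp add: chart_range_def)

lemma chart_homeomorphism: "c \<in> A \<Longrightarrow> homeomorphism (fst c) (chart_range c) (snd c) (chart_inv c)"
  using chart_homeo[of "fst c" "snd c"] by (simp add: chart_range_def chart_inv_def)

lemma chart_inv_chart: "c \<in> A \<Longrightarrow> p \<in> fst c \<Longrightarrow> chart_inv c (snd c p) = p"
  using chart_homeomorphism[of c] unfolding homeomorphism_def by blast

lemma chart_chart_inv: "c \<in> A \<Longrightarrow> x \<in> chart_range c \<Longrightarrow> snd c (chart_inv c x) = x"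
  using chart_homeomorphism[of c] unfolding homeomorphism_def by blast

lemma chart_in_range: "c \<in> A \<Longrightarrow> p \<in> fst c \<Longrightarrow> snd c p \<in> chart_range c"
  by (simp add: chart_range_def)

lemma chart_inv_in: "c \<in> A \<Longrightarrow> x \<in> chart_range c \<Longrightarrow> chart_inv c x \<in> fst c"
  using chart_homeomorphism[of c] unfolding homeomorphism_def by blast

lemma chart_continuous: "c \<in> A \<Longrightarrow> continuous_on (fst c) (snd c)"
  using chart_homeomorphism[of c] unfolding homeomorphism_def by blast

lemma chart_inv_continuous: "c \<in> A \<Longrightarrow> continuous_on (chart_range c) (chart_inv c)"
  using chart_homeomorphism[of c] unfolding homeomorphism_def by blast

lemma chart_image_eq:
  assumes "c \<in> A" "E \<subseteq> fst c"
  shows "snd c ` E = {x \<in> chart_range c. chart_inv c x \<in> E}"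
  using assms chart_inv_chart[OF assms(1)] chart_chart_inv[OF assms(1)] chart_in_range[OF assms(1)]
  by (auto simp: image_iff) (metis)

lemma overlap_open:
  assumes c: "c \<in> A" and d: "d \<in> A"
  shows "open (snd c ` (fst c \<inter> fst d))"
proof -
  have "openin (top_of_set M) (fst c \<inter> fst d)"
    by (intro openin_Int chart_openin c d)
  then have "openin (top_of_set (fst c)) (fst c \<inter> fst d)"
    using chart_subset[OF c] by (meson Int_lower1 openin_subset_trans)
  then have "openin (top_of_set (chart_range c)) (snd c ` (fst c \<inter> fst d))"
    by (rule homeomorphism_imp_open_map[OF chart_homeomorphism[OF c]])
  then show ?thesis
    using chart_range_open[OF c] by (simp add: openin_open_eq)
qed

lemma transition_smooth_on:
  "c \<in> A \<Longrightarrow> d \<in> A \<Longrightarrow> smooth_on (snd c ` (fst c \<inter> fst d)) (snd d \<circ> chart_inv c)"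
  using transition_smooth[of "fst c" "snd c" "fst d" "snd d"] by (simp add: chart_inv_def)

lemma chart_metric_continuous: "c \<in> A \<Longrightarrow> continuous_on (chart_range c) (chart_metric c)"
  using smooth_on_continuous_on[OF metric_smooth[of "fst c" "snd c"]]
  by (simp add: chart_metric_def[abs_def] chart_range_def chart_inv_def)

lemma metric_change_of_chart:
  assumes "c \<in> A" "d \<in> A" "p \<in> fst c" "p \<in> fst d"
    and "J = matrix (frechet_derivative (snd d \<circ> chart_inv c) (at (snd c p)))"
  shows "g c p = transpose J ** g d p ** J"
  using metric_transform[of "fst c" "snd c" "fst d" "snd d" p J] assms by (simp add: chart_inv_def)

definition volume_density :: "('a, 'n) chart \<Rightarrow> real ^ 'n \<Rightarrow> ennreal" where
  "volume_density c x = ennreal (sqrt (det (chart_metric c x)))"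

lemma volume_density_measurable:
  assumes "c \<in> A" "B \<subseteq> chart_range c" "B \<in> sets borel"
  shows "(\<lambda>x. volume_density c x * indicator B x) \<in> borel_measurable borel"
proof -
  have B: "B \<inter> chart_range c = B"
    using assms by auto
  have "(\<lambda>x. if x \<in> chart_range c then sqrt (det (chart_metric c x)) else 0) \<in> borel_measurable borel"
    using chart_range_open[OF assms(1)]
    by (intro borel_measurable_continuous_on_if continuous_on_const continuous_on_real_sqrt
        continuous_on_det chart_metric_continuous assms) auto
  then have "(\<lambda>x. ennreal (if x \<in> chart_range c then sqrt (det (chart_metric c x)) else 0) * indicator B x)
      \<in> borel_measurable borel"
    using assms(3) by measurable
  moreover have "(\<lambda>x. ennreal (if x \<in> chart_range c then sqrt (det (chart_metric c x)) else 0) * indicator B x)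
      = (\<lambda>x. volume_density c x * indicator B x)"
    using assms(2) by (auto simp: volume_density_def indicator_def fun_eq_iff)
  ultimately show ?thesis
    by simp
qed

definition chart_volume :: "('a, 'n) chart \<Rightarrow> 'a set \<Rightarrow> ennreal" where
  "chart_volume c E = (\<integral>\<^sup>+x\<in>snd c ` E. volume_density c x \<partial>lborel)"

lemma is_riemannian_volume_iff:
  "is_riemannian_volume M A g \<mu> \<longleftrightarrow> space \<mu> = M \<and> sets \<mu> = sets (restrict_space borel M) \<and>
    (\<forall>c\<in>A. \<forall>E\<in>sets \<mu>. E \<subseteq> fst c \<longrightarrow> emeasure \<mu> E = chart_volume c E)"
  by (auto simp: is_riemannian_volume_def chart_volume_def volume_density_def chart_metric_def
      chart_inv_def split_beta)

end

locale compact_riemannian_manifold = riemannian_manifold M A g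
  for M :: "'a::t2_space set" and A :: "('a, 'n::finite) chart set" and g +
  assumes compact_M: "compact M"
begin

abbreviation borel_M :: "'a measure" where
  "borel_M \<equiv> restrict_space borel M"

lemma M_borel: "M \<in> sets borel"
  using compact_imp_closed[OF compact_M] by simp

lemma sets_borel_M: "E \<in> sets borel_M \<longleftrightarrow> E \<subseteq> M \<and> E \<in> sets borel"
  using M_borel by (subst sets_restrict_space_iff) auto

lemma borel_M_subset: "E \<in> sets borel_M \<Longrightarrow> E \<subseteq> M"
  by (simp add: sets_borel_M)

lemma chart_borel_M:
  assumes "c \<in> A"
  shows "fst c \<in> sets borel_M"
proof -
  obtain T where "open T" "fst c = M \<inter> T"
    using chart_openin[OF assms] by (auto simp: openin_open)
  then show ?thesis
    using M_borel by (auto simp: sets_borel_M)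
qed

lemma chart_inv_measurable:
  assumes c: "c \<in> A" and p: "p \<in> M"
  shows "(\<lambda>x. if x \<in> chart_range c then chart_inv c x else p) \<in> measurable borel borel_M"
proof (rule measurable_restrict_space2)
  show "(\<lambda>x. if x \<in> chart_range c then chart_inv c x else p) \<in> borel_measurable borel"
    using chart_range_open[OF c]
    by (intro borel_measurable_continuous_on_if chart_inv_continuous c continuous_on_const) auto
  show "(\<lambda>x. if x \<in> chart_range c then chart_inv c x else p) \<in> space borel \<rightarrow> M"
  proof (rule Pi_I)
    fix x
    have "chart_inv c x \<in> M" if "x \<in> chart_range c"
      using chart_inv_in[OF c that] chart_subset[OF c] by blast
    then show "(if x \<in> chart_range c then chart_inv c x else p) \<in> M"
      using p by simp
  qed
qed

lemma chart_measurable: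
  assumes c: "c \<in> A"
  shows "(\<lambda>z. if z \<in> fst c then snd c z else 0) \<in> borel_measurable borel_M"
proof (rule measurable_restrict_space1)
  show "(\<lambda>z. if z \<in> fst c then snd c z else 0) \<in> borel_measurable borel"
    using chart_borel_M[OF c]
    by (intro borel_measurable_continuous_on_if chart_continuous c continuous_on_const)
      (simp add: sets_borel_M)
qed

lemma chart_image_borel:
  assumes c: "c \<in> A" and E: "E \<in> sets borel_M" "E \<subseteq> fst c"
  shows "snd c ` E \<in> sets borel"
proof (cases "M = {}")
  case True
  then have "E = {}"
    using borel_M_subset[OF E(1)] by simp
  then show ?thesis
    by simp
next
  case False
  then obtain p where p: "p \<in> M"
    by auto
  have "(\<lambda>x. if x \<in> chart_range c then chart_inv c x else p) -` E \<in> sets borel"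
    using measurable_sets[OF chart_inv_measurable[OF c p] E(1)] by simp
  then have "chart_range c \<inter> (\<lambda>x. if x \<in> chart_range c then chart_inv c x else p) -` E \<in> sets borel"
    using chart_range_open[OF c] by (intro sets.Int) auto
  also have "chart_range c \<inter> (\<lambda>x. if x \<in> chart_range c then chart_inv c x else p) -` E = snd c ` E"
    unfolding chart_image_eq[OF c E(2)] by auto
  finally show ?thesis .
qed

text \<open>On subsets of its domain, the volume computed in a single chart is a measure: the image under the
inverse chart of the measure with density \<open>sqrt (det g)\<close>. Points off the range of the chart carry
density \<open>0\<close> and may be sent to any point of \<open>M\<close>.\<close>

lemma chart_volume_measure:
  assumes c: "c \<in> A"
  obtains \<nu> where "sets \<nu> = sets borel_M"
    "\<And>E. E \<in> sets borel_M \<Longrightarrow> E \<subseteq> fst c \<Longrightarrow> emeasure \<nu> E = chart_volume c E"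
proof (cases "M = {}")
  case True
  show ?thesis
  proof (rule that[of "null_measure borel_M"])
    fix E assume "E \<in> sets borel_M"
    with True have "E = {}"
      using borel_M_subset by blast
    then show "emeasure (null_measure borel_M) E = chart_volume c E"
      by (simp add: chart_volume_def)
  qed simp
next
  case False
  then obtain p where p: "p \<in> M"
    by auto
  let ?h = "\<lambda>x. if x \<in> chart_range c then chart_inv c x else p"
  let ?w = "\<lambda>x. volume_density c x * indicator (chart_range c) x"
  have h [measurable]: "?h \<in> measurable borel borel_M"
    by (rule chart_inv_measurable[OF c p])
  have w [measurable]: "?w \<in> borel_measurable borel"
    using chart_range_open[OF c] by (intro volume_density_measurable[OF c]) auto
  show ?thesis
  proof (rule that[of "distr (density lborel ?w) borel_M ?h"])
    fix E assume E: "E \<in> sets borel_M" "E \<subseteq> fst c"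
    have pre: "?h -` E \<in> sets borel"
      using measurable_sets[OF h E(1)] by simp
    have "emeasure (distr (density lborel ?w) borel_M ?h) E = emeasure (density lborel ?w) (?h -` E)"
      using E(1) by (subst emeasure_distr) auto
    also have "\<dots> = (\<integral>\<^sup>+x. ?w x * indicator (?h -` E) x \<partial>lborel)"
      using pre by (subst emeasure_density) auto
    also have "\<dots> = chart_volume c E"
      unfolding chart_volume_def chart_image_eq[OF c E(2)]
      by (intro nn_integral_cong) (auto simp: indicator_def)
    finally show "emeasure (distr (density lborel ?w) borel_M ?h) E = chart_volume c E" .
  qed simp
qed

text \<open>For the transition map \<open>T\<close> with Jacobian matrix \<open>J\<close>, the tensor law
\<open>g\<^sub>c = J\<^sup>T g\<^sub>d J\<close> gives \<open>sqrt (det g\<^sub>c) = \<bar>det J\<bar> * sqrt (det g\<^sub>d)\<close>, which is the factor that the change of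
variables by \<open>T\<close> produces.\<close>

lemma chart_volume_change:
  assumes c: "c \<in> A" and d: "d \<in> A" and E: "E \<in> sets borel_M" "E \<subseteq> fst c" "E \<subseteq> fst d"
  shows "chart_volume c E = chart_volume d E"
proof -
  define T where "T = snd d \<circ> chart_inv c"
  define V where "V = snd c ` (fst c \<inter> fst d)"
  define S where "S = snd c ` E"
  define J where "J x = frechet_derivative T (at x)" for x
  have smooth: "smooth_on V T"
    unfolding T_def V_def by (rule transition_smooth_on[OF c d])
  have V: "open V"
    unfolding V_def by (rule overlap_open[OF c d])
  have SV: "S \<subseteq> V"
    using E by (auto simp: S_def V_def)
  have S: "S \<in> sets borel"
    unfolding S_def by (rule chart_image_borel[OF c E(1,2)])
  have "T (snd c p) = snd d p" if "p \<in> fst c" for p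
    using chart_inv_chart[OF c that] by (simp add: T_def)
  then have TS: "T ` S = snd d ` E"
    using E(2) by (auto simp: S_def image_iff) (metis subsetD)+
  have TS_borel: "T ` S \<in> sets borel"
    unfolding TS by (rule chart_image_borel[OF d E(1,3)])
  have S_range: "x \<in> chart_range c" "chart_inv c x \<in> fst c" "chart_inv c x \<in> fst d"
      "snd c (chart_inv c x) = x" "chart_inv d (T x) = chart_inv c x" if "x \<in> S" for x
  proof -
    obtain p where p: "p \<in> E" "x = snd c p"
      using \<open>x \<in> S\<close> by (auto simp: S_def)
    then have pc: "p \<in> fst c" "p \<in> fst d"
      using E by auto
    have "chart_inv c x = p"
      using p(2) chart_inv_chart[OF c pc(1)] by simp
    moreover have "chart_inv d (T x) = p"
      using chart_inv_chart[OF d pc(2)] calculation by (simp add: T_def)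
    ultimately show "x \<in> chart_range c" "chart_inv c x \<in> fst c" "chart_inv c x \<in> fst d"
      "snd c (chart_inv c x) = x" "chart_inv d (T x) = chart_inv c x"
      using p pc chart_in_range[OF c pc(1)] by auto
  qed
  have dens: "volume_density c x = ennreal \<bar>det (matrix (J x))\<bar> * volume_density d (T x)" if "x \<in> S" for x
  proof -
    have "g c (chart_inv c x) = transpose (matrix (J x)) ** g d (chart_inv c x) ** matrix (J x)"
      using S_range[OF that] by (intro metric_change_of_chart[OF c d]) (auto simp: J_def T_def)
    then have "chart_metric c x = transpose (matrix (J x)) ** chart_metric d (T x) ** matrix (J x)"
      using S_range(5)[OF that] by (simp add: chart_metric_def)
    then have "det (chart_metric c x) = (det (matrix (J x)))\<^sup>2 * det (chart_metric d (T x))"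
      by (simp add: det_mul power2_eq_square)
    then show ?thesis
      by (simp add: volume_density_def real_sqrt_mult ennreal_mult')
  qed
  have Jm: "(\<lambda>x. indicator S x * \<bar>det (matrix (J x))\<bar>) \<in> borel_measurable borel"
  proof -
    have "continuous_on S (\<lambda>x. \<bar>det (matrix (J x))\<bar>)"
      using continuous_on_jacobian[OF smooth] SV unfolding J_def
      by (intro continuous_on_rabs continuous_on_det) (rule continuous_on_subset)
    from borel_measurable_continuous_on_indicator[OF S this] show ?thesis
      by simp
  qed
  have "chart_volume d E = (\<integral>\<^sup>+y. indicator (T ` S) y * (volume_density d y * indicator (T ` S) y) \<partial>lborel)"
    unfolding chart_volume_def TS by (intro nn_integral_cong) (auto simp: indicator_def)
  also have "\<dots> = (\<integral>\<^sup>+x. ennreal (indicator S x * \<bar>det (matrix (J x))\<bar>)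
      * (volume_density d (T x) * indicator (T ` S) (T x)) \<partial>lborel)"
  proof (rule nn_integral_change_of_variables[OF S TS_borel _ _ Jm])
    show "(T has_derivative J x) (at x within S)" if "x \<in> S" for x
      unfolding J_def using smooth_on_has_derivative[OF smooth, of x] that SV
      by (auto intro: has_derivative_at_withinI)
    show "inj_on T S"
      using S_range(4,5) by (metis inj_onI)
    show "(\<lambda>y. volume_density d y * indicator (T ` S) y) \<in> borel_measurable borel"
      using TS_borel E(3) by (intro volume_density_measurable[OF d]) (auto simp: TS chart_range_def)
  qed
  also have "\<dots> = chart_volume c E"
    unfolding chart_volume_def S_def[symmetric]
    by (intro nn_integral_cong) (auto simp: indicator_def dens)
  finally show ?thesis ..
qed

text \<open>Finitely many charts cover \<open>M\<close>; removing from each domain the earlier ones makes them disjoint.\<close>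

lemma finite_chart_partition:
  obtains k :: nat and c P where "\<And>i. i < k \<Longrightarrow> c i \<in> A" "\<And>i. i < k \<Longrightarrow> P i \<in> sets borel_M"
    "\<And>i. i < k \<Longrightarrow> P i \<subseteq> fst (c i)" "disjoint_family_on P {..<k}" "M = (\<Union>i<k. P i)"
proof -
  obtain F where F: "F \<subseteq> A" "finite F" "M \<subseteq> (\<Union>c\<in>F. fst c)"
  proof -
    have "\<forall>c\<in>A. \<exists>T. open T \<and> fst c = M \<inter> T"
      using chart_openin by (auto simp: openin_open)
    then obtain T where T: "\<And>c. c \<in> A \<Longrightarrow> open (T c) \<and> fst c = M \<inter> T c"
      by metis
    have cover: "M \<subseteq> (\<Union>c\<in>A. T c)"
    proof
      fix z assume "z \<in> M"
      then obtain c where "c \<in> A" "z \<in> fst c"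
        using atlas_cover by blast
      then show "z \<in> (\<Union>c\<in>A. T c)"
        using T by blast
    qed
    obtain F where "F \<subseteq> A" "finite F" and F: "M \<subseteq> (\<Union>c\<in>F. T c)"
      by (rule compactE_image[OF compact_M _ cover]) (use T in auto)
    have "M \<subseteq> (\<Union>c\<in>F. fst c)"
    proof
      fix z assume "z \<in> M"
      then obtain c where "c \<in> F" "z \<in> T c"
        using F by blast
      then show "z \<in> (\<Union>c\<in>F. fst c)"
        using T[of c] \<open>F \<subseteq> A\<close> \<open>z \<in> M\<close> by blast
    qed
    with \<open>F \<subseteq> A\<close> \<open>finite F\<close> show ?thesis
      by (rule that)
  qed
  obtain c where c: "bij_betw c {..<card F} F"
    using ex_bij_betw_nat_finite[OF F(2)] by (auto simp: atLeast0LessThan)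
  have cA: "c i \<in> A" if "i < card F" for i
    using c F(1) that by (auto simp: bij_betw_def)
  define P where "P i = fst (c i) - (\<Union>j<i. fst (c j))" for i
  show ?thesis
  proof (rule that[of "card F" c P])
    fix i assume i: "i < card F"
    show "c i \<in> A"
      by (rule cA[OF i])
    show "P i \<in> sets borel_M"
      unfolding P_def using i by (intro sets.Diff sets.finite_UN chart_borel_M cA) auto
    show "P i \<subseteq> fst (c i)"
      by (auto simp: P_def)
  next
    have disj: "P m \<inter> P n = {}" if "m < n" for m n :: nat
      using that by (auto simp: P_def)
    show "disjoint_family_on P {..<card F}"
      unfolding disjoint_family_on_def
    proof (intro ballI impI)
      fix m n :: nat assume "m \<noteq> n"
      then show "P m \<inter> P n = {}"
        using disj[of m n] disj[of n m] by (cases m n rule: linorder_cases) (simp_all add: Int_commute)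
    qed
    have cF: "c ` {..<card F} = F"
      using c by (simp add: bij_betw_def)
    have "(\<Union>d\<in>F. fst d) = (\<Union>i<card F. fst (c i))"
      by (subst cF[symmetric]) simp
    then have "M \<subseteq> (\<Union>i<card F. fst (c i))"
      using F(3) by simp
    moreover have "(\<Union>i<card F. fst (c i)) \<subseteq> M"
      using chart_subset cA by (intro UN_least) simp
    ultimately have "M = (\<Union>i<card F. fst (c i))"
      by (rule equalityI)
    also have "\<dots> = (\<Union>i<card F. P i)"
    proof (intro equalityI subsetI)
      fix z assume "z \<in> (\<Union>i<card F. fst (c i))"
      then obtain i where i: "i < card F" "z \<in> fst (c i)"
        by auto
      define m where "m = (LEAST i. z \<in> fst (c i))"
      have "z \<in> fst (c m)"
        unfolding m_def by (rule LeastI[of "\<lambda>i. z \<in> fst (c i)", OF i(2)])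
      moreover have "m \<le> i"
        unfolding m_def by (rule Least_le[of "\<lambda>i. z \<in> fst (c i)", OF i(2)])
      moreover have "z \<notin> fst (c j)" if "j < m" for j
        using that not_less_Least[of j "\<lambda>i. z \<in> fst (c i)"] by (simp add: m_def)
      ultimately show "z \<in> (\<Union>i<card F. P i)"
        using i(1) by (auto simp: P_def intro!: bexI[of _ m])
    qed (auto simp: P_def)
    finally show "M = (\<Union>i<card F. P i)" .
  qed
qed

text \<open>The pieces of the partition lie in charts, where the measure is prescribed.\<close>

lemma riemannian_volume_unique:
  assumes "is_riemannian_volume M A g \<mu>" "is_riemannian_volume M A g \<nu>"
  shows "\<mu> = \<nu>"
proof -
  obtain k :: nat and c P where c: "\<And>i. i < k \<Longrightarrow> c i \<in> A"
    and P: "\<And>i. i < k \<Longrightarrow> P i \<in> sets borel_M" "\<And>i. i < k \<Longrightarrow> P i \<subseteq> fst (c i)"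
      "disjoint_family_on P {..<k}" "M = (\<Union>i<k. P i)"
    by (rule finite_chart_partition) (rule that; assumption)
  have decomp: "emeasure \<rho> E = (\<Sum>i<k. chart_volume (c i) (E \<inter> P i))"
    if \<rho>: "is_riemannian_volume M A g \<rho>" and E: "E \<in> sets borel_M" for \<rho> E
  proof -
    have sets: "sets \<rho> = sets borel_M"
      and em: "\<And>c E. c \<in> A \<Longrightarrow> E \<in> sets borel_M \<Longrightarrow> E \<subseteq> fst c \<Longrightarrow> emeasure \<rho> E = chart_volume c E"
      using \<rho> by (auto simp: is_riemannian_volume_iff)
    have "E \<subseteq> (\<Union>i\<in>{..<k}. P i)"
      using borel_M_subset[OF E] unfolding P(4)[symmetric] .
    then have "emeasure \<rho> E = (\<Sum>i<k. emeasure \<rho> (E \<inter> P i))"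
      using E P(1,3) sets by (intro sum_emeasure_cover) auto
    also have "\<dots> = (\<Sum>i<k. chart_volume (c i) (E \<inter> P i))"
      using E P c by (intro sum.cong refl em) auto
    finally show ?thesis .
  qed
  show ?thesis
  proof (rule measure_eqI)
    show "sets \<mu> = sets \<nu>"
      using assms by (simp add: is_riemannian_volume_iff)
    fix E assume "E \<in> sets \<mu>"
    then have "E \<in> sets borel_M"
      using assms by (simp add: is_riemannian_volume_iff)
    then show "emeasure \<mu> E = emeasure \<nu> E"
      using assms decomp by simp
  qed
qed

text \<open>The volumes of the pieces are computed in their own charts and added. By invariance under change
of chart, the result is right in every other chart as well.\<close>

lemma riemannian_volume_exists: "\<exists>\<mu>. is_riemannian_volume M A g \<mu>"
proof -
  obtain k :: nat and c P where c: "\<And>i. i < k \<Longrightarrow> c i \<in> A"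
    and P: "\<And>i. i < k \<Longrightarrow> P i \<in> sets borel_M" "\<And>i. i < k \<Longrightarrow> P i \<subseteq> fst (c i)"
      "disjoint_family_on P {..<k}" "M = (\<Union>i<k. P i)"
    by (rule finite_chart_partition) (rule that; assumption)
  have "\<forall>i\<in>{..<k}. \<exists>\<nu>. sets \<nu> = sets borel_M \<and>
      (\<forall>E. E \<in> sets borel_M \<longrightarrow> E \<subseteq> fst (c i) \<longrightarrow> emeasure \<nu> E = chart_volume (c i) E)"
  proof
    fix i assume "i \<in> {..<k}"
    then have ci: "c i \<in> A"
      using c by simp
    show "\<exists>\<nu>. sets \<nu> = sets borel_M \<and>
        (\<forall>E. E \<in> sets borel_M \<longrightarrow> E \<subseteq> fst (c i) \<longrightarrow> emeasure \<nu> E = chart_volume (c i) E)"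
      by (rule chart_volume_measure[OF ci]) blast
  qed
  from bchoice[OF this] obtain \<nu> where \<nu>_all: "\<forall>i\<in>{..<k}. sets (\<nu> i) = sets borel_M \<and>
      (\<forall>E. E \<in> sets borel_M \<longrightarrow> E \<subseteq> fst (c i) \<longrightarrow> emeasure (\<nu> i) E = chart_volume (c i) E)" ..
  have \<nu>: "sets (\<nu> i) = sets borel_M" "E \<in> sets borel_M \<Longrightarrow> E \<subseteq> fst (c i) \<Longrightarrow> emeasure (\<nu> i) E = chart_volume (c i) E"
    if "i < k" for i E
    using \<nu>_all that by auto
  define m where "m E = (\<Sum>i<k. emeasure (\<nu> i) (E \<inter> P i))" for E
  define \<mu> where "\<mu> = measure_of M (sets borel_M) m"
  have alg: "sigma_algebra M (sets borel_M)"
    using sets.sigma_algebra_axioms[of borel_M] by (simp add: space_restrict_space)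
  have closed: "sets borel_M \<subseteq> Pow M"
    using borel_M_subset by auto
  have sets_\<mu>: "sets \<mu> = sets borel_M"
    using sigma_algebra.sigma_sets_eq[OF alg] closed by (simp add: \<mu>_def sets_measure_of)
  have space_\<mu>: "space \<mu> = M"
    unfolding \<mu>_def using closed by (rule space_measure_of)
  have em: "emeasure \<mu> E = m E" if "E \<in> sets borel_M" for E
    unfolding \<mu>_def
  proof (rule emeasure_measure_of_sigma[OF alg _ _ that])
    show "positive (sets borel_M) m"
      by (simp add: positive_def m_def)
    show "countably_additive (sets borel_M) m"
    proof (rule countably_additiveI)
      fix B :: "nat \<Rightarrow> 'a set"
      assume B: "range B \<subseteq> sets borel_M" "disjoint_family B" "(\<Union>i. B i) \<in> sets borel_M"
      have "(\<Sum>n. m (B n)) = (\<Sum>i<k. \<Sum>n. emeasure (\<nu> i) (B n \<inter> P i))"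
        unfolding m_def by (rule suminf_sum) simp
      also have "\<dots> = (\<Sum>i<k. emeasure (\<nu> i) ((\<Union>n. B n) \<inter> P i))"
      proof (rule sum.cong[OF refl])
        fix i assume "i \<in> {..<k}"
        then have "range (\<lambda>n. B n \<inter> P i) \<subseteq> sets (\<nu> i)"
          using B(1) P(1)[of i] \<nu>(1)[of i] by auto
        then have "(\<Sum>n. emeasure (\<nu> i) (B n \<inter> P i)) = emeasure (\<nu> i) (\<Union>n. B n \<inter> P i)"
          using B(2) by (intro suminf_emeasure) (auto simp: disjoint_family_on_def)
        then show "(\<Sum>n. emeasure (\<nu> i) (B n \<inter> P i)) = emeasure (\<nu> i) ((\<Union>n. B n) \<inter> P i)"
          by simp
      qed
      finally show "(\<Sum>n. m (B n)) = m (\<Union>n. B n)"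
        by (simp add: m_def)
    qed
  qed
  have "emeasure \<mu> E = chart_volume d E" if d: "d \<in> A" and E: "E \<in> sets borel_M" "E \<subseteq> fst d" for d E
  proof -
    obtain \<rho> where \<rho>: "sets \<rho> = sets borel_M"
      "\<And>E. E \<in> sets borel_M \<Longrightarrow> E \<subseteq> fst d \<Longrightarrow> emeasure \<rho> E = chart_volume d E"
      by (rule chart_volume_measure[OF d]) blast
    have "emeasure \<mu> E = (\<Sum>i<k. emeasure (\<nu> i) (E \<inter> P i))"
      by (simp add: em[OF E(1)] m_def)
    also have "\<dots> = (\<Sum>i<k. emeasure \<rho> (E \<inter> P i))"
    proof (rule sum.cong[OF refl])
      fix i assume "i \<in> {..<k}"
      then have i: "i < k"
        by simp
      have EP: "E \<inter> P i \<in> sets borel_M" "E \<inter> P i \<subseteq> fst (c i)" "E \<inter> P i \<subseteq> fst d"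
        using E P(1)[OF i] P(2)[OF i] by (auto intro: sets.Int)
      show "emeasure (\<nu> i) (E \<inter> P i) = emeasure \<rho> (E \<inter> P i)"
        using chart_volume_change[OF c[OF i] d EP] \<nu>(2)[OF i EP(1,2)] \<rho>(2)[OF EP(1,3)] by simp
    qed
    also have "\<dots> = emeasure \<rho> E"
    proof (rule sum_emeasure_cover[symmetric])
      show "E \<subseteq> (\<Union>i\<in>{..<k}. P i)"
        using borel_M_subset[OF E(1)] unfolding P(4)[symmetric] .
    qed (use E(1) P(1,3) \<rho>(1) in auto)
    also have "\<dots> = chart_volume d E"
      by (rule \<rho>(2)[OF E])
    finally show ?thesis .
  qed
  then have "is_riemannian_volume M A g \<mu>"
    by (simp add: is_riemannian_volume_iff sets_\<mu> space_\<mu>)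
  then show ?thesis ..
qed

lemma is_riemannian_volume: "is_riemannian_volume M A g (riemannian_volume M A g)"
  unfolding riemannian_volume_def
  using riemannian_volume_exists riemannian_volume_unique by (metis theI)

lemma riemannian_volume_sets: "sets (riemannian_volume M A g) = sets borel_M"
  using is_riemannian_volume by (simp add: is_riemannian_volume_iff)

lemma riemannian_volume_chart:
  "c \<in> A \<Longrightarrow> E \<in> sets borel_M \<Longrightarrow> E \<subseteq> fst c \<Longrightarrow> emeasure (riemannian_volume M A g) E = chart_volume c E"
  using is_riemannian_volume by (simp add: is_riemannian_volume_iff)

end

section \<open>Speed and length of curves\<close>

lemma inner_congruence:
  fixes B :: "real ^ 'n::finite ^ 'n"
  shows "u \<bullet> ((transpose J ** B ** J) *v v) = (J *v u) \<bullet> (B *v (J *v v))"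
proof -
  have "(transpose J ** B ** J) *v v = (B *v (J *v v)) v* J"
    by (simp add: matrix_vector_mul_assoc[symmetric] transpose_matrix_vector)
  then show ?thesis
    by (metis dot_lmul_matrix inner_commute)
qed

lemma C1_curve_onD:
  assumes "C1_curve_on A \<gamma> a b" "c \<in> A"
  obtains D where "continuous_on {t \<in> {a..b}. \<gamma> t \<in> fst c} D"
    "\<And>t. t \<in> {a..b} \<Longrightarrow> \<gamma> t \<in> fst c \<Longrightarrow> ((snd c \<circ> \<gamma>) has_vector_derivative D t) (at t within {a..b})"
  using assms unfolding C1_curve_on_def by (force simp: split_beta)

lemma C1_curve_onI:
  assumes "\<And>c. c \<in> A \<Longrightarrow> \<exists>D. continuous_on {t \<in> {a..b}. \<gamma> t \<in> fst c} D \<and>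
    (\<forall>t\<in>{a..b}. \<gamma> t \<in> fst c \<longrightarrow> ((snd c \<circ> \<gamma>) has_vector_derivative D t) (at t within {a..b}))"
  shows "C1_curve_on A \<gamma> a b"
  using assms by (auto simp: C1_curve_on_def split_beta)

text \<open>Reparametrisation by an increasing affine map; \<open>\<eta>\<close> needs to agree with \<open>\<gamma>\<close> on the interval in
question only, so the lemma applies to the two halves of a concatenation.\<close>

lemma C1_curve_on_affine:
  assumes C: "C1_curve_on A \<gamma> a b" and m: "0 < m"
    and ab: "a = m * a' + k" "b = m * b' + k"
    and eq: "\<And>s. s \<in> {a'..b'} \<Longrightarrow> \<eta> s = \<gamma> (m * s + k)"
  shows "C1_curve_on A \<eta> a' b'"
proof (rule C1_curve_onI)
  fix c assume "c \<in> A"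
  then obtain D where D: "continuous_on {t \<in> {a..b}. \<gamma> t \<in> fst c} D"
    "\<And>t. t \<in> {a..b} \<Longrightarrow> \<gamma> t \<in> fst c \<Longrightarrow> ((snd c \<circ> \<gamma>) has_vector_derivative D t) (at t within {a..b})"
    using C1_curve_onD[OF C] by blast
  define f where "f s = m * s + k" for s
  have fin: "f s \<in> {a..b}" if "s \<in> {a'..b'}" for s
    using that m by (auto simp: f_def ab)
  have 1: "continuous_on {t \<in> {a'..b'}. \<eta> t \<in> fst c} (\<lambda>s. m *\<^sub>R D (f s))"
    using fin eq
    by (intro continuous_on_scaleR continuous_on_const continuous_on_compose2[OF D(1)])
      (auto simp: f_def[abs_def] intro!: continuous_intros)
  have 2: "((snd c \<circ> \<eta>) has_vector_derivative m *\<^sub>R D (f s)) (at s within {a'..b'})"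
    if s: "s \<in> {a'..b'}" "\<eta> s \<in> fst c" for s
  proof -
    have "((snd c \<circ> \<gamma>) has_vector_derivative D (f s)) (at (f s) within {a..b})"
      using D(2)[OF fin[OF s(1)]] s eq[OF s(1)] by (simp add: f_def)
    then have "((snd c \<circ> \<gamma>) has_vector_derivative D (f s)) (at (f s) within f ` {a'..b'})"
      using fin by (auto intro: has_vector_derivative_within_subset)
    moreover have "(f has_vector_derivative m) (at s within {a'..b'})"
      unfolding f_def by (auto intro!: derivative_eq_intros simp: has_real_derivative_iff_has_vector_derivative[symmetric])
    ultimately have "((snd c \<circ> \<gamma> \<circ> f) has_vector_derivative m *\<^sub>R D (f s)) (at s within {a'..b'})"
      by (rule vector_diff_chain_within[rotated])
    then show ?thesis
      by (rule has_vector_derivative_transform[rotated 2]) (use s eq in \<open>auto simp: f_def\<close>)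
  qed
  show "\<exists>D. continuous_on {t \<in> {a'..b'}. \<eta> t \<in> fst c} D \<and>
    (\<forall>t\<in>{a'..b'}. \<eta> t \<in> fst c \<longrightarrow> ((snd c \<circ> \<eta>) has_vector_derivative D t) (at t within {a'..b'}))"
    using 1 2 by blast
qed

definition smooth_parameter :: "('a::t2_space, 'n::finite) chart set \<Rightarrow> (real \<Rightarrow> 'a) \<Rightarrow> real \<Rightarrow> bool" where
  "smooth_parameter A \<gamma> t \<longleftrightarrow> (\<exists>a b. a < t \<and> t < b \<and> 0 \<le> a \<and> b \<le> 1 \<and> C1_curve_on A \<gamma> a b)"

text \<open>Every parameter that is not a break point lies strictly between two neighbouring break points.\<close>

lemma piecewise_C1_curve_pieces:
  assumes "piecewise_C1_curve M A \<gamma>"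
  obtains S where "finite S" "{0, 1} \<subseteq> S" "S \<subseteq> {0..1}"
    "\<And>a b. a \<in> S \<Longrightarrow> b \<in> S \<Longrightarrow> a < b \<Longrightarrow> {a<..<b} \<inter> S = {} \<Longrightarrow> C1_curve_on A \<gamma> a b"
    "\<And>t. t \<in> {0<..<1} - S \<Longrightarrow> smooth_parameter A \<gamma> t"
proof -
  obtain S where S: "finite S" "{0, 1} \<subseteq> S" "S \<subseteq> {0..1}"
    and C_all: "\<forall>a\<in>S. \<forall>b\<in>S. a < b \<and> {a<..<b} \<inter> S = {} \<longrightarrow> C1_curve_on A \<gamma> a b"
    using assms unfolding piecewise_C1_curve_def by (elim conjE exE) (rule that)
  have C: "C1_curve_on A \<gamma> a b" if "a \<in> S" "b \<in> S" "a < b" "{a<..<b} \<inter> S = {}" for a b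
    using C_all that by simp
  show ?thesis
  proof (rule that[OF S C])
    fix t assume t: "t \<in> {0<..<1} - S"
    define a where "a = Max {s \<in> S. s < t}"
    define b where "b = Min {s \<in> S. t < s}"
    have "a \<in> {s \<in> S. s < t}"
      unfolding a_def using S t by (intro Max_in) auto
    moreover have "b \<in> {s \<in> S. t < s}"
      unfolding b_def using S t by (intro Min_in) auto
    moreover have "{a<..<b} \<inter> S = {}"
    proof (rule ccontr)
      assume "{a<..<b} \<inter> S \<noteq> {}"
      then obtain s where s: "a < s" "s < b" "s \<in> S"
        by auto
      with t consider "s < t" | "t < s"
        by (metis DiffD2 linorder_neqE_linordered_idom)
      then show False
      proof cases
        case 1
        then have "s \<le> a"
          unfolding a_def using S(1) s(3) by (intro Max_ge) auto
        with s show False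
          by simp
      next
        case 2
        then have "b \<le> s"
          unfolding b_def using S(1) s(3) by (intro Min_le) auto
        with s show False
          by simp
      qed
    qed
    ultimately show "smooth_parameter A \<gamma> t"
      unfolding smooth_parameter_def using S(3)
      by (intro exI[of _ a] exI[of _ b]) (auto intro!: C)
  qed
qed

context riemannian_manifold
begin

definition metric_norm :: "('a, 'n) chart \<Rightarrow> 'a \<Rightarrow> real ^ 'n \<Rightarrow> real" where
  "metric_norm c p v = sqrt (v \<bullet> (g c p *v v))"

lemma open_curve_preimage:
  fixes \<gamma> :: "real \<Rightarrow> 'a"
  assumes "continuous_on {0..1} \<gamma>" "\<gamma> ` {0..1} \<subseteq> M" "openin (top_of_set M) U"
  shows "open {t \<in> {0<..<1}. \<gamma> t \<in> U}"
proof -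
  have "continuous_on {0<..<1} \<gamma>"
    by (rule continuous_on_subset[OF assms(1)]) auto
  moreover have "\<gamma> ` {0<..<1} \<subseteq> M"
    using assms(2) by (meson greaterThanLessThan_subseteq_atLeastAtMost_iff image_mono order_refl order_trans)
  ultimately have "openin (top_of_set {0<..<1}) ({0<..<1} \<inter> \<gamma> -` U)"
    using assms(3) by (intro continuous_openin_preimage[where T = M]) auto
  then have "open ({0<..<1} \<inter> \<gamma> -` U)"
    by (simp add: openin_open_eq)
  moreover have "{0<..<1} \<inter> \<gamma> -` U = {t \<in> {0<..<1}. \<gamma> t \<in> U}"
    by auto
  ultimately show ?thesis
    by simp
qed

text \<open>The chain rule transforms the velocity by the Jacobian of the transition map, and the tensor law
of the metric compensates for it.\<close>

lemma velocity_change_of_chart: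
  assumes \<gamma>: "continuous_on {0..1} \<gamma>" "\<gamma> ` {0..1} \<subseteq> M"
    and t: "t \<in> {0<..<1}" and c: "c \<in> A" "\<gamma> t \<in> fst c" and d: "d \<in> A" "\<gamma> t \<in> fst d"
    and v: "((snd c \<circ> \<gamma>) has_vector_derivative v) (at t)"
  obtains w where "((snd d \<circ> \<gamma>) has_vector_derivative w) (at t)"
    "metric_norm d (\<gamma> t) w = metric_norm c (\<gamma> t) v"
proof -
  define T where "T = snd d \<circ> chart_inv c"
  define F where "F = frechet_derivative T (at (snd c (\<gamma> t)))"
  have smooth: "smooth_on (snd c ` (fst c \<inter> fst d)) T"
    unfolding T_def by (rule transition_smooth_on[OF c(1) d(1)])
  have T: "(T has_derivative F) (at ((snd c \<circ> \<gamma>) t))"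
    using smooth_on_has_derivative[OF smooth, of "snd c (\<gamma> t)"] c d by (auto simp: F_def)
  then have lin: "linear F"
    by (rule has_derivative_linear)
  have "((T \<circ> (snd c \<circ> \<gamma>)) has_derivative F \<circ> (\<lambda>h. h *\<^sub>R v)) (at t)"
    using v T unfolding has_vector_derivative_def by (rule diff_chain_at)
  moreover have "F \<circ> (\<lambda>h. h *\<^sub>R v) = (\<lambda>h. h *\<^sub>R F v)"
    using lin by (auto simp: linear_cmul)
  ultimately have comp: "((T \<circ> (snd c \<circ> \<gamma>)) has_vector_derivative F v) (at t)"
    by (simp add: has_vector_derivative_def)
  have deriv: "((snd d \<circ> \<gamma>) has_vector_derivative F v) (at t)"
  proof (rule has_vector_derivative_transform_within_open[OF comp])
    show "open {t \<in> {0<..<1}. \<gamma> t \<in> fst c}"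
      by (rule open_curve_preimage[OF \<gamma> chart_openin[OF c(1)]])
    show "t \<in> {t \<in> {0<..<1}. \<gamma> t \<in> fst c}"
      using t c by simp
    show "(T \<circ> (snd c \<circ> \<gamma>)) s = (snd d \<circ> \<gamma>) s" if "s \<in> {t \<in> {0<..<1}. \<gamma> t \<in> fst c}" for s
      using that chart_inv_chart[OF c(1)] by (simp add: T_def)
  qed
  define J where "J = matrix F"
  have "g c (\<gamma> t) = transpose J ** g d (\<gamma> t) ** J"
    using c d by (intro metric_change_of_chart) (auto simp: J_def F_def T_def)
  moreover have "J *v v = F v"
    unfolding J_def using matrix_vector_mul(2)[OF lin] by (rule fun_cong)
  ultimately have "metric_norm d (\<gamma> t) (F v) = metric_norm c (\<gamma> t) v"
    by (simp add: metric_norm_def inner_congruence)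
  with deriv show ?thesis
    by (rule that)
qed

text \<open>The speed is defined by an arbitrarily chosen chart around \<open>\<gamma> t\<close>; by the previous lemma any chart
in which the curve is differentiable will do.\<close>

lemma curve_speed_eq:
  assumes \<gamma>: "continuous_on {0..1} \<gamma>" "\<gamma> ` {0..1} \<subseteq> M"
    and t: "t \<in> {0<..<1}" and c: "c \<in> A" "\<gamma> t \<in> fst c"
    and v: "((snd c \<circ> \<gamma>) has_vector_derivative v) (at t)"
  shows "curve_speed A g \<gamma> t = metric_norm c (\<gamma> t) v"
proof -
  define d where "d = (SOME c. c \<in> A \<and> \<gamma> t \<in> fst c)"
  have "d \<in> A \<and> \<gamma> t \<in> fst d"
    unfolding d_def by (rule someI[of _ c]) (use c in simp)
  then have d: "d \<in> A" "\<gamma> t \<in> fst d"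
    by auto
  obtain w where w: "((snd d \<circ> \<gamma>) has_vector_derivative w) (at t)"
    "metric_norm d (\<gamma> t) w = metric_norm c (\<gamma> t) v"
    by (rule velocity_change_of_chart[OF \<gamma> t c d v])
  have "vector_derivative (snd d \<circ> \<gamma>) (at t) = w"
    using w(1) by (rule vector_derivative_at)
  then show ?thesis
    using w(2) by (simp add: curve_speed_def d_def[symmetric] metric_norm_def Let_def)
qed

lemma curve_local_velocity:
  assumes \<gamma>: "continuous_on {0..1} \<gamma>" "\<gamma> ` {0..1} \<subseteq> M"
    and C: "C1_curve_on A \<gamma> a b" and ab: "0 \<le> a" "b \<le> 1"
    and c: "c \<in> A"
  defines "W \<equiv> {t \<in> {a<..<b}. \<gamma> t \<in> fst c}"
  shows "open W" "continuous_on W (\<lambda>t. vector_derivative (snd c \<circ> \<gamma>) (at t))"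
    "\<And>t. t \<in> W \<Longrightarrow> ((snd c \<circ> \<gamma>) has_vector_derivative vector_derivative (snd c \<circ> \<gamma>) (at t)) (at t)"
    "continuous_on W (curve_speed A g \<gamma>)"
proof -
  have "W = {a<..<b} \<inter> {t \<in> {0<..<1}. \<gamma> t \<in> fst c}"
    using ab by (auto simp: W_def)
  then show W: "open W"
    using open_curve_preimage[OF \<gamma> chart_openin[OF c]] by auto
  obtain D where D: "continuous_on {t \<in> {a..b}. \<gamma> t \<in> fst c} D"
    "\<And>t. t \<in> {a..b} \<Longrightarrow> \<gamma> t \<in> fst c \<Longrightarrow> ((snd c \<circ> \<gamma>) has_vector_derivative D t) (at t within {a..b})"
    using C1_curve_onD[OF C c] by blast
  have at: "((snd c \<circ> \<gamma>) has_vector_derivative D t) (at t)" if "t \<in> W" for t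
  proof -
    have "((snd c \<circ> \<gamma>) has_vector_derivative D t) (at t within {a..b})"
      using that by (intro D(2)) (auto simp: W_def)
    moreover have "at t within {a..b} = at t"
      using that by (intro at_within_interior) (auto simp: W_def)
    ultimately show ?thesis
      by simp
  qed
  then have eq: "vector_derivative (snd c \<circ> \<gamma>) (at t) = D t" if "t \<in> W" for t
    using that by (simp add: vector_derivative_at)
  have D_cont: "continuous_on W D"
    by (rule continuous_on_subset[OF D(1)]) (auto simp: W_def)
  then show "continuous_on W (\<lambda>t. vector_derivative (snd c \<circ> \<gamma>) (at t))"
    by (subst continuous_on_cong[OF refl eq]) auto
  show "((snd c \<circ> \<gamma>) has_vector_derivative vector_derivative (snd c \<circ> \<gamma>) (at t)) (at t)" if "t \<in> W" for t
    using at eq that by simp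
  have speed: "curve_speed A g \<gamma> t = sqrt (D t \<bullet> (chart_metric c (snd c (\<gamma> t)) *v D t))" if t: "t \<in> W" for t
  proof -
    have "curve_speed A g \<gamma> t = metric_norm c (\<gamma> t) (D t)"
      using t ab by (intro curve_speed_eq \<gamma> c at) (auto simp: W_def)
    moreover have "chart_metric c (snd c (\<gamma> t)) = g c (\<gamma> t)"
      using t chart_inv_chart[OF c] by (simp add: chart_metric_def W_def)
    ultimately show ?thesis
      by (simp add: metric_norm_def)
  qed
  have "continuous_on W (snd c \<circ> \<gamma>)"
    using at by (meson has_vector_derivative_continuous continuous_at_imp_continuous_on)
  then have "continuous_on W (\<lambda>t. chart_metric c (snd c (\<gamma> t)))"
    using chart_in_range[OF c]
    by (intro continuous_on_compose2[OF chart_metric_continuous[OF c]]) (auto simp: o_def W_def)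
  then have "continuous_on W (\<lambda>t. sqrt (D t \<bullet> (chart_metric c (snd c (\<gamma> t)) *v D t)))"
    using D_cont by (intro continuous_intros)
      (auto simp: matrix_vector_mult_def intro!: continuous_intros)
  then show "continuous_on W (curve_speed A g \<gamma>)"
    by (subst continuous_on_cong[OF refl speed]) auto
qed

lemma piecewise_C1_curveD:
  assumes "piecewise_C1_curve M A \<gamma>"
  shows "continuous_on {0..1} \<gamma>" "\<gamma> ` {0..1} \<subseteq> M"
  using assms by (simp_all add: piecewise_C1_curve_def)

lemma point_in_chart: "p \<in> M \<Longrightarrow> \<exists>c\<in>A. p \<in> fst c"
  using atlas_cover by blast

text \<open>Away from the break points the speed is continuous, because near each parameter one chart serves
for all nearby parameters. Measurability is needed for the substitutions in the length integral.\<close>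

lemma curve_speed_measurable:
  assumes \<gamma>: "piecewise_C1_curve M A \<gamma>" and S: "finite S"
    and pieces: "\<And>t. t \<in> {0<..<1} - S \<Longrightarrow> smooth_parameter A \<gamma> t"
  shows "(\<lambda>t. indicator ({0<..<1} - S) t * curve_speed A g \<gamma> t) \<in> borel_measurable borel"
proof -
  note \<gamma>' = piecewise_C1_curveD[OF \<gamma>]
  have "isCont (curve_speed A g \<gamma>) t" if t: "t \<in> {0<..<1} - S" for t
  proof -
    obtain a b where ab: "a < t" "t < b" "0 \<le> a" "b \<le> 1" "C1_curve_on A \<gamma> a b"
      using pieces[OF t] unfolding smooth_parameter_def by blast
    obtain c where c: "c \<in> A" "\<gamma> t \<in> fst c"
    proof -
      have "\<gamma> t \<in> M"
        using \<gamma>'(2) t by (auto simp: image_subset_iff)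
      then show ?thesis
        using point_in_chart that by blast
    qed
    note loc = curve_local_velocity[OF \<gamma>' ab(5,3,4) c(1)]
    show ?thesis
      using loc(4) c ab by (subst (asm) continuous_on_eq_continuous_at[OF loc(1)]) auto
  qed
  then have "continuous_on ({0<..<1} - S) (curve_speed A g \<gamma>)"
    by (intro continuous_at_imp_continuous_on) auto
  moreover have "{0<..<1} - S \<in> sets borel"
    using finite_imp_closed[OF S] by auto
  ultimately show ?thesis
    using borel_measurable_continuous_on_indicator by fastforce
qed

lemma curve_length_eq:
  assumes "finite S"
  shows "curve_length A g \<gamma> = (\<integral>\<^sup>+t. ennreal (indicator ({0<..<1} - S) t * curve_speed A g \<gamma> t) \<partial>lborel)"
  unfolding curve_length_def
proof (rule nn_integral_cong_AE)
  have "finite (insert 0 (insert 1 S))"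
    using assms by simp
  then have "AE t in lborel. t \<notin> insert 0 (insert 1 S)"
    by (intro AE_not_in finite_imp_null_set_lborel)
  then show "AE t in lborel. ennreal (curve_speed A g \<gamma> t) * indicator {0..1} t
      = ennreal (indicator ({0<..<1} - S) t * curve_speed A g \<gamma> t)"
    by eventually_elim (auto simp: indicator_def)
qed

end

section \<open>Distance estimates in a chart\<close>

context riemannian_manifold
begin

lemma metric_norm_scaleR: "metric_norm c p (r *\<^sub>R v) = \<bar>r\<bar> * metric_norm c p v"
proof -
  have "(r *\<^sub>R v) \<bullet> (g c p *v (r *\<^sub>R v)) = r\<^sup>2 * (v \<bullet> (g c p *v v))"
    by (simp add: matrix_vector_mult_scaleR power2_eq_square)
  then show ?thesis
    by (simp add: metric_norm_def real_sqrt_mult)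
qed

lemma curve_speed_affine:
  assumes \<gamma>: "continuous_on {0..1} \<gamma>" "\<gamma> ` {0..1} \<subseteq> M" and \<eta>: "continuous_on {0..1} \<eta>" "\<eta> ` {0..1} \<subseteq> M"
    and ab: "a < m * t + k" "m * t + k < b" "0 \<le> a" "b \<le> 1" "C1_curve_on A \<gamma> a b"
    and V: "open V" "t \<in> V" "\<And>s. s \<in> V \<Longrightarrow> \<eta> s = \<gamma> (m * s + k)" and t: "t \<in> {0<..<1}" and m: "0 < m"
  shows "curve_speed A g \<eta> t = m * curve_speed A g \<gamma> (m * t + k)"
proof -
  have "\<gamma> (m * t + k) \<in> M"
    using \<gamma>(2) ab by (auto simp: image_subset_iff)
  then obtain c where c: "c \<in> A" "\<gamma> (m * t + k) \<in> fst c"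
    using point_in_chart by blast
  obtain v where v: "((snd c \<circ> \<gamma>) has_vector_derivative v) (at (m * t + k))"
    using curve_local_velocity(3)[OF \<gamma> ab(5,3,4) c(1), of "m * t + k"] ab c by auto
  have "((\<lambda>s. m * s + k) has_vector_derivative m) (at t)"
    by (auto intro!: derivative_eq_intros simp: has_real_derivative_iff_has_vector_derivative[symmetric])
  from vector_diff_chain_at[OF this v]
  have comp: "((snd c \<circ> \<gamma> \<circ> (\<lambda>s. m * s + k)) has_vector_derivative m *\<^sub>R v) (at t)" .
  have v': "((snd c \<circ> \<eta>) has_vector_derivative m *\<^sub>R v) (at t)"
    by (rule has_vector_derivative_transform_within_open[OF comp V(1,2)]) (simp add: V(3))
  have "curve_speed A g \<eta> t = metric_norm c (\<eta> t) (m *\<^sub>R v)"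
    by (rule curve_speed_eq[OF \<eta> t c(1) _ v']) (simp add: V(2,3) c)
  moreover have "curve_speed A g \<gamma> (m * t + k) = metric_norm c (\<gamma> (m * t + k)) v"
    by (rule curve_speed_eq[OF \<gamma> _ c v]) (use ab in auto)
  ultimately show ?thesis
    using m V(2,3) by (simp add: metric_norm_scaleR)
qed

text \<open>\<open>\<gamma>1\<close> and \<open>\<gamma>2\<close> are run through at double speed on half of the unit interval each. The break points
of the concatenation are those of the two curves, rescaled; as \<open>0\<close> and \<open>1\<close> count as break points,
so does the junction \<open>1 / 2\<close>.\<close>

lemma curve_length_join:
  assumes \<gamma>1: "piecewise_C1_curve M A \<gamma>1" and \<gamma>2: "piecewise_C1_curve M A \<gamma>2" and eq: "\<gamma>1 1 = \<gamma>2 0"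
  shows "piecewise_C1_curve M A (\<gamma>1 +++ \<gamma>2)"
    and "curve_length A g (\<gamma>1 +++ \<gamma>2) = curve_length A g \<gamma>1 + curve_length A g \<gamma>2"
proof -
  let ?\<eta> = "\<gamma>1 +++ \<gamma>2"
  obtain S1 where S1: "finite S1" "{0, 1} \<subseteq> S1" "S1 \<subseteq> {0..1}"
    and C1: "\<And>a b. a \<in> S1 \<Longrightarrow> b \<in> S1 \<Longrightarrow> a < b \<Longrightarrow> {a<..<b} \<inter> S1 = {} \<Longrightarrow> C1_curve_on A \<gamma>1 a b"
    and pieces1: "\<And>t. t \<in> {0<..<1} - S1 \<Longrightarrow> smooth_parameter A \<gamma>1 t"
    by (rule piecewise_C1_curve_pieces[OF \<gamma>1]) blast
  obtain S2 where S2: "finite S2" "{0, 1} \<subseteq> S2" "S2 \<subseteq> {0..1}"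
    and C2: "\<And>a b. a \<in> S2 \<Longrightarrow> b \<in> S2 \<Longrightarrow> a < b \<Longrightarrow> {a<..<b} \<inter> S2 = {} \<Longrightarrow> C1_curve_on A \<gamma>2 a b"
    and pieces2: "\<And>t. t \<in> {0<..<1} - S2 \<Longrightarrow> smooth_parameter A \<gamma>2 t"
    by (rule piecewise_C1_curve_pieces[OF \<gamma>2]) blast
  note \<gamma>1' = piecewise_C1_curveD[OF \<gamma>1] and \<gamma>2' = piecewise_C1_curveD[OF \<gamma>2]
  define S where "S = (\<lambda>s. s / 2) ` S1 \<union> (\<lambda>s. (s + 1) / 2) ` S2"
  have left: "s / 2 \<in> S" if "s \<in> S1" for s
    using that by (simp add: S_def)
  have right: "(s + 1) / 2 \<in> S" if "s \<in> S2" for s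
    using that by (simp add: S_def)
  have leftD: "2 * s \<in> S1" if "s \<in> S" "s \<le> 1 / 2" for s
    using that S1(2) S2(3) by (auto simp: S_def)
  have rightD: "2 * s - 1 \<in> S2" if "s \<in> S" "1 / 2 \<le> s" for s
  proof -
    from \<open>s \<in> S\<close> consider r where "r \<in> S1" "s = r / 2" | r where "r \<in> S2" "s = (r + 1) / 2"
      by (auto simp: S_def)
    then show ?thesis
    proof cases
      case 1
      then have "2 * s - 1 = 0"
        using S1(3) \<open>1 / 2 \<le> s\<close> by fastforce
      then show ?thesis
        using S2(2) by simp
    next
      case 2
      then have "2 * s - 1 = r"
        by simp
      with 2 show ?thesis
        by simp
    qed
  qed
  have half: "1 / 2 \<in> S"
    using left[of 1] S1(2) by simp
  have join1: "?\<eta> s = \<gamma>1 (2 * s + 0)" if "s \<le> 1 / 2" for s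
    using that by (simp add: joinpaths_def)
  have join2: "?\<eta> s = \<gamma>2 (2 * s + (- 1))" if "1 / 2 \<le> s" for s
  proof (cases "s = 1 / 2")
    case True
    show ?thesis
      unfolding True using eq by (simp add: joinpaths_def)
  next
    case False
    with that show ?thesis
      by (simp add: joinpaths_def)
  qed
  have cont: "continuous_on {0..1} ?\<eta>"
    using path_join_imp[of \<gamma>1 \<gamma>2] \<gamma>1'(1) \<gamma>2'(1) eq
    by (simp add: path_def pathfinish_def pathstart_def)
  have img: "?\<eta> ` {0..1} \<subseteq> M"
    using path_image_join_subset[of \<gamma>1 \<gamma>2] \<gamma>1'(2) \<gamma>2'(2) by (auto simp: path_image_def)
  have pieces: "C1_curve_on A ?\<eta> a b" if ab: "a \<in> S" "b \<in> S" "a < b" "{a<..<b} \<inter> S = {}" for a b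
  proof (cases "b \<le> 1 / 2")
    case True
    have "C1_curve_on A \<gamma>1 (2 * a) (2 * b)"
    proof (rule C1)
      show "{2 * a<..<2 * b} \<inter> S1 = {}"
        using left ab(4) by (fastforce simp: disjoint_iff)
    qed (use ab True leftD in auto)
    then show ?thesis
      by (rule C1_curve_on_affine[where m = 2 and k = 0]) (use True join1 in auto)
  next
    case False
    have a: "1 / 2 \<le> a"
    proof (rule ccontr)
      assume "\<not> 1 / 2 \<le> a"
      with False half have "1 / 2 \<in> {a<..<b} \<inter> S"
        by auto
      with ab(4) show False
        by blast
    qed
    have "C1_curve_on A \<gamma>2 (2 * a - 1) (2 * b - 1)"
    proof (rule C2)
      show "{2 * a - 1<..<2 * b - 1} \<inter> S2 = {}"
      proof (rule ccontr)
        assume "{2 * a - 1<..<2 * b - 1} \<inter> S2 \<noteq> {}"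
        then obtain s where s: "2 * a - 1 < s" "s < 2 * b - 1" "s \<in> S2"
          by auto
        then have "(s + 1) / 2 \<in> {a<..<b} \<inter> S"
          using right by auto
        with ab(4) show False
          by blast
      qed
    qed (use ab False a rightD in auto)
    then show ?thesis
      by (rule C1_curve_on_affine[where m = 2 and k = "- 1"]) (use a join2 in auto)
  qed
  have S: "finite S" "{0, 1} \<subseteq> S" "S \<subseteq> {0..1}"
    using S1 S2 left[of 0] right[of 1] by (auto simp: S_def)
  show \<eta>: "piecewise_C1_curve M A ?\<eta>"
    unfolding piecewise_C1_curve_def
  proof (intro conjI cont img exI[of _ S] S ballI impI)
    fix a b assume "a \<in> S" "b \<in> S" "a < b \<and> {a<..<b} \<inter> S = {}"
    then show "C1_curve_on A ?\<eta> a b"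
      by (intro pieces) simp_all
  qed
  have speed1: "curve_speed A g ?\<eta> t = 2 * curve_speed A g \<gamma>1 (2 * t)"
    if t: "2 * t \<in> {0<..<1} - S1" for t
  proof -
    have "2 * t + 0 \<in> {0<..<1} - S1"
      using t by simp
    from pieces1[OF this, unfolded smooth_parameter_def] obtain a b
      where ab: "a < 2 * t + 0" "2 * t + 0 < b" "0 \<le> a" "b \<le> 1" "C1_curve_on A \<gamma>1 a b"
      by blast
    have "curve_speed A g ?\<eta> t = 2 * curve_speed A g \<gamma>1 (2 * t + 0)"
      by (rule curve_speed_affine[OF \<gamma>1' cont img ab, of "{..<1 / 2}"]) (use t join1 in auto)
    then show ?thesis
      by simp
  qed
  have speed2: "curve_speed A g ?\<eta> t = 2 * curve_speed A g \<gamma>2 (2 * t - 1)"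
    if t: "2 * t - 1 \<in> {0<..<1} - S2" for t
  proof -
    have "2 * t + (- 1) \<in> {0<..<1} - S2"
      using t by simp
    from pieces2[OF this, unfolded smooth_parameter_def] obtain a b
      where ab: "a < 2 * t + (- 1)" "2 * t + (- 1) < b" "0 \<le> a" "b \<le> 1" "C1_curve_on A \<gamma>2 a b"
      by blast
    have "curve_speed A g ?\<eta> t = 2 * curve_speed A g \<gamma>2 (2 * t + (- 1))"
      by (rule curve_speed_affine[OF \<gamma>2' cont img ab, of "{1 / 2<..}"]) (use t join2 in auto)
    then show ?thesis
      by simp
  qed
  define f1 where "f1 t = ennreal (indicator ({0<..<1} - S1) t * curve_speed A g \<gamma>1 t)" for t
  define f2 where "f2 t = ennreal (indicator ({0<..<1} - S2) t * curve_speed A g \<gamma>2 t)" for t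
  have [measurable]: "f1 \<in> borel_measurable borel" "f2 \<in> borel_measurable borel"
    unfolding f1_def[abs_def] f2_def[abs_def]
    using curve_speed_measurable[OF \<gamma>1 S1(1) pieces1] curve_speed_measurable[OF \<gamma>2 S2(1) pieces2]
    by measurable
  have pw: "ennreal (indicator ({0<..<1} - S) t * curve_speed A g ?\<eta> t) = 2 * f1 (0 + 2 * t) + 2 * f2 (- 1 + 2 * t)"
    if t: "t \<notin> S" for t
  proof -
    have t2: "t \<noteq> 1 / 2"
      using t half by blast
    consider "t \<in> {0<..<1 / 2}" | "t \<in> {1 / 2<..<1}" | "t \<notin> {0<..<1}"
      using t2 by fastforce
    then show ?thesis
    proof cases
      case 1
      then have "2 * t \<in> {0<..<1} - S1"
        using t left[of "2 * t"] by auto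
      then show ?thesis
        using 1 t speed1[of t] by (simp add: f1_def f2_def ennreal_mult')
    next
      case 2
      then have "2 * t - 1 \<in> {0<..<1} - S2"
        using t right[of "2 * t - 1"] by auto
      then show ?thesis
        using 2 t speed2[of t] by (simp add: f1_def f2_def ennreal_mult' add.commute[of "- 1"])
    next
      case 3
      then show ?thesis
        by (auto simp: f1_def f2_def indicator_def)
    qed
  qed
  have "curve_length A g ?\<eta> = (\<integral>\<^sup>+t. 2 * f1 (0 + 2 * t) + 2 * f2 (- 1 + 2 * t) \<partial>lborel)"
    unfolding curve_length_eq[OF S(1)]
  proof (rule nn_integral_cong_AE)
    have "AE t in lborel. t \<notin> S"
      by (intro AE_not_in finite_imp_null_set_lborel S)
    then show "AE t in lborel. ennreal (indicator ({0<..<1} - S) t * curve_speed A g ?\<eta> t)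
        = 2 * f1 (0 + 2 * t) + 2 * f2 (- 1 + 2 * t)"
      by eventually_elim (rule pw)
  qed
  also have "\<dots> = 2 * (\<integral>\<^sup>+t. f1 (0 + 2 * t) \<partial>lborel) + 2 * (\<integral>\<^sup>+t. f2 (- 1 + 2 * t) \<partial>lborel)"
    by (subst nn_integral_add) (auto simp: nn_integral_cmult)
  also have "2 * (\<integral>\<^sup>+t. f1 (0 + 2 * t) \<partial>lborel) = (\<integral>\<^sup>+t. f1 t \<partial>lborel)"
    using nn_integral_real_affine[of f1 2 0] by simp
  also have "2 * (\<integral>\<^sup>+t. f2 (- 1 + 2 * t) \<partial>lborel) = (\<integral>\<^sup>+t. f2 t \<partial>lborel)"
    using nn_integral_real_affine[of f2 2 "- 1"] by simp
  finally show "curve_length A g ?\<eta> = curve_length A g \<gamma>1 + curve_length A g \<gamma>2"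
    by (simp add: curve_length_eq[OF S1(1), of \<gamma>1] curve_length_eq[OF S2(1), of \<gamma>2] f1_def f2_def)
qed

lemma riemannian_dist_triangle:
  "riemannian_dist M A g x z \<le> riemannian_dist M A g x y + riemannian_dist M A g y z"
proof (rule ennreal_le_epsilon)
  fix e :: real
  assume fin: "riemannian_dist M A g x y + riemannian_dist M A g y z < top" and e: "0 < e"
  let ?G = "\<lambda>x y. {\<gamma>. piecewise_C1_curve M A \<gamma> \<and> \<gamma> 0 = x \<and> \<gamma> 1 = y}"
  have near: "\<exists>\<gamma>\<in>?G x y. curve_length A g \<gamma> < riemannian_dist M A g x y + ennreal (e / 2)"
    if "riemannian_dist M A g x y < top" for x y
  proof -
    have "riemannian_dist M A g x y < riemannian_dist M A g x y + ennreal (e / 2)"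
      using that e by (cases "riemannian_dist M A g x y") (auto simp: ennreal_plus[symmetric] ennreal_less_iff simp del: ennreal_plus)
    then show ?thesis
      unfolding riemannian_dist_def by (simp add: INF_less_iff)
  qed
  obtain \<gamma>1 where \<gamma>1: "piecewise_C1_curve M A \<gamma>1" "\<gamma>1 0 = x" "\<gamma>1 1 = y"
    "curve_length A g \<gamma>1 < riemannian_dist M A g x y + ennreal (e / 2)"
    using near[of x y] fin by auto
  obtain \<gamma>2 where \<gamma>2: "piecewise_C1_curve M A \<gamma>2" "\<gamma>2 0 = y" "\<gamma>2 1 = z"
    "curve_length A g \<gamma>2 < riemannian_dist M A g y z + ennreal (e / 2)"
    using near[of y z] fin by auto
  have eq: "\<gamma>1 1 = \<gamma>2 0"
    using \<gamma>1 \<gamma>2 by simp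
  have "riemannian_dist M A g x z \<le> curve_length A g (\<gamma>1 +++ \<gamma>2)"
    unfolding riemannian_dist_def
    using curve_length_join(1)[OF \<gamma>1(1) \<gamma>2(1) eq] \<gamma>1 \<gamma>2 by (intro INF_lower) (auto simp: joinpaths_def)
  also have "\<dots> = curve_length A g \<gamma>1 + curve_length A g \<gamma>2"
    by (rule curve_length_join(2)[OF \<gamma>1(1) \<gamma>2(1) eq])
  also have "\<dots> \<le> (riemannian_dist M A g x y + ennreal (e / 2)) + (riemannian_dist M A g y z + ennreal (e / 2))"
    using \<gamma>1(4) \<gamma>2(4) by (intro add_mono) auto
  also have "\<dots> = riemannian_dist M A g x y + riemannian_dist M A g y z + (ennreal (e / 2) + ennreal (e / 2))"
    by (simp add: ac_simps)
  also have "ennreal (e / 2) + ennreal (e / 2) = ennreal e"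
    using e by (simp add: ennreal_plus[symmetric] del: ennreal_plus)
  finally show "riemannian_dist M A g x z \<le> riemannian_dist M A g x y + riemannian_dist M A g y z + ennreal e" .
qed


text \<open>The segment between the coordinates is an admissible curve with constant velocity \<open>y - x\<close>.\<close>

lemma riemannian_dist_segment_le:
  assumes c: "c \<in> A" and seg: "closed_segment x y \<subseteq> chart_range c"
    and L: "\<And>z. z \<in> closed_segment x y \<Longrightarrow> sqrt ((y - x) \<bullet> (chart_metric c z *v (y - x))) \<le> L"
  shows "riemannian_dist M A g (chart_inv c x) (chart_inv c y) \<le> ennreal L"
proof -
  define l where "l t = x + t *\<^sub>R (y - x)" for t :: real
  define \<gamma> where "\<gamma> = chart_inv c \<circ> l"
  have l_seg: "l t \<in> closed_segment x y" if "t \<in> {0..1}" for t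
    using that by (auto simp: l_def closed_segment_def algebra_simps intro!: exI[of _ t])
  then have l_range: "l t \<in> chart_range c" if "t \<in> {0..1}" for t
    using that seg by blast
  have l_deriv: "(l has_vector_derivative (y - x)) (at t within X)" for t X
    unfolding l_def by (auto intro!: derivative_eq_intros)
  have l_cont: "continuous_on X l" for X
    unfolding l_def by (intro continuous_intros)
  have \<gamma>_in: "\<gamma> t \<in> fst c" and \<gamma>_coord: "snd c (\<gamma> t) = l t" if "t \<in> {0..1}" for t
    using l_range[OF that] chart_inv_in[OF c] chart_chart_inv[OF c] by (auto simp: \<gamma>_def)
  have cont: "continuous_on {0..1} \<gamma>"
    unfolding \<gamma>_def using l_range
    by (intro continuous_on_compose l_cont continuous_on_subset[OF chart_inv_continuous[OF c]]) auto
  have img: "\<gamma> ` {0..1} \<subseteq> M"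
    using \<gamma>_in chart_subset[OF c] by blast
  have "C1_curve_on A \<gamma> 0 1"
  proof (rule C1_curve_onI)
    fix d assume d: "d \<in> A"
    define T where "T = snd d \<circ> chart_inv c"
    define V where "V = snd c ` (fst c \<inter> fst d)"
    have smooth: "smooth_on V T"
      unfolding T_def V_def by (rule transition_smooth_on[OF c d])
    have lV: "l t \<in> V" if "t \<in> {0..1}" "\<gamma> t \<in> fst d" for t
      using \<gamma>_in[OF that(1)] \<gamma>_coord[OF that(1)] that(2) unfolding V_def by (metis IntI image_eqI)
    have 1: "continuous_on {t \<in> {0..1}. \<gamma> t \<in> fst d} (\<lambda>t. frechet_derivative T (at (l t)) (y - x))"
      by (rule continuous_on_compose2[OF smooth_on_continuous_derivative[OF smooth] l_cont]) (auto intro: lV)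
    have 2: "((snd d \<circ> \<gamma>) has_vector_derivative frechet_derivative T (at (l t)) (y - x)) (at t within {0..1})"
      if t: "t \<in> {0..1}" "\<gamma> t \<in> fst d" for t
    proof -
      have "(T has_derivative frechet_derivative T (at (l t))) (at (l t) within l ` {0..1})"
        using smooth_on_has_derivative[OF smooth lV[OF t]] by (rule has_derivative_at_withinI)
      from vector_derivative_diff_chain_within[OF l_deriv this]
      have "((T \<circ> l) has_vector_derivative frechet_derivative T (at (l t)) (y - x)) (at t within {0..1})" .
      moreover have "T \<circ> l = snd d \<circ> \<gamma>"
        by (auto simp: T_def \<gamma>_def)
      ultimately show ?thesis
        by (simp only:)
    qed
    show "\<exists>D. continuous_on {t \<in> {0..1}. \<gamma> t \<in> fst d} D \<and>
      (\<forall>t\<in>{0..1}. \<gamma> t \<in> fst d \<longrightarrow> ((snd d \<circ> \<gamma>) has_vector_derivative D t) (at t within {0..1}))"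
      using 1 2 by blast
  qed
  then have \<gamma>: "piecewise_C1_curve M A \<gamma>"
    unfolding piecewise_C1_curve_def using cont img
    by (intro conjI exI[of _ "{0, 1}"]) auto
  have speed: "curve_speed A g \<gamma> t \<le> L" if t: "t \<in> {0<..<1}" for t
  proof -
    have t': "t \<in> {0..1}"
      using t by simp
    have v: "((snd c \<circ> \<gamma>) has_vector_derivative (y - x)) (at t)"
      by (rule has_vector_derivative_transform_within_open[OF l_deriv, of "{0<..<1}"])
        (use t \<gamma>_coord in auto)
    have "curve_speed A g \<gamma> t = metric_norm c (\<gamma> t) (y - x)"
      by (rule curve_speed_eq[OF cont img t c \<gamma>_in[OF t'] v])
    also have "\<dots> \<le> L"
      using L[OF l_seg[OF t']] by (simp add: metric_norm_def chart_metric_def \<gamma>_def)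
    finally show ?thesis .
  qed
  have "riemannian_dist M A g (chart_inv c x) (chart_inv c y) \<le> curve_length A g \<gamma>"
    unfolding riemannian_dist_def using \<gamma> by (intro INF_lower) (simp add: \<gamma>_def l_def)
  also have "\<dots> \<le> (\<integral>\<^sup>+t. ennreal L * indicator {0<..<1::real} t \<partial>lborel)"
    unfolding curve_length_eq[OF finite.emptyI]
    using speed by (intro nn_integral_mono) (auto simp: indicator_def intro!: ennreal_leI)
  also have "\<dots> = ennreal L"
    by (simp add: nn_integral_cmult_indicator)
  finally show ?thesis .
qed

text \<open>In coordinates, the increment of a curve is the integral of its velocity, and the velocity is
controlled by the speed.\<close>

lemma curve_length_ge:
  assumes \<gamma>: "piecewise_C1_curve M A \<gamma>" and c: "c \<in> A" and T: "0 \<le> T" "T \<le> 1"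
    and in_c: "\<And>t. t \<in> {0..T} \<Longrightarrow> \<gamma> t \<in> fst c"
    and m: "0 < m" "\<And>t v. t \<in> {0..T} \<Longrightarrow> m * norm v \<le> metric_norm c (\<gamma> t) v"
  shows "ennreal (m * norm (snd c (\<gamma> T) - snd c (\<gamma> 0))) \<le> curve_length A g \<gamma>"
proof (cases "curve_length A g \<gamma> = \<infinity>")
  case True
  then show ?thesis
    by simp
next
  case False
  note \<gamma>' = piecewise_C1_curveD[OF \<gamma>]
  obtain S where S: "finite S"
    and pieces: "\<And>t. t \<in> {0<..<1} - S \<Longrightarrow> smooth_parameter A \<gamma> t"
    by (rule piecewise_C1_curve_pieces[OF \<gamma>]) blast
  define f where "f = snd c \<circ> \<gamma>"
  define V where "V t = vector_derivative f (at t)" for t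
  have loc: "(f has_vector_derivative V t) (at t)" "isCont V t" "curve_speed A g \<gamma> t = metric_norm c (\<gamma> t) (V t)"
    if t: "t \<in> {0<..<T} - S" for t
  proof -
    have t': "t \<in> {0<..<1} - S" "\<gamma> t \<in> fst c"
      using t T in_c by auto
    obtain a b where ab: "a < t" "t < b" "0 \<le> a" "b \<le> 1" "C1_curve_on A \<gamma> a b"
      using pieces[OF t'(1)] unfolding smooth_parameter_def by blast
    note l = curve_local_velocity[OF \<gamma>' ab(5,3,4) c]
    show v: "(f has_vector_derivative V t) (at t)"
      using l(3)[of t] ab t' by (simp add: f_def V_def)
    show "isCont V t"
      using l(2) t' ab unfolding V_def[abs_def] f_def
      by (subst (asm) continuous_on_eq_continuous_at[OF l(1)]) auto
    show "curve_speed A g \<gamma> t = metric_norm c (\<gamma> t) (V t)"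
      by (rule curve_speed_eq[OF \<gamma>' _ c t'(2) v[unfolded f_def]]) (use t' in auto)
  qed
  have f_cont: "continuous_on {0..T} f"
    unfolding f_def
  proof (rule continuous_on_compose)
    show "continuous_on {0..T} \<gamma>"
      by (rule continuous_on_subset[OF \<gamma>'(1)]) (use T in auto)
    show "continuous_on (\<gamma> ` {0..T}) (snd c)"
      by (rule continuous_on_subset[OF chart_continuous[OF c]]) (use in_c in auto)
  qed
  have V_int: "(V has_integral (f T - f 0)) {0..T}"
    by (rule fundamental_theorem_of_calculus_interior_strong[OF S T(1)]) (use loc f_cont in auto)
  \<comment> \<open>the velocity as a Borel function, which makes its Henstock--Kurzweil integral a Bochner integral\<close>
  define W where "W t = indicator ({0<..<T} - S) t *\<^sub>R V t" for t
  have "continuous_on ({0<..<T} - S) V"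
    using loc(2) by (intro continuous_at_imp_continuous_on) auto
  then have Wm [measurable]: "W \<in> borel_measurable borel"
    unfolding W_def[abs_def] using finite_imp_closed[OF S]
    by (intro borel_measurable_continuous_on_indicator) auto
  have W_le: "ennreal m * (\<integral>\<^sup>+t. ennreal (norm (W t)) \<partial>lborel) \<le> curve_length A g \<gamma>"
  proof -
    have "ennreal m * (\<integral>\<^sup>+t. ennreal (norm (W t)) \<partial>lborel) = (\<integral>\<^sup>+t. ennreal m * ennreal (norm (W t)) \<partial>lborel)"
      by (rule nn_integral_cmult[symmetric]) measurable
    also have "\<dots> \<le> curve_length A g \<gamma>"
      unfolding curve_length_eq[OF S]
    proof (rule nn_integral_mono)
      fix t
      show "ennreal m * ennreal (norm (W t)) \<le> ennreal (indicator ({0<..<1} - S) t * curve_speed A g \<gamma> t)"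
      proof (cases "t \<in> {0<..<T} - S")
        case True
        then have "m * norm (V t) \<le> curve_speed A g \<gamma> t"
          using loc(3) m(2)[of t "V t"] by auto
        then show ?thesis
          using True T m(1) by (auto simp: W_def ennreal_mult'[symmetric] intro!: ennreal_leI)
      qed (simp add: W_def)
    qed
    finally show ?thesis .
  qed
  have "(\<integral>\<^sup>+t. ennreal (norm (W t)) \<partial>lborel) < \<infinity>"
  proof (rule ccontr)
    assume "\<not> ?thesis"
    then have "ennreal m * (\<integral>\<^sup>+t. ennreal (norm (W t)) \<partial>lborel) = \<infinity>"
      using m(1) by (auto simp: ennreal_mult_top top.not_eq_extremum[symmetric])
    with W_le False show False
      by (simp add: top_unique)
  qed
  then have W_int: "integrable lborel W"
    by (intro integrableI_bounded) auto
  have "((\<lambda>t. if t \<in> {0..T} then V t else 0) has_integral (f T - f 0)) UNIV"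
    using V_int by (subst has_integral_restrict_UNIV)
  then have "(W has_integral (f T - f 0)) UNIV"
  proof (rule has_integral_spike_finite[of "insert 0 (insert T S)", rotated 2])
    show "finite (insert 0 (insert T S))"
      using S by simp
    show "W t = (if t \<in> {0..T} then V t else 0)" if "t \<in> UNIV - insert 0 (insert T S)" for t
      using that by (auto simp: W_def indicator_def)
  qed
  then have "f T - f 0 = (\<integral>t. W t \<partial>lborel)"
    using has_integral_unique has_integral_integral_lborel[OF W_int] by blast
  then have "ennreal (norm (f T - f 0)) \<le> (\<integral>\<^sup>+t. ennreal (norm (W t)) \<partial>lborel)"
    using integral_norm_bound_ennreal[OF W_int] by simp
  then have "ennreal m * ennreal (norm (f T - f 0)) \<le> ennreal m * (\<integral>\<^sup>+t. ennreal (norm (W t)) \<partial>lborel)"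
    by (intro mult_left_mono) auto
  also note W_le
  finally show ?thesis
    using m(1) by (simp add: f_def ennreal_mult')
qed

text \<open>A curve that stays in the coordinate ball is covered by the previous lemma. A curve that leaves it
has to travel at least \<open>2 * \<rho> / 3\<close> in coordinates before it exits, which is more than
\<open>norm (x - y)\<close>. The first exit happens on the sphere, since the closed ball has a compact and
therefore closed image in \<open>M\<close>.\<close>

lemma riemannian_dist_ge:
  assumes c: "c \<in> A" and K: "cball y0 \<rho> \<subseteq> chart_range c" and m: "0 < m"
    and lower: "\<And>z v. z \<in> cball y0 \<rho> \<Longrightarrow> m * norm v \<le> sqrt (v \<bullet> (chart_metric c z *v v))"
    and xy: "x \<in> ball y0 (\<rho> / 3)" "y \<in> ball y0 (\<rho> / 3)"
  shows "ennreal (m * norm (x - y)) \<le> riemannian_dist M A g (chart_inv c x) (chart_inv c y)"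
  unfolding riemannian_dist_def
proof (rule INF_greatest)
  fix \<gamma> assume "\<gamma> \<in> {\<gamma>. piecewise_C1_curve M A \<gamma> \<and> \<gamma> 0 = chart_inv c x \<and> \<gamma> 1 = chart_inv c y}"
  then have \<gamma>: "piecewise_C1_curve M A \<gamma>" and ends: "\<gamma> 0 = chart_inv c x" "\<gamma> 1 = chart_inv c y"
    by auto
  note \<gamma>' = piecewise_C1_curveD[OF \<gamma>]
  have \<rho>: "0 < \<rho>"
  proof -
    have "0 \<le> dist y0 x"
      by simp
    with xy(1) show ?thesis
      unfolding mem_ball by linarith
  qed
  have x: "x \<in> ball y0 \<rho>" and y: "y \<in> ball y0 \<rho>"
    using xy \<rho> by auto
  have B: "ball y0 \<rho> \<subseteq> chart_range c"
    using K by auto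
  have cx: "snd c (\<gamma> 0) = x" and cy: "snd c (\<gamma> 1) = y"
    using ends B x y chart_chart_inv[OF c] by auto
  define Kc where "Kc = chart_inv c ` cball y0 \<rho>"
  define U where "U = chart_inv c ` ball y0 \<rho>"
  have Kc_closed: "closed Kc"
    unfolding Kc_def
    by (intro compact_imp_closed compact_continuous_image continuous_on_subset[OF chart_inv_continuous[OF c] K]) simp
  have U_open: "openin (top_of_set M) U"
  proof -
    have "openin (top_of_set (chart_range c)) (ball y0 \<rho>)"
      using B by (intro open_subset) auto
    then have "openin (top_of_set (fst c)) U"
      unfolding U_def using chart_homeomorphism[OF c] homeomorphism_symD homeomorphism_imp_open_map by blast
    then show ?thesis
      using chart_openin[OF c] openin_trans by blast
  qed
  have Kc_coord: "p \<in> fst c" "snd c p \<in> cball y0 \<rho>" if "p \<in> Kc" for p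
    using that K chart_inv_in[OF c] chart_chart_inv[OF c] by (auto simp: Kc_def)
  have Kc_lower: "m * norm v \<le> metric_norm c p v" if "p \<in> Kc" for p v
  proof -
    obtain z where z: "z \<in> cball y0 \<rho>" "p = chart_inv c z"
      using \<open>p \<in> Kc\<close> by (auto simp: Kc_def)
    show ?thesis
      using lower[OF z(1), of v] by (simp add: metric_norm_def chart_metric_def z(2))
  qed
  have UK: "U \<subseteq> Kc"
    by (auto simp: U_def Kc_def)
  define Z where "Z = {t \<in> {0..1}. \<gamma> t \<notin> U}"
  show "ennreal (m * norm (x - y)) \<le> curve_length A g \<gamma>"
  proof (cases "Z = {}")
    case True
    then have inK: "\<gamma> t \<in> Kc" if "t \<in> {0..1}" for t
      using that UK by (auto simp: Z_def)
    have "ennreal (m * norm (snd c (\<gamma> 1) - snd c (\<gamma> 0))) \<le> curve_length A g \<gamma>"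
      by (rule curve_length_ge[OF \<gamma> c _ _ _ m]) (use inK Kc_coord Kc_lower in auto)
    then show ?thesis
      by (simp add: cx cy norm_minus_commute)
  next
    case False
    have "closed Z"
    proof -
      have "closedin (top_of_set M) (M - U)"
        using U_open by (simp add: closedin_diff)
      then have "closedin (top_of_set {0..1}) ({0..1} \<inter> \<gamma> -` (M - U))"
        using \<gamma>' by (intro continuous_closedin_preimage_gen[where T = M]) auto
      then have "closed ({0..1} \<inter> \<gamma> -` (M - U))"
        by (rule closedin_closed_trans) simp
      moreover have "{0..1} \<inter> \<gamma> -` (M - U) = Z"
        using \<gamma>'(2) by (auto simp: Z_def image_subset_iff)
      ultimately show ?thesis
        by simp
    qed
    \<comment> \<open>time of first exit from the open ball\<close>
    define T where "T = Inf Z"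
    have bdd: "bdd_below Z"
      by (rule bdd_belowI[of _ 0]) (auto simp: Z_def)
    have "T \<in> Z"
      unfolding T_def by (rule closed_contains_Inf[OF False bdd \<open>closed Z\<close>])
    then have T: "0 \<le> T" "T \<le> 1" "\<gamma> T \<notin> U"
      by (auto simp: Z_def)
    have before: "\<gamma> t \<in> U" if "t \<in> {0..<T}" for t
    proof (rule ccontr)
      assume "\<gamma> t \<notin> U"
      then have "t \<in> Z"
        using that T by (auto simp: Z_def)
      then have "T \<le> t"
        unfolding T_def using bdd by (rule cInf_lower)
      then show False
        using that by simp
    qed
    have "\<gamma> 0 \<in> U"
      using x by (simp add: ends U_def)
    then have "T \<noteq> 0"
      using T(3) by auto
    then have cl: "closure {0..<T} = {0..T}"
      using T(1) by simp
    have "\<gamma> ` closure {0..<T} \<subseteq> Kc"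
    proof (rule image_closure_subset[OF _ Kc_closed])
      show "continuous_on (closure {0..<T}) \<gamma>"
        unfolding cl by (rule continuous_on_subset[OF \<gamma>'(1)]) (use T in auto)
      show "\<gamma> ` {0..<T} \<subseteq> Kc"
        using before UK by blast
    qed
    then have inK: "\<gamma> t \<in> Kc" if "t \<in> {0..T}" for t
      using that unfolding cl by blast
    have len: "ennreal (m * norm (snd c (\<gamma> T) - snd c (\<gamma> 0))) \<le> curve_length A g \<gamma>"
      by (rule curve_length_ge[OF \<gamma> c T(1,2) _ m]) (use inK Kc_coord Kc_lower in auto)
    have "snd c (\<gamma> T) \<notin> ball y0 \<rho>"
    proof
      assume "snd c (\<gamma> T) \<in> ball y0 \<rho>"
      then have "chart_inv c (snd c (\<gamma> T)) \<in> U"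
        by (simp add: U_def)
      moreover have "\<gamma> T \<in> fst c"
        using inK[of T] T Kc_coord by auto
      ultimately show False
        using T(3) chart_inv_chart[OF c] by simp
    qed
    then have "\<rho> \<le> dist y0 (snd c (\<gamma> T))"
      by simp
    also have "\<dots> \<le> dist y0 x + norm (snd c (\<gamma> T) - x)"
      using dist_triangle[of y0 "snd c (\<gamma> T)" x] by (simp add: dist_norm norm_minus_commute)
    finally have far: "2 * \<rho> / 3 \<le> norm (snd c (\<gamma> T) - x)"
      using xy(1) by (simp add: field_simps)
    have "norm (x - y) \<le> dist y0 x + dist y0 y"
      using dist_triangle[of x y y0] by (simp add: dist_norm norm_minus_commute)
    with far xy have "norm (x - y) \<le> norm (snd c (\<gamma> T) - x)"
      by (simp add: field_simps)
    then have "ennreal (m * norm (x - y)) \<le> ennreal (m * norm (snd c (\<gamma> T) - snd c (\<gamma> 0)))"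
      using m by (intro ennreal_leI mult_left_mono) (auto simp: cx)
    also note len
    finally show ?thesis .
  qed
qed

end

section \<open>Coordinates that are almost isometric\<close>

lemma symmetric_inner_commute:
  fixes G :: "real ^ 'n::finite ^ 'n"
  assumes "transpose G = G"
  shows "u \<bullet> (G *v v) = v \<bullet> (G *v u)"
  by (metis assms dot_lmul_matrix inner_commute transpose_matrix_vector)

text \<open>Gram--Schmidt with respect to the inner product given by \<open>G\<close>, one index at a time: a family indexed
by fewer than \<open>n\<close> indices does not span, so there is a vector left to orthogonalise.\<close>

lemma orthonormal_family_exists:
  fixes G :: "real ^ 'n::finite ^ 'n"
  assumes sym: "transpose G = G" and pos: "\<And>v. v \<noteq> 0 \<Longrightarrow> 0 < v \<bullet> (G *v v)"
  shows "\<exists>b :: 'n \<Rightarrow> real ^ 'n. \<forall>i\<in>S. \<forall>j\<in>S. b i \<bullet> (G *v b j) = (if i = j then 1 else 0)"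
proof -
  have "finite S"
    by simp
  then show ?thesis
  proof (induction S rule: finite_induct)
    case empty
    show ?case
      by simp
  next
    case (insert k S)
    then obtain b :: "'n \<Rightarrow> real ^ 'n"
      where b: "\<And>i j. i \<in> S \<Longrightarrow> j \<in> S \<Longrightarrow> b i \<bullet> (G *v b j) = (if i = j then 1 else 0)"
      by blast
    have "card (insert k S) \<le> CARD('n)"
      by (intro card_mono) auto
    then have "card S < CARD('n)"
      using insert.hyps by simp
    moreover have "dim (b ` S) \<le> card (b ` S)"
      by (intro dim_le_card') simp
    moreover have "card (b ` S) \<le> card S"
      by (intro card_image_le) simp
    ultimately have "dim (b ` S) < DIM(real ^ 'n)"
      by simp
    then have "span (b ` S) \<noteq> UNIV"
      by (metis dim_UNIV dim_span less_irrefl)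
    then obtain v where v: "v \<notin> span (b ` S)"
      by blast
    define u where "u = v - (\<Sum>i\<in>S. (b i \<bullet> (G *v v)) *\<^sub>R b i)"
    have "(\<Sum>i\<in>S. (b i \<bullet> (G *v v)) *\<^sub>R b i) \<in> span (b ` S)"
      by (intro span_sum span_scale span_base) auto
    with v have "u \<noteq> 0"
      by (auto simp: u_def)
    then have u: "0 < u \<bullet> (G *v u)"
      by (rule pos)
    have ortho: "b j \<bullet> (G *v u) = 0" if j: "j \<in> S" for j
    proof -
      have "b j \<bullet> (G *v u) = b j \<bullet> (G *v v) - (\<Sum>i\<in>S. (b i \<bullet> (G *v v)) * (b j \<bullet> (G *v b i)))"
        by (simp add: u_def matrix_vector_mult_diff_distrib inner_diff_right linear_sum[OF matrix_vector_mul_linear]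
            matrix_vector_mult_scaleR inner_sum_right)
      also have "(\<Sum>i\<in>S. (b i \<bullet> (G *v v)) * (b j \<bullet> (G *v b i))) = (\<Sum>i\<in>S. if i = j then b i \<bullet> (G *v v) else 0)"
        using j by (intro sum.cong refl) (auto simp: b)
      also have "\<dots> = b j \<bullet> (G *v v)"
        using j by simp
      finally show ?thesis
        by simp
    qed
    define b' where "b' = b(k := (1 / sqrt (u \<bullet> (G *v u))) *\<^sub>R u)"
    have kS: "i \<noteq> k" if "i \<in> S" for i
      using that insert.hyps by auto
    have "b' i \<bullet> (G *v b' j) = (if i = j then 1 else 0)" if i: "i \<in> insert k S" and j: "j \<in> insert k S" for i j
    proof -
      consider "i = k" "j = k" | "i = k" "j \<in> S" "j \<noteq> k" | "i \<in> S" "i \<noteq> k" "j = k" | "i \<in> S" "j \<in> S" "i \<noteq> k" "j \<noteq> k"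
        using i j kS by auto
      then show ?thesis
      proof cases
        case 1
        have "sqrt (u \<bullet> (G *v u)) * sqrt (u \<bullet> (G *v u)) = u \<bullet> (G *v u)"
          using u by simp
        with 1 u show ?thesis
          by (simp add: b'_def matrix_vector_mult_scaleR)
      next
        case 2
        then show ?thesis
          using ortho[of j] by (simp add: b'_def symmetric_inner_commute[OF sym, of u "b j"])
      next
        case 3
        then show ?thesis
          using ortho[of i] by (simp add: b'_def matrix_vector_mult_scaleR)
      next
        case 4
        then show ?thesis
          by (simp add: b'_def b)
      qed
    qed
    then show ?case
      by blast
  qed
qed

text \<open>The columns of \<open>L\<close> form an orthonormal basis for \<open>G\<close>; in the coordinates \<open>u\<close> with \<open>x = L *v u\<close> the
inner product given by \<open>G\<close> becomes the Euclidean one.\<close>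

lemma positive_definite_congruent_mat1:
  fixes G :: "real ^ 'n::finite ^ 'n"
  assumes "transpose G = G" and "\<And>v. v \<noteq> 0 \<Longrightarrow> 0 < v \<bullet> (G *v v)"
  shows "\<exists>L :: real ^ 'n ^ 'n. transpose L ** G ** L = mat 1"
proof -
  obtain b :: "'n \<Rightarrow> real ^ 'n" where b: "\<And>i j. b i \<bullet> (G *v b j) = (if i = j then 1 else 0)"
    using orthonormal_family_exists[OF assms, of UNIV] by auto
  define L :: "real ^ 'n ^ 'n" where "L = (\<chi> i j. b j $ i)"
  have L: "L *v axis j 1 = b j" for j
    by (simp add: matrix_vector_mult_basis column_def L_def vec_eq_iff)
  have "(transpose L ** G ** L) $ i $ j = (if i = j then 1 else 0)" for i j
  proof -
    have "(transpose L ** G ** L) $ i $ j = axis i 1 \<bullet> ((transpose L ** G ** L) *v axis j 1)"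
      by (simp add: matrix_vector_mult_basis column_def inner_axis')
    also have "\<dots> = b i \<bullet> (G *v b j)"
      by (simp only: inner_congruence L)
    finally show ?thesis
      by (simp add: b)
  qed
  then have "transpose L ** G ** L = mat 1"
    by (simp add: vec_eq_iff mat_def)
  then show ?thesis ..
qed

lemma abs_inner_matrix_le:
  fixes E :: "real ^ 'n::finite ^ 'n"
  shows "\<bar>v \<bullet> (E *v v)\<bar> \<le> (\<Sum>i\<in>UNIV. \<Sum>j\<in>UNIV. \<bar>E $ i $ j\<bar>) * (norm v)\<^sup>2"
proof -
  have "v \<bullet> (E *v v) = (\<Sum>i\<in>UNIV. \<Sum>j\<in>UNIV. v $ i * (E $ i $ j * v $ j))"
    by (simp add: inner_vec_def matrix_vector_mult_def sum_distrib_left)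
  also have "\<bar>\<dots>\<bar> \<le> (\<Sum>i\<in>UNIV. \<Sum>j\<in>UNIV. \<bar>v $ i * (E $ i $ j * v $ j)\<bar>)"
    by (rule order_trans[OF sum_abs]) (intro sum_mono sum_abs)
  also have "\<dots> \<le> (\<Sum>i\<in>UNIV. \<Sum>j\<in>UNIV. \<bar>E $ i $ j\<bar> * (norm v)\<^sup>2)"
  proof (intro sum_mono)
    fix i j
    have "\<bar>v $ i\<bar> * \<bar>v $ j\<bar> \<le> norm v * norm v"
      by (intro mult_mono component_le_norm_cart) auto
    then have "\<bar>E $ i $ j\<bar> * (\<bar>v $ i\<bar> * \<bar>v $ j\<bar>) \<le> \<bar>E $ i $ j\<bar> * (norm v * norm v)"
      by (intro mult_left_mono) auto
    then show "\<bar>v $ i * (E $ i $ j * v $ j)\<bar> \<le> \<bar>E $ i $ j\<bar> * (norm v)\<^sup>2"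
      by (simp add: abs_mult power2_eq_square mult_ac)
  qed
  finally show ?thesis
    by (simp add: sum_distrib_right)
qed

lemma matrix_vector_mult_bound:
  fixes L :: "real ^ 'n::finite ^ 'n"
  obtains K where "0 < K" "\<And>u. norm (L *v u) \<le> K * norm u"
proof -
  have "\<exists>K>0. \<forall>u. norm (L *v u) \<le> norm u * K"
    by (rule bounded_linear.pos_bounded) simp
  then obtain K where "0 < K" and K: "\<forall>u. norm (L *v u) \<le> norm u * K"
    by blast
  have "norm (L *v u) \<le> K * norm u" for u
    using K by (simp add: mult.commute)
  with \<open>0 < K\<close> show ?thesis
    by (rule that)
qed

context riemannian_manifold
begin

text \<open>In the coordinates given by \<open>L\<close> the metric at \<open>x0\<close> is Euclidean, and by continuity it is nearly so
close to \<open>x0\<close>. The estimates for volumes and for distances from above have to be sharp; for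
distances from below any constant \<open>m\<close> will do.\<close>

lemma metric_near_point:
  assumes c: "c \<in> A" and x0: "x0 \<in> chart_range c"
    and L: "transpose L ** chart_metric c x0 ** L = mat 1" and \<eta>: "0 < \<eta>"
  shows "\<exists>\<rho>>0. \<exists>m>0. cball x0 \<rho> \<subseteq> chart_range c \<and> (\<forall>x\<in>cball x0 \<rho>.
    \<bar>sqrt (det (chart_metric c x)) * \<bar>det L\<bar> - 1\<bar> \<le> \<eta> \<and>
    (\<forall>u. sqrt ((L *v u) \<bullet> (chart_metric c x *v (L *v u))) \<le> (1 + \<eta>) * norm u) \<and>
    (\<forall>v. m * norm v \<le> sqrt (v \<bullet> (chart_metric c x *v v))))"
proof -
  let ?G = "chart_metric c"
  obtain K where K: "0 < K" "\<And>u. norm (L *v u) \<le> K * norm u"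
    using matrix_vector_mult_bound[of L] by blast
  define N where "N x = (\<Sum>i\<in>UNIV. \<Sum>j\<in>UNIV. \<bar>(?G x - ?G x0) $ i $ j\<bar>)" for x
  have G_cont: "continuous (at x0) ?G"
    using chart_metric_continuous[OF c] chart_range_open[OF c] x0 by (simp add: continuous_on_eq_continuous_at)
  have "continuous (at x0) N"
    unfolding N_def using G_cont by (intro continuous_intros) auto
  then have N_lim: "(N \<longlongrightarrow> N x0) (at x0)"
    by (simp add: isCont_def)
  have det_on: "continuous_on (chart_range c) (\<lambda>x. sqrt (det (?G x)) * \<bar>det L\<bar>)"
    by (intro continuous_intros continuous_on_det chart_metric_continuous c)
  then have "continuous (at x0) (\<lambda>x. sqrt (det (?G x)) * \<bar>det L\<bar>)"
    using chart_range_open[OF c] x0 by (simp add: continuous_on_eq_continuous_at)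
  then have det_lim: "((\<lambda>x. sqrt (det (?G x)) * \<bar>det L\<bar>) \<longlongrightarrow> sqrt (det (?G x0)) * \<bar>det L\<bar>) (at x0)"
    by (simp add: isCont_def)
  have "det L * det L * det (?G x0) = 1"
    using arg_cong[OF L, of det] by (simp add: det_mul mult_ac)
  then have "sqrt (det L * det L * det (?G x0)) = 1"
    by simp
  then have det1: "sqrt (det (?G x0)) * \<bar>det L\<bar> = 1"
    by (simp add: real_sqrt_mult mult.commute)
  \<comment> \<open>with \<open>K\<close> bounding \<open>L\<close>, a perturbation of the metric by \<open>e\<close> changes the quadratic form of \<open>L *v u\<close> by at
most \<open>min \<eta> (1 / 2) * (norm u)\<^sup>2\<close>\<close>
  define e where "e = min \<eta> (1 / 2) / K\<^sup>2"
  have e: "0 < e"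
    using \<eta> K by (simp add: e_def)
  have "\<forall>\<^sub>F x in at x0. N x < e"
    using order_tendstoD(2)[OF N_lim] e by (simp add: N_def)
  moreover have "\<forall>\<^sub>F x in at x0. dist (sqrt (det (?G x)) * \<bar>det L\<bar>) 1 < \<eta>"
    using tendstoD[OF det_lim \<eta>] det1 by simp
  moreover have "\<forall>\<^sub>F x in at x0. x \<in> chart_range c"
    using chart_range_open[OF c] x0 by (rule eventually_at_in_open')
  ultimately have "\<forall>\<^sub>F x in at x0. N x < e \<and> dist (sqrt (det (?G x)) * \<bar>det L\<bar>) 1 < \<eta> \<and> x \<in> chart_range c"
    by eventually_elim simp
  then obtain d where d: "0 < d"
    and near': "\<And>x. x \<noteq> x0 \<Longrightarrow> dist x x0 < d \<Longrightarrow>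
      N x < e \<and> dist (sqrt (det (?G x)) * \<bar>det L\<bar>) 1 < \<eta> \<and> x \<in> chart_range c"
    by (auto simp: eventually_at)
  have near: "N x < e \<and> dist (sqrt (det (?G x)) * \<bar>det L\<bar>) 1 < \<eta> \<and> x \<in> chart_range c"
    if "x \<in> cball x0 (d / 2)" for x
  proof (cases "x = x0")
    case True
    then show ?thesis
      using e \<eta> x0 det1 by (simp add: N_def)
  next
    case False
    then show ?thesis
      using that d by (intro near') (auto simp: dist_commute)
  qed
  have quad: "\<bar>(L *v u) \<bullet> (?G x *v (L *v u)) - (norm u)\<^sup>2\<bar> \<le> min \<eta> (1 / 2) * (norm u)\<^sup>2"
    if x: "x \<in> cball x0 (d / 2)" for x u
  proof -
    have "(L *v u) \<bullet> (?G x0 *v (L *v u)) = (norm u)\<^sup>2"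
      using inner_congruence[of u L "?G x0" u] unfolding L by (simp add: power2_norm_eq_inner)
    then have "(L *v u) \<bullet> (?G x *v (L *v u)) - (norm u)\<^sup>2 = (L *v u) \<bullet> ((?G x - ?G x0) *v (L *v u))"
      by (simp add: matrix_vector_mult_diff_rdistrib inner_diff_right)
    also have "\<bar>\<dots>\<bar> \<le> N x * (norm (L *v u))\<^sup>2"
      unfolding N_def by (rule abs_inner_matrix_le)
    also have "\<dots> \<le> e * (K * norm u)\<^sup>2"
      using near[OF x] K e by (intro mult_mono power_mono) auto
    also have "\<dots> = min \<eta> (1 / 2) * (norm u)\<^sup>2"
      using K(1) by (simp add: e_def power_mult_distrib)
    finally show ?thesis .
  qed
  define m where "m = sqrt (1 / (2 * K\<^sup>2))"
  show ?thesis
  proof (rule exI[of _ "d / 2"], intro exI[of _ m] conjI ballI allI)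
    show "0 < d / 2" "0 < m"
      using d K by (auto simp: m_def)
    show "cball x0 (d / 2) \<subseteq> chart_range c"
      using near by blast
  next
    fix x assume x: "x \<in> cball x0 (d / 2)"
    show "\<bar>sqrt (det (?G x)) * \<bar>det L\<bar> - 1\<bar> \<le> \<eta>"
      using near[OF x] by (simp add: dist_real_def)
  next
    fix x and u :: "real ^ 'n" assume x: "x \<in> cball x0 (d / 2)"
    have "min \<eta> (1 / 2) * (norm u)\<^sup>2 \<le> \<eta> * (norm u)\<^sup>2"
      by (intro mult_right_mono) auto
    with quad[OF x, of u] have "(L *v u) \<bullet> (?G x *v (L *v u)) \<le> (1 + \<eta>) * (norm u)\<^sup>2"
      by (simp add: algebra_simps)
    also have "\<dots> \<le> (1 + \<eta>)\<^sup>2 * (norm u)\<^sup>2"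
      using \<eta> by (intro mult_right_mono) (auto simp: power2_eq_square)
    also have "\<dots> = ((1 + \<eta>) * norm u)\<^sup>2"
      by (simp add: power_mult_distrib)
    finally have "sqrt ((L *v u) \<bullet> (?G x *v (L *v u))) \<le> sqrt (((1 + \<eta>) * norm u)\<^sup>2)"
      by (rule real_sqrt_le_mono)
    then show "sqrt ((L *v u) \<bullet> (?G x *v (L *v u))) \<le> (1 + \<eta>) * norm u"
      using \<eta> by simp
  next
    fix x and v :: "real ^ 'n" assume x: "x \<in> cball x0 (d / 2)"
    have "(transpose L ** ?G x0) ** L = mat 1"
      using L by simp
    then have "L ** (transpose L ** ?G x0) = mat 1"
      by (simp add: matrix_left_right_inverse)
    define u where "u = (transpose L ** ?G x0) *v v"
    have v: "v = L *v u"
      using \<open>L ** (transpose L ** ?G x0) = mat 1\<close> by (simp add: u_def matrix_vector_mul_assoc)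
    have "min \<eta> (1 / 2) * (norm u)\<^sup>2 \<le> 1 / 2 * (norm u)\<^sup>2"
      by (intro mult_right_mono) auto
    with quad[OF x, of u] have low: "(norm u)\<^sup>2 / 2 \<le> v \<bullet> (?G x *v v)"
      by (simp add: v)
    have "(norm v)\<^sup>2 \<le> (K * norm u)\<^sup>2"
      unfolding v by (intro power_mono K) simp
    then have "1 / (2 * K\<^sup>2) * (norm v)\<^sup>2 \<le> (norm u)\<^sup>2 / 2"
      using K(1) by (simp add: power_mult_distrib field_simps)
    then have "sqrt (1 / (2 * K\<^sup>2) * (norm v)\<^sup>2) \<le> sqrt (v \<bullet> (?G x *v v))"
      using low by (intro real_sqrt_le_mono) linarith
    moreover have "sqrt (1 / (2 * K\<^sup>2) * (norm v)\<^sup>2) = m * norm v"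
      unfolding m_def by (subst real_sqrt_mult) simp
    ultimately show "m * norm v \<le> sqrt (v \<bullet> (?G x *v v))"
      by (simp only:)
  qed
qed

end

context compact_riemannian_manifold
begin

text \<open>Around any point take coordinates in which the metric at that point is Euclidean, and compress the
ball of radius \<open>R\<close> by a factor \<open>\<delta>\<close> so small that it lands where the metric has hardly changed. The
segment bound for the distance yields the sharp lower bound on the kernel, whose exponent is
negative. Together with the triangle inequality it also shows that the distance is Lipschitz in
each coordinate ball, hence the kernel is measurable.\<close>

lemma euclidean_model_exists:
  assumes p0: "p0 \<in> M" and \<alpha>: "0 < \<alpha>" "\<alpha> < real CARD('n)"
    and R: "0 < R" and \<epsilon>: "0 < \<epsilon>" "\<epsilon> < 1"
  shows "\<exists>\<delta> C \<Phi> \<Psi> w. 0 \<le> C \<and>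
    euclidean_model (riemannian_volume M A g) (riemannian_kernel M A g \<alpha>) \<alpha> R \<epsilon> \<delta> C (\<Phi> :: real ^ 'n \<Rightarrow> 'a) \<Psi> w"
proof -
  define s where "s = real CARD('n) - \<alpha>"
  have s: "0 < s"
    using \<alpha> by (simp add: s_def)
  \<comment> \<open>a distortion of distances by \<open>1 + \<eta>\<close> changes the kernel by \<open>(1 + \<eta>) powr (- s)\<close>\<close>
  obtain \<eta> where \<eta>: "0 < \<eta>" "\<eta> < \<epsilon>" "1 - \<epsilon> < (1 + \<eta>) powr (- s)"
  proof -
    have "((\<lambda>\<eta>. (1 + \<eta>) powr (- s)) \<longlongrightarrow> (1 + 0) powr (- s)) (at_right (0 :: real))"
      by (intro tendsto_intros) auto
    then have "\<forall>\<^sub>F \<eta> in at_right (0 :: real). 1 - \<epsilon> < (1 + \<eta>) powr (- s)"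
      using \<epsilon> by (intro order_tendstoD(1)) auto
    moreover have "\<forall>\<^sub>F \<eta> in at_right (0 :: real). 0 < \<eta> \<and> \<eta> < \<epsilon>"
      using eventually_at_right_real[OF \<epsilon>(1)] by eventually_elim auto
    ultimately have "\<forall>\<^sub>F \<eta> in at_right (0 :: real). 0 < \<eta> \<and> \<eta> < \<epsilon> \<and> 1 - \<epsilon> < (1 + \<eta>) powr (- s)"
      by eventually_elim simp
    then obtain \<eta> where "0 < \<eta> \<and> \<eta> < \<epsilon> \<and> 1 - \<epsilon> < (1 + \<eta>) powr (- s)"
      using eventually_happens trivial_limit_at_right_real by blast
    then show ?thesis
      using that by blast
  qed
  obtain c where c: "c \<in> A" "p0 \<in> fst c"
    using point_in_chart[OF p0] by blast
  define x0 where "x0 = snd c p0"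
  have x0: "x0 \<in> chart_range c"
    unfolding x0_def by (rule chart_in_range[OF c])
  let ?G = "chart_metric c"
  have G0: "?G x0 = g c p0"
    using chart_inv_chart[OF c] by (simp add: chart_metric_def x0_def)
  have sym: "transpose (?G x0) = ?G x0"
    unfolding G0 using metric_symmetric[of "fst c" "snd c" p0] c by simp
  have pos: "0 < v \<bullet> (?G x0 *v v)" if "v \<noteq> 0" for v
    unfolding G0 using metric_pos_def[of "fst c" "snd c" p0 v] c that by simp
  have "\<exists>L :: real ^ 'n ^ 'n. transpose L ** ?G x0 ** L = mat 1"
    by (rule positive_definite_congruent_mat1[OF sym]) (rule pos)
  then obtain L :: "real ^ 'n ^ 'n" where L: "transpose L ** ?G x0 ** L = mat 1" ..
  obtain \<rho> m where \<rho>: "0 < \<rho>" and m: "0 < m" and K: "cball x0 \<rho> \<subseteq> chart_range c"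
    and near: "\<forall>x\<in>cball x0 \<rho>. \<bar>sqrt (det (?G x)) * \<bar>det L\<bar> - 1\<bar> \<le> \<eta> \<and>
      (\<forall>u. sqrt ((L *v u) \<bullet> (?G x *v (L *v u))) \<le> (1 + \<eta>) * norm u) \<and>
      (\<forall>v. m * norm v \<le> sqrt (v \<bullet> (?G x *v v)))"
    using metric_near_point[OF c(1) x0 L \<eta>(1)] by (elim exE conjE) (rule that)
  have dens: "\<bar>sqrt (det (?G x)) * \<bar>det L\<bar> - 1\<bar> \<le> \<eta>"
    and upper: "sqrt ((L *v u) \<bullet> (?G x *v (L *v u))) \<le> (1 + \<eta>) * norm u"
    and lower: "m * norm v \<le> sqrt (v \<bullet> (?G x *v v))"
    if "x \<in> cball x0 \<rho>" for x u v
    using bspec[OF near that] by blast+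
  define Li where "Li = transpose L ** ?G x0"
  have LiL: "Li *v (L *v u) = u" for u
    using L by (simp add: Li_def matrix_vector_mul_assoc)
  have LLi: "L *v (Li *v v) = v" for v
  proof -
    have "L ** Li = mat 1"
      using L by (simp add: Li_def matrix_left_right_inverse)
    then show ?thesis
      by (simp add: matrix_vector_mul_assoc)
  qed
  obtain k1 where k1: "0 < k1" "\<And>u. norm (L *v u) \<le> k1 * norm u"
    using matrix_vector_mult_bound[of L] by blast
  obtain k2 where k2: "0 < k2" "\<And>u. norm (Li *v u) \<le> k2 * norm u"
    using matrix_vector_mult_bound[of Li] by blast
  let ?B = "ball (0 :: real ^ 'n) R"
  \<comment> \<open>the compressed ball has to fit into \<open>ball x0 (\<rho> / 3)\<close>, where the lower distance bound holds\<close>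
  define \<delta> where "\<delta> = \<rho> / (3 * k1 * R)"
  have \<delta>: "0 < \<delta>"
    using \<rho> k1 R by (simp add: \<delta>_def)
  define \<theta> where "\<theta> u = x0 + \<delta> *\<^sub>R (L *v u)" for u
  have \<theta>_diff: "\<theta> v - \<theta> u = L *v (\<delta> *\<^sub>R (v - u))" for u v
    by (simp add: \<theta>_def matrix_vector_mult_scaleR matrix_vector_mult_diff_distrib scaleR_diff_right)
  have \<theta>_ball: "\<theta> u \<in> ball x0 (\<rho> / 3)" if "u \<in> ?B" for u
  proof -
    have "dist x0 (\<theta> u) = \<delta> * norm (L *v u)"
      using \<delta> by (simp add: \<theta>_def dist_norm)
    also have "\<dots> \<le> \<delta> * (k1 * norm u)"
      using \<delta> by (intro mult_left_mono k1) auto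
    also have "\<dots> < \<delta> * (k1 * R)"
      using that \<delta> k1 by simp
    also have "\<dots> = \<rho> / 3"
      using k1 R by (simp add: \<delta>_def)
    finally show ?thesis
      by simp
  qed
  have ball_sub: "ball x0 (\<rho> / 3) \<subseteq> cball x0 \<rho>"
    using \<rho> by auto
  have \<theta>_K: "\<theta> u \<in> cball x0 \<rho>" and \<theta>_range: "\<theta> u \<in> chart_range c" if "u \<in> ?B" for u
    using \<theta>_ball[OF that] ball_sub K by blast+
  define \<Phi> where "\<Phi> u = (if \<theta> u \<in> chart_range c then chart_inv c (\<theta> u) else p0)" for u
  define \<Psi> where "\<Psi> z = (1 / \<delta>) *\<^sub>R (Li *v ((if z \<in> fst c then snd c z else 0) - x0))" for z
  define w where "w u = indicator ?B u * (sqrt (det (?G (\<theta> u))) * \<bar>det L\<bar> * \<delta> powr real CARD('n))" for u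
  let ?\<mu> = "riemannian_volume M A g"
  let ?K = "riemannian_kernel M A g \<alpha>"
  have \<Phi>: "\<Phi> u = chart_inv c (\<theta> u)" if "u \<in> ?B" for u
    using \<theta>_range[OF that] by (simp add: \<Phi>_def)
  have \<Phi>_in: "\<Phi> u \<in> fst c" and \<Phi>_coord: "snd c (\<Phi> u) = \<theta> u" if "u \<in> ?B" for u
    using \<Phi>[OF that] \<theta>_range[OF that] chart_inv_in[OF c(1)] chart_chart_inv[OF c(1)] by auto
  have \<theta>_cont: "continuous_on X \<theta>" for X
    unfolding \<theta>_def by (intro continuous_intros)
  have [measurable]: "\<theta> \<in> borel_measurable borel"
    by (intro borel_measurable_continuous_onI \<theta>_cont)
  have \<Phi>_meas: "\<Phi> \<in> measurable borel ?\<mu>"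
  proof -
    have "\<Phi> \<in> measurable borel borel_M"
      unfolding \<Phi>_def by (rule measurable_compose[OF _ chart_inv_measurable[OF c(1) p0]]) simp
    then show ?thesis
      by (simp add: measurable_cong_sets[OF refl riemannian_volume_sets])
  qed
  have \<Psi>_meas: "\<Psi> \<in> borel_measurable ?\<mu>"
  proof -
    have "(\<lambda>x. (1 / \<delta>) *\<^sub>R (Li *v (x - x0))) \<in> borel_measurable borel"
      by (intro borel_measurable_continuous_onI continuous_on_scaleR continuous_on_const
          bounded_linear.continuous_on[OF matrix_vector_mul_bounded_linear] continuous_on_diff continuous_on_id)
    then have "\<Psi> \<in> borel_measurable borel_M"
      unfolding \<Psi>_def by (rule measurable_compose[OF chart_measurable[OF c(1)]])
    then show ?thesis
      by (simp add: measurable_cong_sets[OF riemannian_volume_sets refl])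
  qed
  have G\<theta>_cont: "continuous_on ?B (\<lambda>u. sqrt (det (?G (\<theta> u))) * \<bar>det L\<bar> * \<delta> powr real CARD('n))"
  proof -
    have "continuous_on ?B (\<lambda>u. ?G (\<theta> u))"
      by (rule continuous_on_compose2[OF chart_metric_continuous[OF c(1)] \<theta>_cont]) (use \<theta>_range in auto)
    then show ?thesis
      by (intro continuous_intros continuous_on_det)
  qed
  have w_meas: "w \<in> borel_measurable borel"
    using borel_measurable_continuous_on_indicator[OF _ G\<theta>_cont] by (simp add: w_def[abs_def])
  have \<Psi>\<Phi>: "\<Psi> (\<Phi> u) = u" if u: "u \<in> ?B" for u
  proof -
    have "\<Psi> (\<Phi> u) = (1 / \<delta>) *\<^sub>R (Li *v (\<theta> u - x0))"
      using \<Phi>_in[OF u] \<Phi>_coord[OF u] by (simp add: \<Psi>_def)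
    also have "\<dots> = (1 / \<delta>) *\<^sub>R (\<delta> *\<^sub>R u)"
      by (simp add: \<theta>_def matrix_vector_mult_scaleR LiL)
    finally show ?thesis
      using \<delta> by simp
  qed
  have image: "\<Phi> ` ?B = {z \<in> fst c. \<Psi> z \<in> ?B}"
  proof (intro equalityI subsetI)
    fix z assume "z \<in> \<Phi> ` ?B"
    then show "z \<in> {z \<in> fst c. \<Psi> z \<in> ?B}"
      using \<Phi>_in \<Psi>\<Phi> by force
  next
    fix z assume "z \<in> {z \<in> fst c. \<Psi> z \<in> ?B}"
    then have z: "z \<in> fst c" "\<Psi> z \<in> ?B"
      by auto
    have "\<theta> (\<Psi> z) = snd c z"
      using z(1) \<delta> by (simp add: \<theta>_def \<Psi>_def matrix_vector_mult_scaleR LLi)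
    then have "\<Phi> (\<Psi> z) = z"
      using \<Phi>[OF z(2)] chart_inv_chart[OF c(1) z(1)] by simp
    then show "z \<in> \<Phi> ` ?B"
      using z(2) by (metis imageI)
  qed
  have image_sets: "\<Phi> ` ?B \<in> sets borel_M"
  proof -
    have "\<Psi> -` ?B \<inter> space ?\<mu> \<in> sets ?\<mu>"
      by (rule measurable_sets[OF \<Psi>_meas]) simp
    moreover have "space ?\<mu> = M"
      using sets_eq_imp_space_eq[OF riemannian_volume_sets] by (simp add: space_restrict_space)
    ultimately have "fst c \<inter> (\<Psi> -` ?B \<inter> M) \<in> sets borel_M"
      using chart_borel_M[OF c(1)] by (simp add: riemannian_volume_sets sets.Int)
    moreover have "fst c \<inter> (\<Psi> -` ?B \<inter> M) = \<Phi> ` ?B"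
      unfolding image using chart_subset[OF c(1)] by blast
    ultimately show ?thesis
      by simp
  qed
  have image_fst: "\<Phi> ` ?B \<subseteq> fst c"
    using \<Phi>_in by blast
  \<comment> \<open>the affine map \<open>\<theta>\<close> has the constant Jacobian \<open>\<delta> ^ n * \<bar>det L\<bar>\<close>\<close>
  have volume: "emeasure ?\<mu> E = (\<integral>\<^sup>+u. ennreal (w u) * indicator (?B \<inter> \<Phi> -` E) u \<partial>lborel)"
    if E: "E \<in> sets borel_M" "E \<subseteq> \<Phi> ` ?B" for E
  proof -
    have Ec: "E \<subseteq> fst c"
      using E(2) image_fst by blast
    define S where "S = ?B \<inter> \<Phi> -` E"
    have S_borel: "S \<in> sets borel"
    proof -
      have "\<Phi> -` E \<inter> space borel \<in> sets borel"
        using \<Phi>_meas E(1) by (intro measurable_sets[OF \<Phi>_meas]) (simp add: riemannian_volume_sets)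
      then show ?thesis
        by (simp add: S_def)
    qed
    have \<theta>S: "\<theta> ` S = snd c ` E"
    proof (intro equalityI subsetI)
      fix x assume "x \<in> \<theta> ` S"
      then obtain u where u: "u \<in> ?B" "\<Phi> u \<in> E" "x = \<theta> u"
        by (auto simp: S_def)
      then show "x \<in> snd c ` E"
        using \<Phi>_coord[OF u(1)] by (metis imageI)
    next
      fix x assume "x \<in> snd c ` E"
      then obtain z where z: "z \<in> E" "x = snd c z"
        by blast
      then obtain u where u: "u \<in> ?B" "z = \<Phi> u"
        using E(2) by blast
      then show "x \<in> \<theta> ` S"
        using z \<Phi>_coord[OF u(1)] by (auto simp: S_def)
    qed
    define D where "D = (\<lambda>h. \<delta> *\<^sub>R (L *v h))"
    have "matrix D = matrix ((*\<^sub>R) \<delta> :: real ^ 'n \<Rightarrow> _) ** matrix ((*v) L)"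
      unfolding D_def by (subst matrix_compose[symmetric]) (auto simp: o_def linear_scaleR matrix_vector_mul_linear)
    then have "\<bar>det (matrix D)\<bar> = \<delta> ^ CARD('n) * \<bar>det L\<bar>"
      using \<delta> by (simp add: det_mul abs_mult)
    then have det_D: "\<bar>det (matrix D)\<bar> = \<bar>det L\<bar> * \<delta> powr real CARD('n)"
      using \<delta> by (simp add: powr_realpow)
    have "emeasure ?\<mu> E = chart_volume c E"
      by (rule riemannian_volume_chart[OF c(1) E(1) Ec])
    also have "\<dots> = (\<integral>\<^sup>+x. indicator (\<theta> ` S) x * (volume_density c x * indicator (\<theta> ` S) x) \<partial>lborel)"
      unfolding chart_volume_def \<theta>S by (intro nn_integral_cong) (auto simp: indicator_def)
    also have "\<dots> = (\<integral>\<^sup>+u. ennreal (indicator S u * \<bar>det (matrix D)\<bar>)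
        * (volume_density c (\<theta> u) * indicator (\<theta> ` S) (\<theta> u)) \<partial>lborel)"
    proof (rule nn_integral_change_of_variables[OF S_borel])
      show *: "\<theta> ` S \<in> sets borel"
        unfolding \<theta>S by (rule chart_image_borel[OF c(1) E(1) Ec])
      show "(\<theta> has_derivative D) (at u within S)" for u
        unfolding \<theta>_def D_def by (auto intro!: derivative_eq_intros bounded_linear_imp_has_derivative)
      show "inj_on \<theta> S"
        using \<Psi>\<Phi> \<Phi> by (intro inj_onI) (metis IntD1 S_def)
      show "(\<lambda>x. indicator S x * \<bar>det (matrix D)\<bar>) \<in> borel_measurable borel"
        using S_borel by measurable
      show "(\<lambda>x. volume_density c x * indicator (\<theta> ` S) x) \<in> borel_measurable borel"
        using * Ec by (intro volume_density_measurable[OF c(1)]) (auto simp: \<theta>S chart_range_def)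
    qed
    also have "\<dots> = (\<integral>\<^sup>+u. ennreal (w u) * indicator S u \<partial>lborel)"
    proof (rule nn_integral_cong)
      fix u
      show "ennreal (indicator S u * \<bar>det (matrix D)\<bar>) * (volume_density c (\<theta> u) * indicator (\<theta> ` S) (\<theta> u))
          = ennreal (w u) * indicator S u"
      proof (cases "u \<in> S")
        case True
        then have "u \<in> ?B"
          by (simp add: S_def)
        have "ennreal (\<bar>det L\<bar> * \<delta> powr real CARD('n)) * ennreal (sqrt (det (?G (\<theta> u))))
            = ennreal ((\<bar>det L\<bar> * \<delta> powr real CARD('n)) * sqrt (det (?G (\<theta> u))))"
          by (rule ennreal_mult'[symmetric]) simp
        then show ?thesis
          using True \<open>u \<in> ?B\<close> by (simp add: w_def volume_density_def det_D mult_ac)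
      qed simp
    qed
    finally show ?thesis
      by (simp add: S_def)
  qed
  have w_bounds: "(1 - \<epsilon>) * \<delta> powr real CARD('n) \<le> w u" "w u \<le> (1 + \<epsilon>) * \<delta> powr real CARD('n)"
    if u: "u \<in> ?B" for u
  proof -
    have "1 - \<epsilon> \<le> sqrt (det (?G (\<theta> u))) * \<bar>det L\<bar>" "sqrt (det (?G (\<theta> u))) * \<bar>det L\<bar> \<le> 1 + \<epsilon>"
      using dens[OF \<theta>_K[OF u]] \<eta>(2) by linarith+
    then show "(1 - \<epsilon>) * \<delta> powr real CARD('n) \<le> w u" "w u \<le> (1 + \<epsilon>) * \<delta> powr real CARD('n)"
      using u by (auto simp: w_def intro!: mult_right_mono)
  qed
  define d where "d u v = riemannian_dist M A g (\<Phi> u) (\<Phi> v)" for u v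
  have d_upper: "d u v \<le> ennreal ((1 + \<eta>) * \<delta> * norm (u - v))" if u: "u \<in> ?B" and v: "v \<in> ?B" for u v
  proof -
    have seg: "closed_segment (\<theta> u) (\<theta> v) \<subseteq> cball x0 \<rho>"
      by (intro closed_segment_subset \<theta>_K u v convex_cball)
    have "riemannian_dist M A g (chart_inv c (\<theta> u)) (chart_inv c (\<theta> v))
        \<le> ennreal ((1 + \<eta>) * norm (\<delta> *\<^sub>R (v - u)))"
    proof (rule riemannian_dist_segment_le[OF c(1)])
      show "closed_segment (\<theta> u) (\<theta> v) \<subseteq> chart_range c"
        using seg K by blast
      show "sqrt ((\<theta> v - \<theta> u) \<bullet> (?G z *v (\<theta> v - \<theta> u))) \<le> (1 + \<eta>) * norm (\<delta> *\<^sub>R (v - u))"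
        if "z \<in> closed_segment (\<theta> u) (\<theta> v)" for z
        unfolding \<theta>_diff using that seg by (intro upper) blast
    qed
    then show ?thesis
      using \<delta> u v by (simp add: d_def \<Phi> norm_minus_commute mult.assoc)
  qed
  have d_lower: "ennreal (m * \<delta> / k2 * norm (u - v)) \<le> d u v" if u: "u \<in> ?B" and v: "v \<in> ?B" for u v
  proof -
    have "norm (\<delta> *\<^sub>R (u - v)) \<le> k2 * norm (\<theta> u - \<theta> v)"
      unfolding \<theta>_diff using k2(2)[of "L *v (\<delta> *\<^sub>R (u - v))"] by (simp add: LiL)
    then have "\<delta> * norm (u - v) \<le> k2 * norm (\<theta> u - \<theta> v)"
      using \<delta> by (simp only: norm_scaleR abs_of_pos)
    then have "\<delta> * norm (u - v) / k2 \<le> norm (\<theta> u - \<theta> v)"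
      using k2(1) by (simp add: pos_divide_le_eq mult.commute)
    then have "m * (\<delta> * norm (u - v) / k2) \<le> m * norm (\<theta> u - \<theta> v)"
      using m by (intro mult_left_mono) auto
    then have "ennreal (m * \<delta> / k2 * norm (u - v)) \<le> ennreal (m * norm (\<theta> u - \<theta> v))"
      by (intro ennreal_leI) (simp add: mult_ac)
    also have "\<dots> \<le> riemannian_dist M A g (chart_inv c (\<theta> u)) (chart_inv c (\<theta> v))"
      by (rule riemannian_dist_ge[OF c(1) K m lower \<theta>_ball[OF u] \<theta>_ball[OF v]])
    finally show ?thesis
      using u v by (simp add: d_def \<Phi>)
  qed
  define r where "r u v = enn2real (d u v)" for u v
  have d_fin: "d u v \<noteq> \<infinity>" if "u \<in> ?B" "v \<in> ?B" for u v
    using d_upper[OF that] by (auto simp: top_unique)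
  have d_r: "d u v = ennreal (r u v)" if "u \<in> ?B" "v \<in> ?B" for u v
    using d_fin[OF that] by (simp add: r_def top.not_eq_extremum)
  have r0: "0 \<le> r u v" for u v
    by (simp add: r_def)
  have r_upper: "r u v \<le> (1 + \<eta>) * \<delta> * norm (u - v)" if "u \<in> ?B" "v \<in> ?B" for u v
    using d_upper[OF that] unfolding d_r[OF that] using \<eta> \<delta> by (simp add: ennreal_le_iff)
  have r_lower: "m * \<delta> / k2 * norm (u - v) \<le> r u v" if "u \<in> ?B" "v \<in> ?B" for u v
    using d_lower[OF that] unfolding d_r[OF that] using r0 by (simp add: ennreal_le_iff)
  have kernel: "?K (\<Phi> u) (\<Phi> v) = 1 / r u v powr s" if "u \<in> ?B" "v \<in> ?B" for u v
    using d_fin[OF that] by (simp add: riemannian_kernel_def Let_def d_def r_def s_def)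
  define C where "C = (m * \<delta> / k2) powr (- s)"
  have kernel_bounds: "(1 - \<epsilon>) * \<delta> powr (\<alpha> - real CARD('n)) * euclidean_kernel \<alpha> u v \<le> ?K (\<Phi> u) (\<Phi> v)"
      "?K (\<Phi> u) (\<Phi> v) \<le> C * euclidean_kernel \<alpha> u v"
    if u: "u \<in> ?B" and v: "v \<in> ?B" for u v
  proof -
    have ek: "euclidean_kernel \<alpha> u v = norm (u - v) powr (- s)"
      by (simp add: euclidean_kernel_def s_def)
    have Kr: "?K (\<Phi> u) (\<Phi> v) = r u v powr (- s)"
      unfolding kernel[OF u v] by (simp add: powr_minus_divide)
    show "?K (\<Phi> u) (\<Phi> v) \<le> C * euclidean_kernel \<alpha> u v"
    \<comment> \<open>on the diagonal both kernels have the value \<open>0\<close>\<close>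
    proof (cases "u = v")
      case True
      then have "r u v = 0"
        using r_upper[OF u v] r0[of u v] by simp
      then show ?thesis
        unfolding Kr ek by (simp add: True)
    next
      case False
      then have pos: "0 < m * \<delta> / k2 * norm (u - v)"
        using m \<delta> k2 by simp
      have "r u v powr (- s) \<le> (m * \<delta> / k2 * norm (u - v)) powr (- s)"
        using pos r_lower[OF u v] s by (intro powr_mono2') auto
      also have "\<dots> = C * norm (u - v) powr (- s)"
        unfolding C_def by (rule powr_mult)
      finally show ?thesis
        by (simp add: Kr ek)
    qed
    show "(1 - \<epsilon>) * \<delta> powr (\<alpha> - real CARD('n)) * euclidean_kernel \<alpha> u v \<le> ?K (\<Phi> u) (\<Phi> v)"
    \<comment> \<open>on the diagonal both kernels have the value \<open>0\<close>\<close>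
    proof (cases "u = v")
      case True
      then show ?thesis
        unfolding Kr ek by simp
    next
      case False
      have "0 < m * \<delta> / k2 * norm (u - v)"
        using m \<delta> k2 False by simp
      then have pos: "0 < r u v"
        using r_lower[OF u v] by linarith
      have "(1 - \<epsilon>) * (\<delta> powr (- s) * norm (u - v) powr (- s))
          \<le> (1 + \<eta>) powr (- s) * (\<delta> powr (- s) * norm (u - v) powr (- s))"
        using \<eta>(3) by (intro mult_right_mono) auto
      also have "\<dots> = ((1 + \<eta>) * \<delta> * norm (u - v)) powr (- s)"
        using \<eta> \<delta> by (simp add: powr_mult)
      also have "\<dots> \<le> r u v powr (- s)"
        using pos r_upper[OF u v] s by (intro powr_mono2') auto
      finally show ?thesis
        by (simp add: Kr ek s_def mult.assoc)
    qed
  qed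
  \<comment> \<open>by the triangle inequality and the upper bound on \<open>r\<close>\<close>
  have r_cont: "continuous_on ?B (r u)" if u: "u \<in> ?B" for u
  proof -
    have tri: "r u v \<le> r u v' + (1 + \<eta>) * \<delta> * norm (v' - v)" if v: "v \<in> ?B" and v': "v' \<in> ?B" for v v'
    proof -
      have "ennreal (r u v) \<le> ennreal (r u v') + ennreal (r v' v)"
        unfolding d_r[OF u v, symmetric] d_r[OF u v', symmetric] d_r[OF v' v, symmetric] d_def
        by (rule riemannian_dist_triangle)
      then have "ennreal (r u v) \<le> ennreal (r u v' + r v' v)"
        using r0 by simp
      then have "r u v \<le> r u v' + r v' v"
        using r0 by (subst (asm) ennreal_le_iff) (auto intro: add_nonneg_nonneg)
      with r_upper[OF v' v] show ?thesis
        by linarith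
    qed
    have "dist (r u v) (r u v') \<le> ((1 + \<eta>) * \<delta>) * dist v v'" if "v \<in> ?B" "v' \<in> ?B" for v v'
      using tri[OF that] tri[OF that(2,1)] by (simp add: dist_real_def dist_norm norm_minus_commute)
    then have "((1 + \<eta>) * \<delta>)-lipschitz_on ?B (r u)"
      using \<eta> \<delta> by (intro lipschitz_onI) auto
    then show ?thesis
      by (rule lipschitz_on_continuous_on)
  qed
  have kernel_meas: "(\<lambda>z. indicator (\<Phi> ` ?B) z * ?K (\<Phi> u) z) \<in> borel_measurable ?\<mu>" if u: "u \<in> ?B" for u
  proof -
    define \<kappa> where "\<kappa> v = (if v \<in> ?B then r u v else 0)" for v
    have [measurable]: "\<kappa> \<in> borel_measurable borel"
      unfolding \<kappa>_def by (intro borel_measurable_continuous_on_if r_cont u continuous_on_const) simp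
    note [measurable] = \<Psi>_meas
    have [measurable]: "\<Phi> ` ?B \<in> sets ?\<mu>"
      using image_sets by (simp add: riemannian_volume_sets)
    have "(\<lambda>z. indicator (\<Phi> ` ?B) z * (1 / \<kappa> (\<Psi> z) powr s)) \<in> borel_measurable ?\<mu>"
      by measurable
    moreover have "indicator (\<Phi> ` ?B) z * ?K (\<Phi> u) z = indicator (\<Phi> ` ?B) z * (1 / \<kappa> (\<Psi> z) powr s)" for z
    proof (cases "z \<in> \<Phi> ` ?B")
      case True
      then obtain v where v: "v \<in> ?B" "z = \<Phi> v"
        by blast
      have "\<kappa> (\<Psi> z) = r u v"
        unfolding v(2) \<Psi>\<Phi>[OF v(1)] using v(1) by (simp add: \<kappa>_def)
      then show ?thesis
        using kernel[OF u v(1)] v(2) by simp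
    qed simp
    ultimately show ?thesis
      by simp
  qed
  have "euclidean_model ?\<mu> ?K \<alpha> R \<epsilon> \<delta> C \<Phi> \<Psi> w"
    unfolding euclidean_model_def
    using \<delta> \<Phi>_meas \<Psi>_meas w_meas image_sets \<Psi>\<Phi> volume w_bounds kernel_bounds kernel_meas
    by (simp add: riemannian_volume_sets del: mem_ball)
  moreover have "0 \<le> C"
    by (simp add: C_def)
  ultimately show ?thesis
    by blast
qed

end

theorem proposition1p2:
  fixes M :: "'a::t2_space set"
    and A :: "('a, 'n::finite) chart set"
    and g :: "('a, 'n) metric_coeffs"
    and \<alpha> p q :: real
  assumes "riemannian_manifold M A g"
    and "compact M" and "M \<noteq> {}"
    and "0 < \<alpha>" and "\<alpha> < real CARD('n)"
    and "1 < p" and "p < real CARD('n) / \<alpha>"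
    and "1 / q = 1 / p - \<alpha> / real CARD('n)"
  shows "N_manifold M A g p \<alpha> q \<ge> N_euclidean TYPE('n) p \<alpha> q"
proof -
  interpret riemannian_manifold M A g
    by fact
  interpret compact_riemannian_manifold M A g
    by unfold_locales fact
  obtain p0 where p0: "p0 \<in> M"
    using \<open>M \<noteq> {}\<close> by blast
  have "\<alpha> / real CARD('n) < 1 / p"
    using assms(4,6,7) by (simp add: field_simps)
  then have "0 < 1 / q"
    using assms(8) by simp
  then have q: "0 < q"
    by simp
  have p: "0 < p"
    using assms(6) by simp
  show ?thesis
    unfolding N_manifold_def N_euclidean_def
    by (rule sharp_const_euclidean_le[OF assms(4,5) p q assms(8)])
      (rule euclidean_model_exists[OF p0 assms(4,5)])
qed

end
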